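(* $M_\Omega(n,\mathfrak e)$ is an $n^2$-dimensional Zariski closed affine nonsingular (irreducible) subvariety of the nonsingular affine variety $\mathfrak e_{\Omega(n)}\times M_\Omega(n)$.
   Context: Fix a positive integer $n$; $I_k=\{1,\dots,k\}$, $d(k)=k(k+1)/2$. Varieties are irreducible by convention. $M(n)$ is the space of complex $n\times n$ matrices; for $x\in M(n)$ and $m\in I_n$, $x_m$ is the upper left $m\times m$ block of $x$. $M_\Omega(n)$ is the Zariski open set of all $x\in M(n)$ such that $x_m$ has $m$ distinct eigenvalues for every $m\in I_n$, and $x_m,x_{m+1}$ have no common eigenvalue for every $m\in I_{n-1}$. $\mathfrak e_{\Omega(n)}$ is the set of all $\nu=(\nu(1),\dots,\nu(n))$, $\nu(m)=\mathrm{diag}(\nu_{1\,m},\dots,\nu_{m\,m})$, such that for each $m\in I_n$ the numbers $\nu_{1\,m},\dots,\nu_{m\,m}$ are distinct and $\nu_{i\,m}\ne\nu_{j\,m+1}$ for all $m\in I_{n-1}$, $i\in I_m$, $j\in I_{m+1}$; it is a Zariski open subset of $\mathbb C^{d(n)}$. Both $M_\Omega(n)$ and $\mathfrak e_{\Omega(n)}$ are nonsingular affine varieties. Let $$M_\Omega(n,\mathfrak e)=\{(\nu,x)\in\mathfrak e_{\Omega(n)}\times M_\Omega(n)\mid \nu(m)\text{ is } Gl(m)\text{-conjugate to }x_m\ \forall m\in I_n\}.$$ *)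

theory Defs
  imports
    "HOL-Analysis.Abstract_Topology"
    "HOL-Library.Extended_Nat"
    "HOL-Library.Function_Algebras"
    "Jordan_Normal_Form.Spectral_Radius"
begin

section \<open>Quasi-affine complex varieties\<close>

text \<open>
  A point of the affine space with finite coordinate set \<open>I\<close> is a function vanishing outside \<open>I\<close>.
  Since the field is infinite, polynomials in the coordinates from \<open>I\<close> may be identified with the
  functions that they induce.
\<close>

definition affine_space :: "'i set \<Rightarrow> ('i \<Rightarrow> complex) set" where
  "affine_space I = {p. \<forall>i. i \<notin> I \<longrightarrow> p i = 0}"

inductive_set poly_funs :: "'i set \<Rightarrow> (('i \<Rightarrow> complex) \<Rightarrow> complex) set" for I where
  const: "(\<lambda>p. c) \<in> poly_funs I"
| coord: "i \<in> I \<Longrightarrow> (\<lambda>p. p i) \<in> poly_funs I"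
| add: "f \<in> poly_funs I \<Longrightarrow> g \<in> poly_funs I \<Longrightarrow> (\<lambda>p. f p + g p) \<in> poly_funs I"
| mult: "f \<in> poly_funs I \<Longrightarrow> g \<in> poly_funs I \<Longrightarrow> (\<lambda>p. f p * g p) \<in> poly_funs I"

definition zero_locus :: "'i set \<Rightarrow> (('i \<Rightarrow> complex) \<Rightarrow> complex) set \<Rightarrow> ('i \<Rightarrow> complex) set" where
  "zero_locus I F = {p \<in> affine_space I. \<forall>f\<in>F. f p = 0}"

definition zariski_open :: "'i set \<Rightarrow> ('i \<Rightarrow> complex) set \<Rightarrow> bool" where
  "zariski_open I U \<longleftrightarrow> (\<exists>F \<subseteq> poly_funs I. U = affine_space I - zero_locus I F)"

definition zariski :: "'i set \<Rightarrow> ('i \<Rightarrow> complex) topology" where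
  "zariski I = topology (zariski_open I)"

lemma istopology_zariski_open: "istopology (zariski_open I)"
  unfolding istopology_def
proof (intro conjI allI impI)
  fix S T :: "('a \<Rightarrow> complex) set"
  assume "zariski_open I S" "zariski_open I T"
  then obtain F G where F: "F \<subseteq> poly_funs I" "S = affine_space I - zero_locus I F"
    and G: "G \<subseteq> poly_funs I" "T = affine_space I - zero_locus I G"
    unfolding zariski_open_def by blast
  let ?H = "{\<lambda>p. f p * g p | f g. f \<in> F \<and> g \<in> G}"
  have sub: "?H \<subseteq> poly_funs I"
    using F(1) G(1) by (auto intro!: poly_funs.mult)
  have "S \<inter> T = affine_space I - zero_locus I ?H"
  proof (intro Set.set_eqI iffI)
    fix p assume "p \<in> S \<inter> T"
    then obtain f g where "p \<in> affine_space I" "f \<in> F" "f p \<noteq> 0" "g \<in> G" "g p \<noteq> 0"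
      unfolding F(2) G(2) zero_locus_def by auto
    moreover from this have "(\<lambda>p. f p * g p) \<in> ?H" by blast
    ultimately show "p \<in> affine_space I - zero_locus I ?H"
      unfolding zero_locus_def by force
  next
    fix p assume "p \<in> affine_space I - zero_locus I ?H"
    then show "p \<in> S \<inter> T"
      unfolding F(2) G(2) zero_locus_def by auto
  qed
  with sub show "zariski_open I (S \<inter> T)"
    unfolding zariski_open_def by blast
next
  fix K :: "('a \<Rightarrow> complex) set set"
  assume "\<forall>S\<in>K. zariski_open I S"
  then obtain F where F: "\<And>S. S \<in> K \<Longrightarrow> F S \<subseteq> poly_funs I \<and> S = affine_space I - zero_locus I (F S)"
    unfolding zariski_open_def by metis
  have "p \<in> \<Union>K \<longleftrightarrow> p \<in> affine_space I - zero_locus I (\<Union>S\<in>K. F S)" for p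
  proof -
    have "p \<in> \<Union>K \<longleftrightarrow> (\<exists>S\<in>K. p \<in> affine_space I - zero_locus I (F S))"
      using F by blast
    also have "\<dots> \<longleftrightarrow> p \<in> affine_space I - zero_locus I (\<Union>S\<in>K. F S)"
      unfolding zero_locus_def by auto
    finally show ?thesis .
  qed
  then have "\<Union>K = affine_space I - zero_locus I (\<Union>S\<in>K. F S)"
    by blast
  moreover have "(\<Union>S\<in>K. F S) \<subseteq> poly_funs I"
    using F by blast
  ultimately show "zariski_open I (\<Union>K)"
    unfolding zariski_open_def by blast
qed

lemma openin_zariski: "openin (zariski I) U \<longleftrightarrow> zariski_open I U"
  by (simp add: zariski_def istopology_zariski_open)

lemma topspace_zariski: "topspace (zariski I) = affine_space I"
proof -
  have "zariski_open I (affine_space I)"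
    unfolding zariski_open_def zero_locus_def
    by (rule exI[of _ "{\<lambda>p. 1}"]) (auto intro: poly_funs.const)
  moreover have "U \<subseteq> affine_space I" if "zariski_open I U" for U
    using that unfolding zariski_open_def by blast
  ultimately show ?thesis
    unfolding topspace_def openin_zariski by blast
qed

lemma closedin_zariski:
  "closedin (zariski I) V \<longleftrightarrow> (\<exists>F \<subseteq> poly_funs I. V = zero_locus I F)"
proof -
  have sub: "zero_locus I F \<subseteq> affine_space I" for F :: "(('a \<Rightarrow> complex) \<Rightarrow> complex) set"
    by (auto simp: zero_locus_def)
  have "V \<subseteq> affine_space I \<and> affine_space I - V = affine_space I - zero_locus I F
      \<longleftrightarrow> V = zero_locus I F" for F
    using sub[of F] by (simp add: set_eq_iff subset_iff) metis
  then show ?thesis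
    unfolding closedin_def topspace_zariski openin_zariski zariski_open_def by metis
qed

definition irreducible_space :: "'a topology \<Rightarrow> bool" where
  "irreducible_space T \<longleftrightarrow> topspace T \<noteq> {} \<and>
     (\<forall>A B. closedin T A \<and> closedin T B \<and> A \<union> B = topspace T
        \<longrightarrow> A = topspace T \<or> B = topspace T)"

definition krull_dim :: "'a topology \<Rightarrow> enat" where
  "krull_dim T = Sup {enat k | k. \<exists>Z :: nat \<Rightarrow> 'a set.
     (\<forall>i\<le>k. closedin T (Z i) \<and> irreducible_space (subtopology T (Z i))) \<and>
     (\<forall>i<k. Z i \<subset> Z (Suc i))}"

definition quasi_affine_variety :: "'i set \<Rightarrow> ('i \<Rightarrow> complex) set \<Rightarrow> bool" where
  "quasi_affine_variety I X \<longleftrightarrow> finite I \<and>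
     (\<exists>U V. openin (zariski I) U \<and> closedin (zariski I) V \<and> X = U \<inter> V) \<and>
     irreducible_space (subtopology (zariski I) X)"

definition regular_fun_on ::
    "'i set \<Rightarrow> ('i \<Rightarrow> complex) set \<Rightarrow> (('i \<Rightarrow> complex) \<Rightarrow> complex) \<Rightarrow> bool" where
  "regular_fun_on I X f \<longleftrightarrow>
     (\<forall>p\<in>X. \<exists>U. openin (subtopology (zariski I) X) U \<and> p \<in> U \<and>
        (\<exists>g\<in>poly_funs I. \<exists>h\<in>poly_funs I. \<forall>q\<in>U. h q \<noteq> 0 \<and> f q = g q / h q))"

definition morphism ::
    "'i set \<Rightarrow> ('i \<Rightarrow> complex) set \<Rightarrow> 'j set \<Rightarrow> ('j \<Rightarrow> complex) set
      \<Rightarrow> (('i \<Rightarrow> complex) \<Rightarrow> ('j \<Rightarrow> complex)) \<Rightarrow> bool" where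
  "morphism I X J Y \<phi> \<longleftrightarrow> \<phi> ` X \<subseteq> Y \<and> (\<forall>j\<in>J. regular_fun_on I X (\<lambda>p. \<phi> p j))"

definition isomorphic_varieties ::
    "'i set \<Rightarrow> ('i \<Rightarrow> complex) set \<Rightarrow> 'j set \<Rightarrow> ('j \<Rightarrow> complex) set \<Rightarrow> bool" where
  "isomorphic_varieties I X J Y \<longleftrightarrow>
     (\<exists>\<phi> \<psi>. morphism I X J Y \<phi> \<and> morphism J Y I X \<psi> \<and>
        (\<forall>p\<in>X. \<psi> (\<phi> p) = p) \<and> (\<forall>q\<in>Y. \<phi> (\<psi> q) = q))"

text \<open>A variety is affine if it is isomorphic to a closed subvariety of some affine space.\<close>

definition affine_variety :: "'i set \<Rightarrow> ('i \<Rightarrow> complex) set \<Rightarrow> bool" where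
  "affine_variety I X \<longleftrightarrow> quasi_affine_variety I X \<and>
     (\<exists>N Y. closedin (zariski {..<N::nat}) Y \<and> isomorphic_varieties I X {..<N} Y)"

text \<open>
  The Zariski tangent space at \<open>p\<close>: the common kernel of the differentials at \<open>p\<close> of all
  polynomials vanishing on \<open>X\<close>. For locally closed \<open>X\<close> these polynomials are the ideal of the
  closure of \<open>X\<close>, in which \<open>X\<close> is open, so this is the tangent space of \<open>X\<close> itself.
\<close>

definition tangent_space ::
    "'i set \<Rightarrow> ('i \<Rightarrow> complex) set \<Rightarrow> ('i \<Rightarrow> complex) \<Rightarrow> ('i \<Rightarrow> complex) set" where
  "tangent_space I X p = {v \<in> affine_space I.
     \<forall>f\<in>poly_funs I. (\<forall>q\<in>X. f q = 0) \<longrightarrow>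
       ((\<lambda>t. f (\<lambda>i. p i + t * v i)) has_field_derivative 0) (at 0)}"

definition cscale :: "complex \<Rightarrow> ('i \<Rightarrow> complex) \<Rightarrow> 'i \<Rightarrow> complex" where
  "cscale c v = (\<lambda>i. c * v i)"

interpretation cfun: vector_space cscale
  by standard (auto simp: cscale_def fun_eq_iff algebra_simps)

text \<open>
  As varieties are irreducible, the local dimension at every point is the dimension of the
  whole variety.
\<close>

definition nonsingular :: "'i set \<Rightarrow> ('i \<Rightarrow> complex) set \<Rightarrow> bool" where
  "nonsingular I X \<longleftrightarrow>
     (\<forall>p\<in>X. enat (cfun.dim (tangent_space I X p)) = krull_dim (subtopology (zariski I) X))"


section \<open>The sets \<open>M\<^sub>\<Omega>(n)\<close>, \<open>\<ee>\<^sub>\<Omega>\<^sub>(\<^sub>n\<^sub>)\<close> and \<open>M\<^sub>\<Omega>(n, \<ee>)\<close>\<close>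

definition lead_block :: "complex mat \<Rightarrow> nat \<Rightarrow> complex mat" where
  "lead_block x m = mat m m (\<lambda>(i, j). x $$ (i, j))"

definition M_Omega :: "nat \<Rightarrow> complex mat set" where
  "M_Omega n = {x \<in> carrier_mat n n.
     (\<forall>m\<in>{1..n}. card (spectrum (lead_block x m)) = m) \<and>
     (\<forall>m\<in>{1..<n}. spectrum (lead_block x m) \<inter> spectrum (lead_block x (Suc m)) = {})}"

text \<open>
  Matrix indices start at 0, so \<open>\<nu>\<^sub>i\<^sub>m\<close> with \<open>1 \<le> i \<le> m \<le> n\<close> is stored at the index \<open>(i - 1, m)\<close>.
\<close>

definition triangle_index :: "nat \<Rightarrow> (nat \<times> nat) set" where
  "triangle_index n = {(i, m). i < m \<and> m \<le> n}"

definition diag_part :: "(nat \<times> nat \<Rightarrow> complex) \<Rightarrow> nat \<Rightarrow> complex mat" where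
  "diag_part \<nu> m = mat_diag m (\<lambda>i. \<nu> (i, m))"

definition e_Omega :: "nat \<Rightarrow> (nat \<times> nat \<Rightarrow> complex) set" where
  "e_Omega n = {\<nu> \<in> affine_space (triangle_index n).
     (\<forall>m\<in>{1..n}. inj_on (\<lambda>i. \<nu> (i, m)) {..<m}) \<and>
     (\<forall>m\<in>{1..<n}. \<forall>i<m. \<forall>j<Suc m. \<nu> (i, m) \<noteq> \<nu> (j, Suc m))}"

definition M_Omega_e :: "nat \<Rightarrow> ((nat \<times> nat \<Rightarrow> complex) \<times> complex mat) set" where
  "M_Omega_e n = {(\<nu>, x) \<in> e_Omega n \<times> M_Omega n.
     \<forall>m\<in>{1..n}. similar_mat (diag_part \<nu> m) (lead_block x m)}"

text \<open>
  Coordinates on \<open>\<complex>\<^bsup>d(n)\<^esup> \<times> M(n)\<close>: the left summand of the index set carries \<open>\<nu>\<close>, the right one the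
  entries of \<open>x\<close>.
\<close>

definition pair_index :: "nat \<Rightarrow> ((nat \<times> nat) + (nat \<times> nat)) set" where
  "pair_index n = triangle_index n <+> ({..<n} \<times> {..<n})"

definition mat_coords :: "complex mat \<Rightarrow> nat \<times> nat \<Rightarrow> complex" where
  "mat_coords x = (\<lambda>(i, j). if i < dim_row x \<and> j < dim_col x then x $$ (i, j) else 0)"

definition pair_coords ::
    "(nat \<times> nat \<Rightarrow> complex) \<times> complex mat \<Rightarrow> (nat \<times> nat) + (nat \<times> nat) \<Rightarrow> complex" where
  "pair_coords = (\<lambda>(\<nu>, x). case_sum \<nu> (mat_coords x))"

lemma bij_betw_pair_coords:
  "bij_betw pair_coords (affine_space (triangle_index n) \<times> carrier_mat n n) (affine_space (pair_index n))"
proof (rule bij_betw_byWitness[where f' = "\<lambda>p. (p \<circ> Inl, mat n n (p \<circ> Inr))"])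
  show "\<forall>a\<in>affine_space (triangle_index n) \<times> carrier_mat n n.
      (pair_coords a \<circ> Inl, mat n n (pair_coords a \<circ> Inr)) = a"
    by (auto simp: pair_coords_def mat_coords_def fun_eq_iff intro!: eq_matI)
  show "\<forall>p\<in>affine_space (pair_index n). pair_coords (p \<circ> Inl, mat n n (p \<circ> Inr)) = p"
    by (auto simp: pair_coords_def mat_coords_def fun_eq_iff affine_space_def pair_index_def
        split: sum.splits)
  show "pair_coords ` (affine_space (triangle_index n) \<times> carrier_mat n n) \<subseteq> affine_space (pair_index n)"
    by (auto simp: pair_coords_def mat_coords_def affine_space_def pair_index_def split: sum.splits)
      blast
  show "(\<lambda>p. (p \<circ> Inl, mat n n (p \<circ> Inr))) ` affine_space (pair_index n)
      \<subseteq> affine_space (triangle_index n) \<times> carrier_mat n n"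
    by (force simp: affine_space_def pair_index_def)
qed

end

theory Submission
  imports
    Defs
    "Subresultants.Subresultant_Gcd"
    "HOL-Computational_Algebra.Field_as_Ring"
begin

text \<open>
  If the columns of \<open>g\<close> are eigenvectors of \<open>x\<^sub>m\<close> for the eigenvalues \<open>\<nu>\<^sub>k\<close> and the border column of
  \<open>x\<^sub>m\<^sub>+\<^sub>1\<close> is \<open>g b\<close>, then the eigenvector of \<open>x\<^sub>m\<^sub>+\<^sub>1\<close> for \<open>\<mu>\<close> with last entry 1 is
  \<open>g (b\<^sub>k / (\<mu> - \<nu>\<^sub>k))\<^sub>k\<close>. Hence \<open>x\<close> can be recovered rationally from the eigenvalues and the border
  coefficients \<open>b\<close>, which are nonzero but otherwise arbitrary, and \<open>M\<^sub>\<Omega>(n, \<ee>)\<close> is isomorphic to the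
  nonempty Zariski open subset of \<open>\<complex>\<^sup>n\<^sup>\<times>\<^sup>n\<close> formed by these parameters. Irreducibility, dimension and
  tangent spaces are transported along this isomorphism. The dimension of an open subset of an affine
  space is bounded by counting monomials: a chain of \<open>k + 1\<close> irreducible closed sets yields \<open>k\<close>
  algebraically independent polynomials.
\<close>

section \<open>Polynomial functions and fractions\<close>

text \<open>The Omega conditions explain why the border coefficients are nonzero. In the eigenbasis
  of the smaller block the eigenvector equation reads \<open>(\<mu> - \<nu>_k) R_k = b_k r\<close>,
  with \<open>r\<close> the last entry. If some \<open>b_k\<close> were 0, the k-th coordinate of
  every eigenvector of the larger block would vanish, and these vectors could not span. Conversely,
  the Cauchy numbers \<open>1 / (\<mu>_j - \<nu>_k)\<close> together with a row of ones form an
  invertible matrix, so nonzero \<open>b_k\<close> always give independent columns. The border rows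
  carry no parameters: \<open>G D G^{-1}\<close>, with \<open>G\<close> the eigenvector matrix of
  level n, determines all of x, and d(n) + d(n-1) = n^2 parameters remain. The obstacle is that this
  matrix is prescribed at level n only, while every smaller block must have the right eigenvalues
  too. Descending from n works because the bordered smaller matrix satisfies the same eigenvector
  equations in its first m rows, and an invertible eigenvector matrix leaves only one choice for
  these rows. Closedness uses another description: the numbers \<nu>_jm being distinct, conjugacy
  amounts to the equations \<open>det (x_m - \<nu>_jm) = 0\<close>.\<close>

lemma poly_funs_uminus: "f \<in> poly_funs I \<Longrightarrow> (\<lambda>p. - f p) \<in> poly_funs I"
  using poly_funs.mult[OF poly_funs.const[of "-1"]] by fastforce

lemma poly_funs_diff:
  "f \<in> poly_funs I \<Longrightarrow> g \<in> poly_funs I \<Longrightarrow> (\<lambda>p. f p - g p) \<in> poly_funs I"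
  using poly_funs.add[OF _ poly_funs_uminus] by fastforce

lemma poly_funs_sum:
  "(\<And>a. a \<in> A \<Longrightarrow> f a \<in> poly_funs I) \<Longrightarrow> (\<lambda>p. \<Sum>a\<in>A. f a p) \<in> poly_funs I"
  by (induction A rule: infinite_finite_induct) (auto intro: poly_funs.intros)

lemma poly_funs_prod:
  "(\<And>a. a \<in> A \<Longrightarrow> f a \<in> poly_funs I) \<Longrightarrow> (\<lambda>p. \<Prod>a\<in>A. f a p) \<in> poly_funs I"
  by (induction A rule: infinite_finite_induct) (auto intro: poly_funs.intros)

lemma poly_funs_power: "f \<in> poly_funs I \<Longrightarrow> (\<lambda>p. f p ^ a) \<in> poly_funs I"
  by (induction a) (auto intro: poly_funs.intros)

lemma poly_funs_cong: "f \<in> poly_funs I \<Longrightarrow> (\<And>i. i \<in> I \<Longrightarrow> p i = q i) \<Longrightarrow> f p = f q"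
  by (induction rule: poly_funs.induct) auto

lemma poly_funs_comp:
  "f \<in> poly_funs I \<Longrightarrow> (\<And>i. i \<in> I \<Longrightarrow> (\<lambda>p. \<phi> p i) \<in> poly_funs J) \<Longrightarrow> (\<lambda>p. f (\<phi> p)) \<in> poly_funs J"
  by (induction rule: poly_funs.induct) (auto intro: poly_funs.intros)

text \<open>Restriction to lines is the common tool for irreducibility, for strictness of chains and
  for behaviour near a point: each becomes a statement about the roots of one univariate
  polynomial.\<close>

lemma poly_funs_line:
  assumes "f \<in> poly_funs I"
  shows "\<exists>P. \<forall>t. f (\<lambda>i. p i + t * v i) = poly P t"
  using assms
proof (induction rule: poly_funs.induct)
  case (const c)
  show ?case by (rule exI[of _ "[:c:]"]) simp
next
  case (coord i)
  show ?case by (rule exI[of _ "[:p i, v i:]"]) simp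
next
  case (add f g)
  then show ?case by (metis poly_add)
next
  case (mult f g)
  then show ?case by (metis poly_mult)
qed

text \<open>One global fraction, where \<open>regular_fun_on\<close> allows a different one near
  each point. All maps constructed below are of this kind, and global fractions are easily combined
  and substituted.\<close>

definition frac_funs ::
    "'i set \<Rightarrow> ('i \<Rightarrow> complex) set \<Rightarrow> (('i \<Rightarrow> complex) \<Rightarrow> complex) set" where
  "frac_funs I X =
     {f. \<exists>g\<in>poly_funs I. \<exists>h\<in>poly_funs I. \<forall>p\<in>X. h p \<noteq> 0 \<and> f p = g p / h p}"

lemma frac_funsE:
  assumes "f \<in> frac_funs I X"
  obtains g h where "g \<in> poly_funs I" "h \<in> poly_funs I"
    "\<forall>p\<in>X. h p \<noteq> 0" "\<forall>p\<in>X. f p = g p / h p"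
  using assms unfolding frac_funs_def by blast

lemma frac_funsI:
  assumes "g \<in> poly_funs I" "h \<in> poly_funs I"
    "\<And>p. p \<in> X \<Longrightarrow> h p \<noteq> 0" "\<And>p. p \<in> X \<Longrightarrow> f p = g p / h p"
  shows "f \<in> frac_funs I X"
  using assms unfolding frac_funs_def by blast

lemma frac_funs_cong:
  assumes "f \<in> frac_funs I X" "\<And>p. p \<in> X \<Longrightarrow> f p = f' p"
  shows "f' \<in> frac_funs I X"
proof -
  obtain g h where "g \<in> poly_funs I" "h \<in> poly_funs I"
    "\<forall>p\<in>X. h p \<noteq> 0" "\<forall>p\<in>X. f p = g p / h p"
    using assms(1) by (rule frac_funsE)
  then show ?thesis
    using assms(2) by (intro frac_funsI[of g I h]) auto
qed

lemma frac_funs_mono: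
  assumes "f \<in> frac_funs I X" "Y \<subseteq> X"
  shows "f \<in> frac_funs I Y"
proof -
  obtain g h where "g \<in> poly_funs I" "h \<in> poly_funs I"
    "\<forall>p\<in>X. h p \<noteq> 0" "\<forall>p\<in>X. f p = g p / h p"
    using assms(1) by (rule frac_funsE)
  then show ?thesis
    using assms(2) by (intro frac_funsI[of g I h]) auto
qed

lemma poly_funs_frac: "f \<in> poly_funs I \<Longrightarrow> f \<in> frac_funs I X"
  by (rule frac_funsI[OF _ poly_funs.const[of 1]]) auto

lemma frac_funs_const: "(\<lambda>p. c) \<in> frac_funs I X"
  by (intro poly_funs_frac poly_funs.const)

lemma frac_funs_coord: "i \<in> I \<Longrightarrow> (\<lambda>p. p i) \<in> frac_funs I X"
  by (intro poly_funs_frac poly_funs.coord)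

lemma frac_funs_add:
  assumes "f \<in> frac_funs I X" "g \<in> frac_funs I X"
  shows "(\<lambda>p. f p + g p) \<in> frac_funs I X"
proof -
  obtain a b where f: "a \<in> poly_funs I" "b \<in> poly_funs I"
    "\<forall>p\<in>X. b p \<noteq> 0" "\<forall>p\<in>X. f p = a p / b p"
    using assms(1) by (rule frac_funsE)
  obtain c d where g: "c \<in> poly_funs I" "d \<in> poly_funs I"
    "\<forall>p\<in>X. d p \<noteq> 0" "\<forall>p\<in>X. g p = c p / d p"
    using assms(2) by (rule frac_funsE)
  show ?thesis
    by (rule frac_funsI[where g = "\<lambda>p. a p * d p + c p * b p" and h = "\<lambda>p. b p * d p"])
      (auto simp: f g add_frac_eq intro!: poly_funs.add poly_funs.mult)
qed

lemma frac_funs_mult: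
  assumes "f \<in> frac_funs I X" "g \<in> frac_funs I X"
  shows "(\<lambda>p. f p * g p) \<in> frac_funs I X"
proof -
  obtain a b where f: "a \<in> poly_funs I" "b \<in> poly_funs I"
    "\<forall>p\<in>X. b p \<noteq> 0" "\<forall>p\<in>X. f p = a p / b p"
    using assms(1) by (rule frac_funsE)
  obtain c d where g: "c \<in> poly_funs I" "d \<in> poly_funs I"
    "\<forall>p\<in>X. d p \<noteq> 0" "\<forall>p\<in>X. g p = c p / d p"
    using assms(2) by (rule frac_funsE)
  show ?thesis
    by (rule frac_funsI[where g = "\<lambda>p. a p * c p" and h = "\<lambda>p. b p * d p"])
      (auto simp: f g intro!: poly_funs.mult)
qed

lemma frac_funs_inverse:
  assumes "f \<in> frac_funs I X" "\<And>p. p \<in> X \<Longrightarrow> f p \<noteq> 0"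
  shows "(\<lambda>p. inverse (f p)) \<in> frac_funs I X"
proof -
  obtain a b where f: "a \<in> poly_funs I" "b \<in> poly_funs I"
    "\<forall>p\<in>X. b p \<noteq> 0" "\<forall>p\<in>X. f p = a p / b p"
    using assms(1) by (rule frac_funsE)
  show ?thesis
    by (rule frac_funsI[where g = b and h = a]) (use f assms(2) in auto)
qed

lemma frac_funs_divide:
  assumes "f \<in> frac_funs I X" "g \<in> frac_funs I X" "\<And>p. p \<in> X \<Longrightarrow> g p \<noteq> 0"
  shows "(\<lambda>p. f p / g p) \<in> frac_funs I X"
  using frac_funs_mult[OF assms(1) frac_funs_inverse[OF assms(2,3)]] by (simp add: field_simps)

lemma frac_funs_diff:
  assumes "f \<in> frac_funs I X" "g \<in> frac_funs I X"
  shows "(\<lambda>p. f p - g p) \<in> frac_funs I X"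
  using frac_funs_add[OF assms(1) frac_funs_mult[OF frac_funs_const[of "-1"] assms(2)]] by simp

lemma frac_funs_sum:
  "(\<And>a. a \<in> A \<Longrightarrow> f a \<in> frac_funs I X) \<Longrightarrow> (\<lambda>p. \<Sum>a\<in>A. f a p) \<in> frac_funs I X"
  by (induction A rule: infinite_finite_induct) (auto intro: frac_funs_const frac_funs_add)

lemma poly_funs_comp_frac:
  "f \<in> poly_funs I \<Longrightarrow> (\<And>i. i \<in> I \<Longrightarrow> (\<lambda>p. \<phi> p i) \<in> frac_funs J X) \<Longrightarrow>
    (\<lambda>p. f (\<phi> p)) \<in> frac_funs J X"
  by (induction rule: poly_funs.induct)
    (auto intro: frac_funs_const frac_funs_add frac_funs_mult)

lemma frac_funs_regular:
  assumes "f \<in> frac_funs I X" "X \<subseteq> affine_space I"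
  shows "regular_fun_on I X f"
proof -
  have "openin (subtopology (zariski I) X) X"
    using openin_topspace[of "subtopology (zariski I) X"] assms(2)
    by (simp add: topspace_zariski inf_absorb2)
  then show ?thesis
    using assms(1) unfolding regular_fun_on_def frac_funs_def by blast
qed

section \<open>Irreducibility and dimension\<close>

lemma closedin_subtopology_zariski:
  assumes "X \<subseteq> affine_space I"
  shows "closedin (subtopology (zariski I) X) A \<longleftrightarrow>
    (\<exists>F\<subseteq>poly_funs I. A = {p\<in>X. \<forall>f\<in>F. f p = 0})"
proof -
  have "zero_locus I F \<inter> X = {p\<in>X. \<forall>f\<in>F. f p = 0}" for F
    using assms by (auto simp: zero_locus_def)
  then show ?thesis
    unfolding closedin_subtopology closedin_zariski by metis
qed

lemma topspace_subtopology_zariski: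
  "X \<subseteq> affine_space I \<Longrightarrow> topspace (subtopology (zariski I) X) = X"
  by (simp add: topspace_zariski inf_absorb2)

text \<open>The right-hand side says that the vanishing ideal is prime. If two proper closed subsets
  covered \<open>X\<close>, an equation of each that fails somewhere would give two functions whose
  product vanishes on \<open>X\<close>.\<close>

lemma irreducible_zariski_iff:
  assumes X: "X \<subseteq> affine_space I"
  shows "irreducible_space (subtopology (zariski I) X) \<longleftrightarrow> X \<noteq> {} \<and>
    (\<forall>f\<in>poly_funs I. \<forall>g\<in>poly_funs I. (\<forall>p\<in>X. f p * g p = 0) \<longrightarrow>
       (\<forall>p\<in>X. f p = 0) \<or> (\<forall>p\<in>X. g p = 0))" (is "?L \<longleftrightarrow> _ \<and> ?R")
proof (intro iffI conjI)
  assume L: ?L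
  then show "X \<noteq> {}"
    unfolding irreducible_space_def topspace_subtopology_zariski[OF X] by blast
  show ?R
  proof (intro ballI impI)
    fix f g assume fg: "f \<in> poly_funs I" "g \<in> poly_funs I" "\<forall>p\<in>X. f p * g p = 0"
    have cl: "closedin (subtopology (zariski I) X) {p\<in>X. h p = 0}" if "h \<in> poly_funs I" for h
      unfolding closedin_subtopology_zariski[OF X] by (rule exI[of _ "{h}"]) (use that in auto)
    have "{p\<in>X. f p = 0} \<union> {p\<in>X. g p = 0} = X"
      using fg(3) by auto
    then have "{p\<in>X. f p = 0} = X \<or> {p\<in>X. g p = 0} = X"
      using L cl[OF fg(1)] cl[OF fg(2)]
      unfolding irreducible_space_def topspace_subtopology_zariski[OF X] by blast
    then show "(\<forall>p\<in>X. f p = 0) \<or> (\<forall>p\<in>X. g p = 0)"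
      by blast
  qed
next
  assume "X \<noteq> {} \<and> ?R"
  then have ne: "X \<noteq> {}" and R: ?R by auto
  show ?L
    unfolding irreducible_space_def topspace_subtopology_zariski[OF X]
  proof (intro conjI ne allI impI)
    fix A B
    assume "closedin (subtopology (zariski I) X) A \<and> closedin (subtopology (zariski I) X) B
      \<and> A \<union> B = X"
    then obtain F G where F: "F \<subseteq> poly_funs I" "A = {p\<in>X. \<forall>f\<in>F. f p = 0}"
      and G: "G \<subseteq> poly_funs I" "B = {p\<in>X. \<forall>f\<in>G. f p = 0}" and AB: "A \<union> B = X"
      unfolding closedin_subtopology_zariski[OF X] by blast
    show "A = X \<or> B = X"
    proof (rule ccontr)
      assume "\<not> (A = X \<or> B = X)"
      then obtain p q f g where p: "p \<in> X" "f \<in> F" "f p \<noteq> 0" and q: "q \<in> X" "g \<in> G" "g q \<noteq> 0"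
        using F(2) G(2) by auto
      have "\<forall>p\<in>X. f p * g p = 0"
        using AB F(2) G(2) p(2) q(2) by auto
      then show False
        using R p q F(1) G(1) by blast
    qed
  qed
qed

lemma zariski_openE:
  assumes "openin (zariski I) U" "p \<in> U"
  obtains f where "f \<in> poly_funs I" "f p \<noteq> 0"
    "\<And>q. q \<in> affine_space I \<Longrightarrow> f q \<noteq> 0 \<Longrightarrow> q \<in> U"
  using assms unfolding openin_zariski zariski_open_def zero_locus_def by auto

text \<open>Restricting to the line through two points reduces the claim to the fact that nonzero
  univariate polynomials have finitely many roots.\<close>

lemma irreducible_line_closed:
  assumes S: "S \<subseteq> affine_space I" "\<And>a b t. a \<in> S \<Longrightarrow> b \<in> S \<Longrightarrow> (\<lambda>i. a i + t * (b i - a i)) \<in> S"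
    and U: "openin (zariski I) U" and ne: "S \<inter> U \<noteq> {}"
  shows "irreducible_space (subtopology (zariski I) (S \<inter> U))"
proof -
  have X: "S \<inter> U \<subseteq> affine_space I" using S(1) by auto
  have False if fg: "f \<in> poly_funs I" "g \<in> poly_funs I" "\<forall>p\<in>S \<inter> U. f p * g p = 0"
    and a: "a \<in> S \<inter> U" "f a \<noteq> 0" and b: "b \<in> S \<inter> U" "g b \<noteq> 0" for f g a b
  proof -
    \<comment> \<open>\<open>h\<close> certifies membership in \<open>U\<close>: the point sought on
      the line must also avoid the zeros of \<open>h\<close>.\<close>
    obtain h where h: "h \<in> poly_funs I" "h a \<noteq> 0"
      "\<And>q. q \<in> affine_space I \<Longrightarrow> h q \<noteq> 0 \<Longrightarrow> q \<in> U"
      using zariski_openE[OF U] a(1) by blast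
    define l where "l t = (\<lambda>i. a i + t * (b i - a i))" for t
    obtain P Q R where P: "\<And>t. f (l t) = poly P t" and Q: "\<And>t. g (l t) = poly Q t"
      and R: "\<And>t. h (l t) = poly R t"
      using poly_funs_line[OF fg(1)] poly_funs_line[OF fg(2)] poly_funs_line[OF h(1)]
      unfolding l_def by metis
    have l: "l 0 = a" "l 1 = b" by (auto simp: l_def)
    have "P \<noteq> 0" "Q \<noteq> 0" "R \<noteq> 0"
      using P[of 0] Q[of 1] R[of 0] a b h(2) l by auto
    then have "P * Q * R \<noteq> 0" by simp
    then obtain t where "poly (P * Q * R) t \<noteq> 0"
      using poly_all_0_iff_0 by blast
    then have t: "f (l t) \<noteq> 0" "g (l t) \<noteq> 0" "h (l t) \<noteq> 0"
      using P Q R by auto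
    have "l t \<in> S" unfolding l_def using S(2) a b by auto
    moreover have "l t \<in> U" using h(3) t(3) S(1) \<open>l t \<in> S\<close> by auto
    ultimately show False using fg(3) t by auto
  qed
  then show ?thesis
    unfolding irreducible_zariski_iff[OF X] using ne by blast
qed

lemma irreducible_zariski_open:
  assumes "openin (zariski I) U" "U \<noteq> {}"
  shows "irreducible_space (subtopology (zariski I) U)"
proof -
  have "U \<subseteq> affine_space I" using openin_subset[OF assms(1)] by (simp add: topspace_zariski)
  then have "affine_space I \<inter> U = U" by auto
  then show ?thesis
    using irreducible_line_closed[of "affine_space I" I U] assms by (simp add: affine_space_def)
qed

section \<open>Polynomial functions of bounded degree and monomial counting\<close>

definition deg_space :: "'i set \<Rightarrow> nat \<Rightarrow> (('i \<Rightarrow> complex) \<Rightarrow> complex) set" where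
  "deg_space I d = cfun.span ((\<lambda>\<beta> p. \<Prod>i\<in>I. p i ^ \<beta> i) ` (I \<rightarrow>\<^sub>E {..d}))"

lemma deg_space_mono: "d \<le> e \<Longrightarrow> deg_space I d \<subseteq> deg_space I e"
  unfolding deg_space_def by (intro cfun.span_mono image_mono PiE_mono) auto

lemma monomial_in_deg_space:
  assumes "\<And>i. i \<in> I \<Longrightarrow> \<beta> i \<le> d"
  shows "(\<lambda>p. \<Prod>i\<in>I. p i ^ \<beta> i) \<in> deg_space I d"
proof -
  have "(\<lambda>p. \<Prod>i\<in>I. p i ^ \<beta> i) = (\<lambda>p::'a \<Rightarrow> complex. \<Prod>i\<in>I. p i ^ restrict \<beta> I i)"
    by (intro ext prod.cong) auto
  moreover have "restrict \<beta> I \<in> I \<rightarrow>\<^sub>E {..d}" using assms by auto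
  ultimately show ?thesis
    unfolding deg_space_def by (intro cfun.span_base image_eqI)
qed

lemma deg_space_add:
  "f \<in> deg_space I d \<Longrightarrow> g \<in> deg_space I d \<Longrightarrow> (\<lambda>p. f p + g p) \<in> deg_space I d"
  using cfun.span_add[of f _ g] unfolding deg_space_def plus_fun_def by blast

lemma deg_space_scale: "f \<in> deg_space I d \<Longrightarrow> (\<lambda>p. c * f p) \<in> deg_space I d"
  using cfun.span_scale[of f _ c] unfolding deg_space_def cscale_def by blast

lemma deg_space_zero: "(\<lambda>p. 0) \<in> deg_space I d"
  using cfun.span_zero unfolding deg_space_def zero_fun_def by blast

lemma deg_space_minimal:
  assumes "\<And>\<beta>. \<beta> \<in> I \<rightarrow>\<^sub>E {..d} \<Longrightarrow> (\<lambda>p. \<Prod>i\<in>I. p i ^ \<beta> i) \<in> T"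
    and "(\<lambda>p. 0) \<in> T" "\<And>f g. f \<in> T \<Longrightarrow> g \<in> T \<Longrightarrow> (\<lambda>p. f p + g p) \<in> T"
    and "\<And>c f. f \<in> T \<Longrightarrow> (\<lambda>p. c * f p) \<in> T"
  shows "deg_space I d \<subseteq> T"
  unfolding deg_space_def
proof (rule cfun.span_minimal)
  show "cfun.subspace T"
    using assms(2-4) by (intro cfun.subspaceI) (simp_all add: zero_fun_def plus_fun_def cscale_def)
qed (use assms(1) in auto)

text \<open>By bilinearity it suffices to multiply monomials, whose exponents add.
  \<open>deg_space_minimal\<close> performs this reduction for one factor at a time.\<close>

lemma deg_space_mult:
  assumes "f \<in> deg_space I d" "g \<in> deg_space I e"
  shows "(\<lambda>p. f p * g p) \<in> deg_space I (d + e)"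
proof -
  have *: "deg_space I e \<subseteq> {g. (\<lambda>p. (\<Prod>i\<in>I. p i ^ \<beta> i) * g p) \<in> deg_space I (d + e)}"
    if \<beta>: "\<beta> \<in> I \<rightarrow>\<^sub>E {..d}" for \<beta>
  proof (rule deg_space_minimal; unfold mem_Collect_eq)
    fix \<gamma> assume \<gamma>: "\<gamma> \<in> I \<rightarrow>\<^sub>E {..e}"
    have "(\<lambda>p::'a \<Rightarrow> complex. \<Prod>i\<in>I. p i ^ (\<beta> i + \<gamma> i)) \<in> deg_space I (d + e)"
      using \<beta> \<gamma> by (intro monomial_in_deg_space add_mono) auto
    then show "(\<lambda>p::'a \<Rightarrow> complex. (\<Prod>i\<in>I. p i ^ \<beta> i) * (\<Prod>i\<in>I. p i ^ \<gamma> i)) \<in> deg_space I (d + e)"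
      by (simp add: power_add prod.distrib)
  next
    show "(\<lambda>p::'a \<Rightarrow> complex. (\<Prod>i\<in>I. p i ^ \<beta> i) * 0) \<in> deg_space I (d + e)"
      using deg_space_zero by simp
  next
    fix f g :: "('a \<Rightarrow> complex) \<Rightarrow> complex"
    assume "(\<lambda>p. (\<Prod>i\<in>I. p i ^ \<beta> i) * f p) \<in> deg_space I (d + e)"
      "(\<lambda>p. (\<Prod>i\<in>I. p i ^ \<beta> i) * g p) \<in> deg_space I (d + e)"
    from deg_space_add[OF this]
    show "(\<lambda>p. (\<Prod>i\<in>I. p i ^ \<beta> i) * (f p + g p)) \<in> deg_space I (d + e)"
      by (simp add: distrib_left)
  next
    fix c and f :: "('a \<Rightarrow> complex) \<Rightarrow> complex"
    assume "(\<lambda>p. (\<Prod>i\<in>I. p i ^ \<beta> i) * f p) \<in> deg_space I (d + e)"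
    from deg_space_scale[OF this, of c]
    show "(\<lambda>p. (\<Prod>i\<in>I. p i ^ \<beta> i) * (c * f p)) \<in> deg_space I (d + e)"
      by (simp add: mult.left_commute)
  qed
  have "deg_space I d \<subseteq> {f. (\<lambda>p. f p * g p) \<in> deg_space I (d + e)}"
  proof (rule deg_space_minimal; unfold mem_Collect_eq)
    fix \<beta> assume "\<beta> \<in> I \<rightarrow>\<^sub>E {..d}"
    then show "(\<lambda>p. (\<Prod>i\<in>I. p i ^ \<beta> i) * g p) \<in> deg_space I (d + e)"
      using *[of \<beta>] assms(2) by blast
  next
    show "(\<lambda>p. 0 * g p) \<in> deg_space I (d + e)"
      using deg_space_zero by simp
  next
    fix f f' :: "('a \<Rightarrow> complex) \<Rightarrow> complex"
    assume "(\<lambda>p. f p * g p) \<in> deg_space I (d + e)" "(\<lambda>p. f' p * g p) \<in> deg_space I (d + e)"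
    from deg_space_add[OF this]
    show "(\<lambda>p. (f p + f' p) * g p) \<in> deg_space I (d + e)"
      by (simp add: distrib_right)
  next
    fix c and f :: "('a \<Rightarrow> complex) \<Rightarrow> complex"
    assume "(\<lambda>p. f p * g p) \<in> deg_space I (d + e)"
    from deg_space_scale[OF this, of c]
    show "(\<lambda>p. (c * f p) * g p) \<in> deg_space I (d + e)"
      by (simp add: mult.assoc)
  qed
  then show ?thesis using assms(1) by blast
qed

lemma deg_space_one: "(\<lambda>p. 1) \<in> deg_space I 0"
  using monomial_in_deg_space[of I "\<lambda>_. 0" 0] by simp

lemma deg_space_power: "f \<in> deg_space I d \<Longrightarrow> (\<lambda>p. f p ^ a) \<in> deg_space I (a * d)"
  by (induction a) (auto intro: deg_space_one deg_space_mult)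

lemma deg_space_prod:
  "finite A \<Longrightarrow> (\<And>a. a \<in> A \<Longrightarrow> f a \<in> deg_space I (e a)) \<Longrightarrow>
    (\<lambda>p. \<Prod>a\<in>A. f a p) \<in> deg_space I (\<Sum>a\<in>A. e a)"
  by (induction A rule: finite_induct) (auto intro: deg_space_one deg_space_mult)

lemma poly_funs_deg_space:
  assumes "finite I" "f \<in> poly_funs I"
  shows "\<exists>d. f \<in> deg_space I d"
  using assms(2)
proof (induction rule: poly_funs.induct)
  case (const c)
  then show ?case using deg_space_scale[OF deg_space_one, of c] by auto
next
  case (coord i)
  have "(\<Prod>j\<in>I. p j ^ (if j = i then 1 else 0)) = p i" for p :: "'a \<Rightarrow> complex"
    using assms(1) coord by (subst prod.remove[of I i]) auto
  moreover have "(\<lambda>p. \<Prod>j\<in>I. p j ^ (if j = i then 1 else 0)) \<in> deg_space I 1"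
    by (rule monomial_in_deg_space) simp
  ultimately show ?case by auto
next
  case (add f g)
  then obtain d e where "f \<in> deg_space I d" "g \<in> deg_space I e" by auto
  then have "f \<in> deg_space I (max d e)" "g \<in> deg_space I (max d e)"
    by (auto intro: subsetD[OF deg_space_mono, rotated])
  then show ?case using deg_space_add by blast
next
  case (mult f g)
  then show ?case using deg_space_mult by blast
qed

lemma sum_fun_apply: "(\<Sum>a\<in>A. f a) x = (\<Sum>a\<in>A. f a x)" for f :: "'a \<Rightarrow> 'b \<Rightarrow> 'c::comm_monoid_add"
  by (induction A rule: infinite_finite_induct) auto

text \<open>The degree is bounded in each coordinate separately, so the spanning monomials are
  indexed by a function set of exactly \<open>Suc d ^ card I\<close> elements. As \<open>m\<close>
  is an indexed family, its injectivity has to be drawn from independence before cardinalities can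
  be compared.\<close>

lemma card_independent_le:
  assumes I: "finite I" and A: "finite A" and m: "\<And>a. a \<in> A \<Longrightarrow> m a \<in> deg_space I d"
    and ind: "\<And>c a. (\<And>p. (\<Sum>a\<in>A. c a * m a p) = 0) \<Longrightarrow> a \<in> A \<Longrightarrow> c a = 0"
  shows "card A \<le> Suc d ^ card I"
proof -
  have inj: "inj_on m A"
  proof (rule inj_onI, rule ccontr)
    fix a b assume ab: "a \<in> A" "b \<in> A" "m a = m b" "a \<noteq> b"
    define c :: "'b \<Rightarrow> complex" where "c x = (if x = a then 1 else if x = b then -1 else 0)" for x
    have "(\<Sum>x\<in>A. c x * m x p) = 0" for p
    proof -
      have "(\<Sum>x\<in>A. c x * m x p) = (\<Sum>x\<in>{a, b}. c x * m x p)"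
        using ab A by (intro sum.mono_neutral_right) (auto simp: c_def)
      also have "\<dots> = m a p - m b p" using ab(4) by (simp add: c_def)
      finally show ?thesis using ab(3) by simp
    qed
    then have "c a = 0" using ind[of c a] ab by blast
    then show False by (simp add: c_def)
  qed
  have "cfun.independent (m ` A)"
  proof
    assume "cfun.dependent (m ` A)"
    then obtain u where u: "\<exists>x\<in>m ` A. u x \<noteq> 0" "(\<Sum>x\<in>m ` A. cscale (u x) x) = 0"
      unfolding cfun.dependent_finite[OF finite_imageI[OF A]] by (elim exE conjE)
    have "(\<Sum>a\<in>A. u (m a) * m a p) = 0" for p
    proof -
      have "(\<Sum>a\<in>A. u (m a) * m a p) = (\<Sum>x\<in>m ` A. u x * x p)"
        by (simp add: sum.reindex[OF inj])
      also have "\<dots> = (\<Sum>x\<in>m ` A. cscale (u x) x) p"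
        by (simp add: sum_fun_apply cscale_def)
      also have "\<dots> = 0"
        unfolding u(2) by simp
      finally show ?thesis .
    qed
    then have "u (m a) = 0" if "a \<in> A" for a
      using that by (rule ind[where c = "\<lambda>a. u (m a)"])
    with u(1) show False by (elim bexE imageE) simp
  qed
  moreover have "finite ((\<lambda>\<beta> p. \<Prod>i\<in>I. p i ^ \<beta> i :: complex) ` (I \<rightarrow>\<^sub>E {..d}))"
    using I by (intro finite_imageI finite_PiE) auto
  moreover have "m ` A \<subseteq> cfun.span ((\<lambda>\<beta> p. \<Prod>i\<in>I. p i ^ \<beta> i) ` (I \<rightarrow>\<^sub>E {..d}))"
    using m unfolding deg_space_def by (rule image_subsetI)
  ultimately have "card (m ` A) \<le> card ((\<lambda>\<beta> p. \<Prod>i\<in>I. p i ^ \<beta> i :: complex) ` (I \<rightarrow>\<^sub>E {..d}))"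
    by (intro cfun.independent_span_bound[THEN conjunct2])
  also have "\<dots> \<le> card (I \<rightarrow>\<^sub>E {..d})"
    using I by (intro card_image_le finite_PiE) auto
  also have "\<dots> = Suc d ^ card I"
    using I by (simp add: card_PiE)
  finally show ?thesis by (simp add: card_image[OF inj])
qed

text \<open>
  Dividing a relation by the highest power of \<open>f k\<close> occurring in all its terms and restricting to
  \<open>Z k\<close>, where \<open>f k\<close> vanishes, leaves a relation between the earlier functions.
\<close>

lemma chain_algebraically_independent:
  assumes irr: "\<And>i f g. i \<le> k \<Longrightarrow> f \<in> poly_funs I \<Longrightarrow> g \<in> poly_funs I \<Longrightarrow>
      (\<forall>p\<in>Z i. f p * g p = 0) \<Longrightarrow> (\<forall>p\<in>Z i. f p = 0) \<or> (\<forall>p\<in>Z i. g p = 0)"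
    and ne: "Z 0 \<noteq> {}" and mono: "\<And>i. i < k \<Longrightarrow> Z i \<subseteq> Z (Suc i)"
    and f: "\<And>i. i < k \<Longrightarrow> f i \<in> poly_funs I" "\<And>i p. i < k \<Longrightarrow> p \<in> Z i \<Longrightarrow> f i p = 0"
      "\<And>i. i < k \<Longrightarrow> \<exists>p\<in>Z (Suc i). f i p \<noteq> 0"
    and rel: "\<And>p. p \<in> Z k \<Longrightarrow> (\<Sum>\<alpha>\<in>{..<k} \<rightarrow>\<^sub>E {..<D}. c \<alpha> * (\<Prod>i<k. f i p ^ \<alpha> i)) = 0"
    and \<alpha>: "\<alpha> \<in> {..<k} \<rightarrow>\<^sub>E {..<D}"
  shows "c \<alpha> = 0"
  using assms
proof (induction k arbitrary: c \<alpha>)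
  case 0
  then obtain p where "p \<in> Z 0" by blast
  then show ?case using 0(7)[of p] 0(8) by simp
next
  case (Suc k)
  define g where "g j p = (\<Sum>\<beta>\<in>{..<k} \<rightarrow>\<^sub>E {..<D}. c (\<beta>(k := j)) * (\<Prod>i<k. f i p ^ \<beta> i))" for j p
  have gpoly: "g j \<in> poly_funs I" for j
    unfolding g_def
    using Suc.prems(4)
    by (intro poly_funs_sum poly_funs.mult poly_funs.const poly_funs_prod poly_funs_power) auto
  have eq: "(\<Sum>\<alpha>\<in>{..<Suc k} \<rightarrow>\<^sub>E {..<D}. c \<alpha> * (\<Prod>i<Suc k. f i p ^ \<alpha> i)) = (\<Sum>j<D. f k p ^ j * g j p)"
    for p
  proof -
    have "(\<Sum>\<alpha>\<in>{..<Suc k} \<rightarrow>\<^sub>E {..<D}. c \<alpha> * (\<Prod>i<Suc k. f i p ^ \<alpha> i)) =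
        (\<Sum>(j, \<beta>)\<in>{..<D} \<times> ({..<k} \<rightarrow>\<^sub>E {..<D}).
          c (\<beta>(k := j)) * (\<Prod>i<Suc k. f i p ^ (\<beta>(k := j)) i))"
      unfolding lessThan_Suc[of k] PiE_insert_eq
      by (subst sum.reindex[OF inj_combinator]) (auto simp: case_prod_unfold)
    also have "\<dots> = (\<Sum>(j, \<beta>)\<in>{..<D} \<times> ({..<k} \<rightarrow>\<^sub>E {..<D}).
          f k p ^ j * (c (\<beta>(k := j)) * (\<Prod>i<k. f i p ^ \<beta> i)))"
      by (intro sum.cong) (auto simp: mult_ac)
    also have "\<dots> = (\<Sum>j<D. f k p ^ j * g j p)"
      by (simp add: g_def sum.cartesian_product[symmetric] sum_distrib_left)
    finally show ?thesis .
  qed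
  \<comment> \<open>Strong induction on the exponent of \<open>f k\<close>: once the coefficients
    with lower exponent are zero, all \<open>g j'\<close> with \<open>j' < j\<close> vanish and
    \<open>f k ^ j\<close> divides what remains of the relation.\<close>
  have zero: "c (\<beta>(k := j)) = 0" if "j < D" "\<beta> \<in> {..<k} \<rightarrow>\<^sub>E {..<D}" for j \<beta>
    using that
  proof (induction j arbitrary: \<beta> rule: less_induct)
    case (less j)
    have g0: "g j' p = 0" if "j' < j" for j' p
      unfolding g_def
    proof (intro sum.neutral ballI)
      fix \<gamma> assume "\<gamma> \<in> {..<k} \<rightarrow>\<^sub>E {..<D}"
      then have "c (\<gamma>(k := j')) = 0" using less.IH[OF that] that less.prems(1) by fastforce
      then show "c (\<gamma>(k := j')) * (\<Prod>i<k. f i p ^ \<gamma> i) = 0" by simp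
    qed
    define h where "h p = (\<Sum>j'\<in>{j<..<D}. f k p ^ (j' - Suc j) * g j' p)" for p
    have fk: "f k \<in> poly_funs I" using Suc.prems(4) by simp
    have powpoly: "(\<lambda>p. f k p ^ a) \<in> poly_funs I" for a
      using fk by (rule poly_funs_power)
    have "h \<in> poly_funs I"
      unfolding h_def by (intro poly_funs_sum poly_funs.mult powpoly gpoly)
    then have hp: "(\<lambda>p. g j p + f k p * h p) \<in> poly_funs I"
      by (intro poly_funs.add poly_funs.mult gpoly fk)
    have split: "(\<Sum>j'<D. f k p ^ j' * g j' p) = f k p ^ j * (g j p + f k p * h p)" for p
    proof -
      have "{..<D} = {..<j} \<union> insert j {j<..<D}" using less.prems(1) by auto
      moreover have "sum F ({..<j} \<union> insert j {j<..<D}) = sum F {..<j} + sum F (insert j {j<..<D})"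
        for F :: "nat \<Rightarrow> complex"
        by (rule sum.union_disjoint) auto
      ultimately have "(\<Sum>j'<D. f k p ^ j' * g j' p) =
          (\<Sum>j'<j. f k p ^ j' * g j' p) + (\<Sum>j'\<in>insert j {j<..<D}. f k p ^ j' * g j' p)"
        by simp
      also have "(\<Sum>j'<j. f k p ^ j' * g j' p) = 0"
        using g0 by (intro sum.neutral) simp
      also have "0 + (\<Sum>j'\<in>insert j {j<..<D}. f k p ^ j' * g j' p) =
          f k p ^ j * g j p + (\<Sum>j'\<in>{j<..<D}. f k p ^ j' * g j' p)"
        by simp
      also have "(\<Sum>j'\<in>{j<..<D}. f k p ^ j' * g j' p) = f k p ^ j * (f k p * h p)"
        unfolding h_def sum_distrib_left
      proof (intro sum.cong refl)
        fix j' assume "j' \<in> {j<..<D}"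
        then have "j' = j + Suc (j' - Suc j)" by auto
        then have "f k p ^ j' = f k p ^ j * (f k p * f k p ^ (j' - Suc j))"
          by (metis power_Suc power_add)
        then show "f k p ^ j' * g j' p = f k p ^ j * (f k p * (f k p ^ (j' - Suc j) * g j' p))"
          by simp
      qed
      finally show ?thesis by (simp add: distrib_left)
    qed
    have "\<forall>p\<in>Z (Suc k). f k p ^ j * (g j p + f k p * h p) = 0"
      using Suc.prems(7) unfolding eq split by blast
    \<comment> \<open>\<open>f k\<close> does not vanish identically on the irreducible set
      \<open>Z (Suc k)\<close>, so its power can be cancelled. On \<open>Z k\<close> the term with
      \<open>h\<close> then drops out because \<open>f k\<close> is zero there.\<close>
    from Suc.prems(1)[OF order_refl powpoly hp this]
    have "\<forall>p\<in>Z (Suc k). g j p + f k p * h p = 0"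
      using Suc.prems(6)[of k] by auto
    then have "\<forall>p\<in>Z k. g j p = 0"
      using Suc.prems(3)[of k] Suc.prems(5)[of k] by fastforce
    then have rel: "(\<Sum>\<beta>\<in>{..<k} \<rightarrow>\<^sub>E {..<D}. c (\<beta>(k := j)) * (\<Prod>i<k. f i p ^ \<beta> i)) = 0"
      if "p \<in> Z k" for p
      using that unfolding g_def by blast
    show ?case
      by (rule Suc.IH[where c = "\<lambda>\<beta>. c (\<beta>(k := j))", OF Suc.prems(1) Suc.prems(2)
            Suc.prems(3) Suc.prems(4) Suc.prems(5) Suc.prems(6) rel less.prems(2)]) simp_all
  qed
  have "\<alpha> \<in> insert k {..<k} \<rightarrow>\<^sub>E {..<D}" using Suc.prems(8) by (simp add: lessThan_Suc)
  then obtain j \<beta> where "j < D" "\<beta> \<in> {..<k} \<rightarrow>\<^sub>E {..<D}" "\<alpha> = \<beta>(k := j)"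
    unfolding PiE_insert_eq by auto
  then show ?case unfolding \<open>\<alpha> = \<beta>(k := j)\<close> by (intro zero)
qed

text \<open>Growth rates decide: the \<open>D ^ k\<close> monomials in the \<open>k\<close>
  functions of a chain are independent, but they lie in a space whose dimension grows only like
  \<open>D ^ card I\<close>. Hence \<open>k\<close> cannot exceed \<open>card I\<close>.\<close>

lemma krull_dim_le:
  assumes I: "finite I" and X: "X \<subseteq> affine_space I"
  shows "krull_dim (subtopology (zariski I) X) \<le> enat (card I)"
proof -
  let ?T = "subtopology (zariski I) X"
  have "k \<le> card I"
    if Z: "\<forall>i\<le>k. closedin ?T (Z i) \<and> irreducible_space (subtopology ?T (Z i))"
      "\<forall>i<k. Z i \<subset> Z (Suc i)" for k and Z :: "nat \<Rightarrow> _"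
  proof (rule ccontr)
    assume k: "\<not> k \<le> card I"
    have ZX: "Z i \<subseteq> X" if "i \<le> k" for i
      using Z(1) that closedin_subset[of ?T] by (auto simp: topspace_subtopology_zariski[OF X])
    then have sub: "subtopology ?T (Z i) = subtopology (zariski I) (Z i)" if "i \<le> k" for i
      using that by (simp add: subtopology_subtopology inf_absorb2)
    have irr: "irreducible_space (subtopology (zariski I) (Z i))" if "i \<le> k" for i
      using Z(1) sub that by metis
    have ZA: "Z i \<subseteq> affine_space I" if "i \<le> k" for i using ZX X that by blast
    have "\<exists>f\<in>poly_funs I. (\<forall>p\<in>Z i. f p = 0) \<and> (\<exists>p\<in>Z (Suc i). f p \<noteq> 0)" if "i < k" for i
    proof -
      obtain F where F: "F \<subseteq> poly_funs I" "Z i = {p\<in>X. \<forall>f\<in>F. f p = 0}"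
        using Z(1) \<open>i < k\<close> unfolding closedin_subtopology_zariski[OF X] by (meson less_imp_le)
      obtain p where "p \<in> Z (Suc i)" "p \<notin> Z i" using Z(2) \<open>i < k\<close> by blast
      then show ?thesis using F ZX[of "Suc i"] \<open>i < k\<close> by auto
    qed
    then obtain f where f: "\<And>i. i < k \<Longrightarrow> f i \<in> poly_funs I"
        "\<And>i p. i < k \<Longrightarrow> p \<in> Z i \<Longrightarrow> f i p = 0" "\<And>i. i < k \<Longrightarrow> \<exists>p\<in>Z (Suc i). f i p \<noteq> 0"
      by metis
    define e where "e i = (SOME d. f i \<in> deg_space I d)" for i
    have e: "f i \<in> deg_space I (e i)" if "i < k" for i
      unfolding e_def using poly_funs_deg_space[OF I f(1)[OF that]] by (rule someI_ex)
    define E where "E = (\<Sum>i<k. e i)"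
    have eE: "e i \<le> E" if "i < k" for i
      unfolding E_def using that by (intro member_le_sum) auto
    define N where "N = card I"
    \<comment> \<open>The choice makes \<open>D\<close> larger than \<open>(k * E + 1) ^ N\<close>.
      Then \<open>(k * D * E + 1) ^ N \<le> D ^ N * (k * E + 1) ^ N < D ^ (N + 1)\<close>, which is
      at most \<open>D ^ k\<close> when \<open>k\<close> exceeds \<open>N\<close>.\<close>
    define D where "D = Suc ((k * E + 1) ^ N)"
    let ?A = "{..<k} \<rightarrow>\<^sub>E {..<D}"
    have "card ?A \<le> Suc (k * (D * E)) ^ card I"
    proof (rule card_independent_le[OF I, where m = "\<lambda>\<alpha> p. \<Prod>i<k. f i p ^ \<alpha> i"])
      show "finite ?A" by (intro finite_PiE) auto
    next
      fix \<alpha> assume \<alpha>: "\<alpha> \<in> ?A"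
      have "(\<lambda>p. \<Prod>i<k. f i p ^ \<alpha> i) \<in> deg_space I (\<Sum>i<k. \<alpha> i * e i)"
        using e by (intro deg_space_prod deg_space_power) auto
      moreover have "(\<Sum>i<k. \<alpha> i * e i) \<le> (\<Sum>i<k. D * E)"
        using \<alpha> eE by (intro sum_mono mult_mono) (auto simp: PiE_iff less_imp_le)
      then have "(\<Sum>i<k. \<alpha> i * e i) \<le> k * (D * E)" by simp
      ultimately show "(\<lambda>p. \<Prod>i<k. f i p ^ \<alpha> i) \<in> deg_space I (k * (D * E))"
        by (rule subsetD[OF deg_space_mono, rotated])
    next
      fix c :: "(nat \<Rightarrow> nat) \<Rightarrow> complex" and \<alpha>
      assume c: "\<And>p. (\<Sum>\<alpha>\<in>?A. c \<alpha> * (\<Prod>i<k. f i p ^ \<alpha> i)) = 0" and \<alpha>: "\<alpha> \<in> ?A"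
      show "c \<alpha> = 0"
      proof (rule chain_algebraically_independent[where Z = Z and k = k and I = I, OF _ _ _ f c \<alpha>])
        show "Z 0 \<noteq> {}" using irr[of 0] irreducible_zariski_iff[OF ZA[of 0]] by simp
      next
        fix i f g assume "i \<le> k" "f \<in> poly_funs I" "g \<in> poly_funs I" "\<forall>p\<in>Z i. f p * g p = 0"
        then show "(\<forall>p\<in>Z i. f p = 0) \<or> (\<forall>p\<in>Z i. g p = 0)"
          using irr[of i] irreducible_zariski_iff[OF ZA[of i]] by blast
      qed (use Z(2) in auto)
    qed
    then have "D ^ k \<le> Suc (k * (D * E)) ^ N"
      by (simp add: card_PiE N_def)
    also have "\<dots> \<le> (D * (k * E + 1)) ^ N"
      by (intro power_mono) (auto simp: D_def algebra_simps)
    also have "\<dots> = D ^ N * (k * E + 1) ^ N" by (rule power_mult_distrib)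
    also have "\<dots> < D ^ N * D" by (simp add: D_def)
    also have "\<dots> = D ^ Suc N" by simp
    also have "\<dots> \<le> D ^ k"
      using k by (intro power_increasing) (auto simp: N_def D_def)
    finally show False by simp
  qed
  then show ?thesis
    unfolding krull_dim_def by (intro Sup_least) auto
qed

text \<open>The chain consists of the slices of \<open>W\<close> through a point \<open>p\<close> on
  which the coordinates numbered from \<open>k\<close> on keep their values at \<open>p\<close>;
  each step frees one coordinate. A slice is a set closed under lines cut by \<open>W\<close>, hence
  irreducible.\<close>

lemma krull_dim_open_ge:
  assumes J: "finite J" and W: "openin (zariski J) W" "W \<noteq> {}"
  shows "enat (card J) \<le> krull_dim (subtopology (zariski J) W)"
proof -
  let ?T = "subtopology (zariski J) W"
  have WA: "W \<subseteq> affine_space J" using openin_subset[OF W(1)] by (simp add: topspace_zariski)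
  obtain p where p: "p \<in> W" using W(2) by blast
  obtain e where e: "bij_betw e {0..<card J} J" using ex_bij_betw_nat_finite[OF J] by blast
  define S where "S k = {q \<in> affine_space J. \<forall>i. k \<le> i \<and> i < card J \<longrightarrow> q (e i) = p (e i)}" for k
  define Z where "Z k = S k \<inter> W" for k
  have eJ: "e i \<in> J" if "i < card J" for i using bij_betwE[OF e] that by simp
  have closed: "closedin ?T (Z k)" for k
    unfolding closedin_subtopology_zariski[OF WA]
  proof (intro exI conjI)
    show "(\<lambda>i q. q (e i) - p (e i)) ` {k..<card J} \<subseteq> poly_funs J"
      using eJ by (auto intro!: poly_funs_diff poly_funs.coord poly_funs.const)
    show "Z k = {q \<in> W. \<forall>f\<in>(\<lambda>i q. q (e i) - p (e i)) ` {k..<card J}. f q = 0}"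
      using WA by (auto simp: Z_def S_def)
  qed
  have irr: "irreducible_space (subtopology ?T (Z k))" for k
  proof -
    have "irreducible_space (subtopology (zariski J) (S k \<inter> W))"
    proof (rule irreducible_line_closed[OF _ _ W(1)])
      show "S k \<inter> W \<noteq> {}" using p WA by (auto simp: S_def)
    qed (auto simp: S_def affine_space_def)
    moreover have "W \<inter> Z k = S k \<inter> W" by (auto simp: Z_def)
    ultimately show ?thesis by (simp add: subtopology_subtopology)
  qed
  have strict: "Z k \<subset> Z (Suc k)" if k: "k < card J" for k
  proof -
    obtain f where f: "f \<in> poly_funs J" "f p \<noteq> 0"
      "\<And>q. q \<in> affine_space J \<Longrightarrow> f q \<noteq> 0 \<Longrightarrow> q \<in> W"
      using zariski_openE[OF W(1) p] by blast
    define l where "l t = (\<lambda>i. p i + t * (if i = e k then 1 else 0))" for t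
    obtain P where P: "\<And>t. f (l t) = poly P t"
      using poly_funs_line[OF f(1)] unfolding l_def by metis
    have "P \<noteq> 0" using P[of 0] f(2) by (auto simp: l_def)
    \<comment> \<open>The factor \<open>[:0, 1:]\<close> rules out \<open>t = 0\<close>, so that the
      point found on the line differs from \<open>p\<close> in coordinate
      \<open>e k\<close>.\<close>
    then have "P * [:0, 1:] \<noteq> 0" by simp
    then obtain t where t: "poly (P * [:0, 1:]) t \<noteq> 0" using poly_all_0_iff_0 by blast
    then have t: "f (l t) \<noteq> 0" "t \<noteq> 0" using P by auto
    have lA: "l t \<in> affine_space J"
      using p WA eJ[OF k] by (auto simp: l_def affine_space_def)
    have "e i \<noteq> e k" if "Suc k \<le> i" "i < card J" for i
      using inj_onD[OF bij_betw_imp_inj_on[OF e], of i k] that by auto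
    then have "l t \<in> Z (Suc k)"
      using f(3)[OF lA t(1)] lA by (auto simp: Z_def S_def l_def)
    moreover have "l t \<notin> Z k" using t(2) k by (auto simp: Z_def S_def l_def)
    moreover have "Z k \<subseteq> Z (Suc k)" by (auto simp: Z_def S_def)
    ultimately show ?thesis by blast
  qed
  show ?thesis
    unfolding krull_dim_def
    by (rule Sup_upper) (use closed irr strict in blast)
qed

section \<open>Transport of irreducibility and dimension along homeomorphisms\<close>

lemma irreducible_image:
  assumes f: "continuous_map T T' f" and Z: "Z \<subseteq> topspace T"
    and irr: "irreducible_space (subtopology T Z)"
  shows "irreducible_space (subtopology T' (f ` Z))"
proof -
  have fZ: "f ` Z \<subseteq> topspace T'" using f Z by (auto simp: continuous_map_def)
  have top: "topspace (subtopology T Z) = Z" "topspace (subtopology T' (f ` Z)) = f ` Z"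
    using Z fZ by auto
  have cont: "continuous_map (subtopology T Z) (subtopology T' (f ` Z)) f"
    using f by (simp add: continuous_map_in_subtopology continuous_map_from_subtopology)
  show ?thesis
    unfolding irreducible_space_def top
  proof (intro conjI allI impI)
    show "f ` Z \<noteq> {}" using irr unfolding irreducible_space_def top by simp
    fix A B
    assume AB: "closedin (subtopology T' (f ` Z)) A \<and> closedin (subtopology T' (f ` Z)) B \<and>
      A \<union> B = f ` Z"
    have "closedin (subtopology T Z) {x \<in> Z. f x \<in> C}" if "closedin (subtopology T' (f ` Z)) C" for C
      using closedin_continuous_map_preimage[OF cont that] unfolding top(1) .
    then have "closedin (subtopology T Z) {x \<in> Z. f x \<in> A}" "closedin (subtopology T Z) {x \<in> Z. f x \<in> B}"
      using AB by blast+
    moreover have "{x \<in> Z. f x \<in> A} \<union> {x \<in> Z. f x \<in> B} = Z" using AB by auto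
    ultimately have "{x \<in> Z. f x \<in> A} = Z \<or> {x \<in> Z. f x \<in> B} = Z"
      using irr unfolding irreducible_space_def top by blast
    then show "A = f ` Z \<or> B = f ` Z" using AB by blast
  qed
qed

lemma krull_dim_homeomorphic_le:
  assumes "homeomorphic_map T T' f"
  shows "krull_dim T \<le> krull_dim T'"
  unfolding krull_dim_def
proof (rule Sup_subset_mono, clarify)
  fix k and Z :: "nat \<Rightarrow> 'a set"
  assume Z: "\<forall>i\<le>k. closedin T (Z i) \<and> irreducible_space (subtopology T (Z i))"
    "\<forall>i<k. Z i \<subset> Z (Suc i)"
  have sub: "Z i \<subseteq> topspace T" if "i \<le> k" for i using Z(1) that closedin_subset by blast
  have inj: "inj_on f (topspace T)" and cont: "continuous_map T T' f"
    using assms by (auto simp: homeomorphic_eq_everything_map)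
  have "closedin T' (f ` Z i) \<and> irreducible_space (subtopology T' (f ` Z i))" if "i \<le> k" for i
    using Z(1) that sub[OF that] homeomorphic_map_closedness[OF assms] irreducible_image[OF cont]
    by blast
  moreover have "f ` Z i \<subset> f ` Z (Suc i)" if "i < k" for i
    using Z(2) that sub[of "Suc i"] inj
    by (metis Suc_leI image_strict_mono inj_on_subset)
  ultimately show "\<exists>k'. enat k = enat k' \<and> (\<exists>Z'. (\<forall>i\<le>k'. closedin T' (Z' i) \<and>
      irreducible_space (subtopology T' (Z' i))) \<and> (\<forall>i<k'. Z' i \<subset> Z' (Suc i)))"
    by (intro exI[of _ k] conjI refl exI[of _ "\<lambda>i. f ` Z i"]) auto
qed

text \<open>On \<open>X\<close> a fraction has the same zeros as its numerator. So the pullback of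
  each equation of a closed set can be replaced by a polynomial equation.\<close>

lemma continuous_frac:
  assumes "X \<subseteq> affine_space I" "Y \<subseteq> affine_space J" "\<phi> ` X \<subseteq> Y"
    and "\<And>j. j \<in> J \<Longrightarrow> (\<lambda>p. \<phi> p j) \<in> frac_funs I X"
  shows "continuous_map (subtopology (zariski I) X) (subtopology (zariski J) Y) \<phi>"
  unfolding continuous_map_closedin topspace_subtopology_zariski[OF assms(1)]
    topspace_subtopology_zariski[OF assms(2)]
proof (intro conjI allI impI)
  show "\<phi> \<in> X \<rightarrow> Y" using assms(3) by auto
  fix C assume "closedin (subtopology (zariski J) Y) C"
  then obtain F where F: "F \<subseteq> poly_funs J" "C = {p\<in>Y. \<forall>f\<in>F. f p = 0}"
    unfolding closedin_subtopology_zariski[OF assms(2)] by blast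
  have "\<exists>g\<in>poly_funs I. \<forall>p\<in>X. f (\<phi> p) = 0 \<longleftrightarrow> g p = 0" if "f \<in> F" for f
  proof -
    have "(\<lambda>p. f (\<phi> p)) \<in> frac_funs I X"
      using F(1) that assms(4) by (intro poly_funs_comp_frac[of f J]) auto
    then obtain g h where "g \<in> poly_funs I" "\<forall>p\<in>X. h p \<noteq> 0" "\<forall>p\<in>X. f (\<phi> p) = g p / h p"
      by (rule frac_funsE)
    then show ?thesis by (intro bexI[of _ g]) auto
  qed
  then obtain g where g: "\<And>f. f \<in> F \<Longrightarrow> g f \<in> poly_funs I"
    "\<And>f p. f \<in> F \<Longrightarrow> p \<in> X \<Longrightarrow> f (\<phi> p) = 0 \<longleftrightarrow> g f p = 0" by metis
  have "{x \<in> X. \<phi> x \<in> C} = {p\<in>X. \<forall>f\<in>g ` F. f p = 0}"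
    using F(2) g(2) assms(3) by auto
  then show "closedin (subtopology (zariski I) X) {x \<in> X. \<phi> x \<in> C}"
    unfolding closedin_subtopology_zariski[OF assms(1)]
    by (intro exI[of _ "g ` F"] conjI image_subsetI g(1))
qed

section \<open>Tangent spaces of parametrized varieties\<close>

text \<open>The gradient is tested on arbitrary differentiable curves, so that the chain rule for
  substitutions is part of the definition.\<close>

definition has_gradient ::
    "'i set \<Rightarrow> (('i \<Rightarrow> complex) \<Rightarrow> complex) \<Rightarrow> ('i \<Rightarrow> complex) \<Rightarrow> ('i \<Rightarrow> complex) \<Rightarrow> bool" where
  "has_gradient I f p d \<longleftrightarrow> (\<forall>\<gamma> v.
     (\<forall>i\<in>I. \<gamma> 0 i = p i \<and> ((\<lambda>t. \<gamma> t i) has_field_derivative v i) (at 0)) \<longrightarrow>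
     ((\<lambda>t. f (\<gamma> t)) has_field_derivative (\<Sum>i\<in>I. d i * v i)) (at 0))"

lemma has_gradientD:
  assumes "has_gradient I f p d" "\<And>i. i \<in> I \<Longrightarrow> \<gamma> 0 i = p i"
    "\<And>i. i \<in> I \<Longrightarrow> ((\<lambda>t. \<gamma> t i) has_field_derivative v i) (at 0)"
  shows "((\<lambda>t. f (\<gamma> t)) has_field_derivative (\<Sum>i\<in>I. d i * v i)) (at 0)"
  using assms unfolding has_gradient_def by blast

lemma has_gradient_mult:
  assumes "f \<in> poly_funs I" "g \<in> poly_funs I" "has_gradient I f p d" "has_gradient I g p e"
  shows "has_gradient I (\<lambda>q. f q * g q) p (\<lambda>i. d i * g p + e i * f p)"
  unfolding has_gradient_def
proof (intro allI impI)
  fix \<gamma> :: "complex \<Rightarrow> 'a \<Rightarrow> complex" and v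
  assume \<gamma>: "\<forall>i\<in>I. \<gamma> 0 i = p i \<and> ((\<lambda>t. \<gamma> t i) has_field_derivative v i) (at 0)"
  have "f (\<gamma> 0) = f p" "g (\<gamma> 0) = g p"
    using \<gamma> poly_funs_cong assms(1,2) by blast+
  moreover have "((\<lambda>t. f (\<gamma> t) * g (\<gamma> t)) has_field_derivative
      (\<Sum>i\<in>I. d i * v i) * g (\<gamma> 0) + (\<Sum>i\<in>I. e i * v i) * f (\<gamma> 0)) (at 0)"
    using \<gamma> by (intro DERIV_mult has_gradientD[OF assms(3)] has_gradientD[OF assms(4)]) auto
  ultimately show "((\<lambda>t. f (\<gamma> t) * g (\<gamma> t)) has_field_derivative
      (\<Sum>i\<in>I. (d i * g p + e i * f p) * v i)) (at 0)"
    by (simp add: sum_distrib_left sum_distrib_right sum.distrib algebra_simps)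
qed

lemma poly_has_gradient:
  assumes "finite I" "f \<in> poly_funs I"
  shows "\<exists>d. has_gradient I f p d"
  using assms(2)
proof (induction rule: poly_funs.induct)
  case (const c)
  show ?case
    by (rule exI[of _ "\<lambda>_. 0"]) (simp add: has_gradient_def)
next
  case (coord i)
  have "(\<Sum>j\<in>I. (if j = i then 1 else 0) * v j) = v i" for v :: "'a \<Rightarrow> complex"
    using assms(1) coord by (subst sum.remove[of I i]) auto
  then show ?case
    using coord by (intro exI[of _ "\<lambda>j. if j = i then 1 else 0"]) (simp add: has_gradient_def)
next
  case (add f g)
  then obtain d e where "has_gradient I f p d" "has_gradient I g p e" by blast
  then have "has_gradient I (\<lambda>q. f q + g q) p (\<lambda>i. d i + e i)"
    unfolding has_gradient_def by (simp add: distrib_right sum.distrib DERIV_add)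
  then show ?case by blast
next
  case (mult f g)
  then show ?case using has_gradient_mult by blast
qed

lemma frac_has_gradient:
  assumes I: "finite I" and g: "g \<in> poly_funs I" and h: "h \<in> poly_funs I" and nz: "h p \<noteq> 0"
  shows "\<exists>d. has_gradient I (\<lambda>q. g q / h q) p d"
proof -
  obtain d e where d: "has_gradient I g p d" and e: "has_gradient I h p e"
    using poly_has_gradient[OF I g] poly_has_gradient[OF I h] by blast
  have "has_gradient I (\<lambda>q. g q / h q) p (\<lambda>i. (d i * h p - g p * e i) / (h p * h p))"
    unfolding has_gradient_def
  proof (intro allI impI)
    fix \<gamma> :: "complex \<Rightarrow> 'a \<Rightarrow> complex" and v
    assume \<gamma>: "\<forall>i\<in>I. \<gamma> 0 i = p i \<and> ((\<lambda>t. \<gamma> t i) has_field_derivative v i) (at 0)"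
    have 0: "g (\<gamma> 0) = g p" "h (\<gamma> 0) = h p"
      using \<gamma> poly_funs_cong g h by blast+
    have "((\<lambda>t. g (\<gamma> t) / h (\<gamma> t)) has_field_derivative
        ((\<Sum>i\<in>I. d i * v i) * h (\<gamma> 0) - g (\<gamma> 0) * (\<Sum>i\<in>I. e i * v i)) / (h (\<gamma> 0) * h (\<gamma> 0))) (at 0)"
      using \<gamma> nz 0 by (intro DERIV_divide has_gradientD[OF d] has_gradientD[OF e]) auto
    moreover have "(\<Sum>i\<in>I. (d i * h p - g p * e i) / (h p * h p) * v i) =
        ((\<Sum>i\<in>I. d i * v i) * h p - g p * (\<Sum>i\<in>I. e i * v i)) / (h p * h p)"
    proof -
      have "(\<Sum>i\<in>I. (d i * h p - g p * e i) / (h p * h p) * v i) =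
          (\<Sum>i\<in>I. d i * v i * h p - g p * (e i * v i)) / (h p * h p)"
        unfolding sum_divide_distrib by (intro sum.cong refl) (simp add: field_simps nz)
      then show ?thesis by (simp add: sum_subtractf sum_distrib_left sum_distrib_right)
    qed
    ultimately show "((\<lambda>t. g (\<gamma> t) / h (\<gamma> t)) has_field_derivative
        (\<Sum>i\<in>I. (d i * h p - g p * e i) / (h p * h p) * v i)) (at 0)"
      using 0 by simp
  qed
  then show ?thesis by blast
qed

lemma line_has_derivative: "((\<lambda>t. p i + t * v i) has_field_derivative (v i :: complex)) (at 0)"
  by (auto intro!: derivative_eq_intros)

text \<open>Zariski open conditions persist for small \<open>t\<close> in the classical topology.
  This allows derivatives at 0 to be computed from identities that hold only on a Zariski open
  set.\<close>

lemma eventually_line_nonzero: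
  assumes "h \<in> poly_funs I" "h p \<noteq> 0"
  shows "\<forall>\<^sub>F t in nhds 0. h (\<lambda>i. p i + t * v i) \<noteq> 0"
proof -
  obtain P where P: "\<And>t. h (\<lambda>i. p i + t * v i) = poly P t"
    using poly_funs_line[OF assms(1)] by metis
  have "open {t. poly P t \<noteq> 0}"
    by (intro open_Collect_neq continuous_intros)
  moreover have "0 \<in> {t. poly P t \<noteq> 0}" using P[of 0] assms(2) by simp
  ultimately show ?thesis
    unfolding P eventually_nhds by blast
qed

lemma eventually_line_open:
  assumes "openin (zariski J) W" "w \<in> W" "u \<in> affine_space J"
  shows "\<forall>\<^sub>F t in nhds 0. (\<lambda>j. w j + t * u j) \<in> W"
proof -
  obtain f where f: "f \<in> poly_funs J" "f w \<noteq> 0"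
    "\<And>q. q \<in> affine_space J \<Longrightarrow> f q \<noteq> 0 \<Longrightarrow> q \<in> W"
    using zariski_openE[OF assms(1,2)] by blast
  have "w \<in> affine_space J"
    using openin_subset[OF assms(1)] assms(2) by (auto simp: topspace_zariski)
  then have A: "(\<lambda>j. w j + t * u j) \<in> affine_space J" for t
    using assms(3) by (simp add: affine_space_def)
  show ?thesis
    using eventually_line_nonzero[of f J w u, OF f(1,2)]
  proof (rule eventually_mono)
    fix t assume "f (\<lambda>j. w j + t * u j) \<noteq> 0"
    then show "(\<lambda>j. w j + t * u j) \<in> W" by (rule f(3)[OF A])
  qed
qed

lemma dim_parametrized:
  fixes l :: "'j \<Rightarrow> 'i \<Rightarrow> complex"
  assumes J: "finite J" and ind: "\<And>u. (\<And>i. (\<Sum>j\<in>J. u j * l j i) = 0) \<Longrightarrow> \<forall>j\<in>J. u j = 0"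
    and T: "T = {(\<lambda>i. \<Sum>j\<in>J. u j * l j i) | u. True}"
  shows "cfun.dim T = card J"
proof (rule cfun.dim_unique)
  have comb: "(\<Sum>j\<in>J. cscale (u j) (l j)) = (\<lambda>i. \<Sum>j\<in>J. u j * l j i)" for u
    by (rule ext) (simp add: sum_fun_apply cscale_def)
  have inj: "inj_on l J"
  proof (rule inj_onI, rule ccontr)
    fix a b assume ab: "a \<in> J" "b \<in> J" "l a = l b" "a \<noteq> b"
    define c :: "'j \<Rightarrow> complex" where "c x = (if x = a then 1 else if x = b then -1 else 0)" for x
    have "(\<Sum>x\<in>J. c x * l x i) = 0" for i
    proof -
      have "(\<Sum>x\<in>J. c x * l x i) = (\<Sum>x\<in>{a, b}. c x * l x i)"
        using ab J by (intro sum.mono_neutral_right) (auto simp: c_def)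
      also have "\<dots> = l a i - l b i" using ab(4) by (simp add: c_def)
      finally show ?thesis using ab(3) by simp
    qed
    then have "c a = 0" using ind[of c] ab by blast
    then show False by (simp add: c_def)
  qed
  show "l ` J \<subseteq> T"
  proof
    fix x assume "x \<in> l ` J"
    then obtain j where j: "j \<in> J" "x = l j" by blast
    have "x = (\<lambda>i. \<Sum>j'\<in>J. (if j' = j then 1 else 0) * l j' i)"
    proof
      fix i
      have "(\<Sum>j'\<in>J. (if j' = j then 1 else 0) * l j' i) = l j i"
        using j(1) J by (subst sum.remove[of J j]) auto
      then show "x i = (\<Sum>j'\<in>J. (if j' = j then 1 else 0) * l j' i)" using j(2) by simp
    qed
    then show "x \<in> T" unfolding T mem_Collect_eq by (intro exI conjI TrueI)
  qed
  show "T \<subseteq> cfun.span (l ` J)"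
  proof
    fix x assume "x \<in> T"
    then obtain u where "x = (\<Sum>j\<in>J. cscale (u j) (l j))" unfolding T comb[symmetric] by blast
    then show "x \<in> cfun.span (l ` J)"
      by (simp only:) (intro cfun.span_sum cfun.span_scale cfun.span_base imageI)
  qed
  show "cfun.independent (l ` J)"
  proof
    assume "cfun.dependent (l ` J)"
    then obtain u where u: "\<exists>x\<in>l ` J. u x \<noteq> 0" "(\<Sum>x\<in>l ` J. cscale (u x) x) = 0"
      unfolding cfun.dependent_finite[OF finite_imageI[OF J]] by (elim exE conjE)
    have "(\<lambda>i. \<Sum>j\<in>J. u (l j) * l j i) = 0"
      using u(2) unfolding comb[symmetric] by (simp add: sum.reindex[OF inj])
    then have "(\<Sum>j\<in>J. u (l j) * l j i) = 0" for i
      by (metis zero_fun_apply)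
    then have "\<forall>j\<in>J. u (l j) = 0" by (rule ind[where u = "\<lambda>j. u (l j)"])
    with u(1) show False by (elim bexE imageE) simp
  qed
  show "card (l ` J) = card J" by (rule card_image[OF inj])
qed

lemma DERIV_transform_nhds:
  assumes "(f has_field_derivative D) (at x)" "\<forall>\<^sub>F t in nhds x. f t = g t"
  shows "(g has_field_derivative D) (at x)"
  using DERIV_cong_ev[OF refl assms(2) refl] assms(1) by blast

text \<open>The differentials \<open>L\<close> of \<open>\<phi>\<close> and \<open>M\<close> of
  \<open>\<psi>\<close> are mutually inverse between \<open>affine_space J\<close> and the tangent
  space. For \<open>M (L u) = u\<close> one differentiates along a line, which stays in
  \<open>W\<close> for small \<open>t\<close>. For \<open>L (M v) = v\<close> the line
  \<open>p + t v\<close> may leave \<open>Y\<close>, where \<open>\<phi>\<close> and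
  \<open>\<psi>\<close> are not known to be inverse. Instead, the numerator of
  \<open>q i - \<Phi> (\<Psi> q) i\<close> vanishes on \<open>Y\<close>, and the definition of a
  tangent vector applies to it.\<close>

lemma tangent_space_parametrized:
  assumes I: "finite I" and J: "finite J" and W: "openin (zariski J) W"
    and Y: "Y \<subseteq> affine_space I"
    and \<phi>: "\<phi> ` W \<subseteq> Y" "\<And>i. i \<in> I \<Longrightarrow> (\<lambda>w. \<phi> w i) \<in> frac_funs J W"
    and \<psi>: "\<psi> ` Y \<subseteq> W" "\<And>j. j \<in> J \<Longrightarrow> (\<lambda>p. \<psi> p j) \<in> frac_funs I Y"
    and inv: "\<And>w. w \<in> W \<Longrightarrow> \<psi> (\<phi> w) = w" "\<And>p. p \<in> Y \<Longrightarrow> \<phi> (\<psi> p) = p"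
    and p: "p \<in> Y"
  shows "cfun.dim (tangent_space I Y p) = card J"
proof -
  define w where "w = \<psi> p"
  have WA: "W \<subseteq> affine_space J" using openin_subset[OF W] by (simp add: topspace_zariski)
  have w: "w \<in> W" "\<phi> w = p" using p \<psi>(1) inv(2) by (auto simp: w_def)
  have wA: "w \<in> affine_space J" and pA: "p \<in> affine_space I" using w WA p Y by auto
  have "\<forall>i. \<exists>g h. i \<in> I \<longrightarrow> g \<in> poly_funs J \<and> h \<in> poly_funs J \<and>
      (\<forall>w\<in>W. h w \<noteq> 0) \<and> (\<forall>w\<in>W. \<phi> w i = g w / h w)"
    using \<phi>(2) unfolding frac_funs_def by blast
  then obtain g h where gh: "\<forall>i. i \<in> I \<longrightarrow> g i \<in> poly_funs J \<and> h i \<in> poly_funs J \<and>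
      (\<forall>w\<in>W. h i w \<noteq> 0) \<and> (\<forall>w\<in>W. \<phi> w i = g i w / h i w)"
    unfolding choice_iff by (elim exE)
  have "\<forall>j. \<exists>g h. j \<in> J \<longrightarrow> g \<in> poly_funs I \<and> h \<in> poly_funs I \<and>
      (\<forall>p\<in>Y. h p \<noteq> 0) \<and> (\<forall>p\<in>Y. \<psi> p j = g p / h p)"
    using \<psi>(2) unfolding frac_funs_def by blast
  then obtain a b where ab: "\<forall>j. j \<in> J \<longrightarrow> a j \<in> poly_funs I \<and> b j \<in> poly_funs I \<and>
      (\<forall>p\<in>Y. b j p \<noteq> 0) \<and> (\<forall>p\<in>Y. \<psi> p j = a j p / b j p)"
    unfolding choice_iff by (elim exE)
  \<comment> \<open>\<open>\<phi>\<close> and \<open>\<psi>\<close> are controlled only on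
    \<open>W\<close> and \<open>Y\<close>. The explicit fractions can also be evaluated and
    differentiated along lines that leave these sets.\<close>
  define \<Phi> where "\<Phi> u = (\<lambda>i. if i \<in> I then g i u / h i u else 0)" for u
  define \<Psi> where "\<Psi> q = (\<lambda>j. if j \<in> J then a j q / b j q else 0)" for q
  have \<Phi>: "\<Phi> u = \<phi> u" if "u \<in> W" for u
  proof
    fix i
    have "\<phi> u \<in> affine_space I" using that \<phi>(1) Y by blast
    then show "\<Phi> u i = \<phi> u i" using gh that by (simp add: \<Phi>_def affine_space_def)
  qed
  have \<Psi>: "\<Psi> q = \<psi> q" if "q \<in> Y" for q
  proof
    fix j
    have "\<psi> q \<in> affine_space J" using that \<psi>(1) WA by blast
    then show "\<Psi> q j = \<psi> q j" using ab that by (simp add: \<Psi>_def affine_space_def)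
  qed
  have "\<forall>i. \<exists>d. i \<in> I \<longrightarrow> has_gradient J (\<lambda>u. \<Phi> u i) w d"
    using gh w(1) frac_has_gradient[OF J] by (simp add: \<Phi>_def)
  then obtain d where d: "\<And>i. i \<in> I \<Longrightarrow> has_gradient J (\<lambda>u. \<Phi> u i) w (d i)"
    unfolding choice_iff by blast
  have "\<forall>j. \<exists>e. j \<in> J \<longrightarrow> has_gradient I (\<lambda>q. \<Psi> q j) p e"
    using ab p frac_has_gradient[OF I] by (simp add: \<Psi>_def)
  then obtain e where e: "\<And>j. j \<in> J \<Longrightarrow> has_gradient I (\<lambda>q. \<Psi> q j) p (e j)"
    unfolding choice_iff by blast
  define l where "l j = (\<lambda>i. if i \<in> I then d i j else 0)" for j
  define L where "L u = (\<lambda>i. \<Sum>j\<in>J. u j * l j i)" for u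
  define M where "M v = (\<lambda>j. if j \<in> J then \<Sum>i\<in>I. e j i * v i else 0)" for v
  have LA: "L u \<in> affine_space I" for u by (simp add: L_def l_def affine_space_def)
  have MA: "M v \<in> affine_space J" for v by (simp add: M_def affine_space_def)
  have LI: "L u i = (\<Sum>j\<in>J. d i j * u j)" if "i \<in> I" for u i
    using that by (simp add: L_def l_def mult.commute)
  have derL: "((\<lambda>t. \<Phi> (\<lambda>j. w j + t * u j) i) has_field_derivative L u i) (at 0)"
    if "i \<in> I" for u i
    unfolding LI[OF that]
    by (rule has_gradientD[OF d[OF that]]) (simp_all add: line_has_derivative)
  have derM: "((\<lambda>t. \<Psi> (\<lambda>i. p i + t * v i) j) has_field_derivative M v j) (at 0)"
    if "j \<in> J" for v j
    using has_gradientD[OF e[OF that], of "\<lambda>t i. p i + t * v i" v] that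
    by (simp add: M_def line_has_derivative)
  have MLid: "M (L u) = u" if u: "u \<in> affine_space J" for u
  proof
    fix j
    show "M (L u) j = u j"
    proof (cases "j \<in> J")
      case True
      \<comment> \<open>The curve inserted here is the image of a line under \<open>\<Phi>\<close>;
        this is the chain rule built into \<open>has_gradient\<close>.\<close>
      have "((\<lambda>t. \<Psi> (\<Phi> (\<lambda>j. w j + t * u j)) j) has_field_derivative (\<Sum>i\<in>I. e j i * L u i)) (at 0)"
        by (rule has_gradientD[OF e[OF True]]) (use \<Phi>[OF w(1)] w(2) derL in simp_all)
      moreover have "\<forall>\<^sub>F t in nhds 0. \<Psi> (\<Phi> (\<lambda>j. w j + t * u j)) j = w j + t * u j"
      proof (rule eventually_mono[OF eventually_line_open[OF W w(1) u]])
        fix t assume t: "(\<lambda>j. w j + t * u j) \<in> W"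
        then have "\<phi> (\<lambda>j. w j + t * u j) \<in> Y" using \<phi>(1) by blast
        then show "\<Psi> (\<Phi> (\<lambda>j. w j + t * u j)) j = w j + t * u j"
          using t \<Phi> \<Psi> inv(1) by simp
      qed
      ultimately have "((\<lambda>t. w j + t * u j) has_field_derivative (\<Sum>i\<in>I. e j i * L u i)) (at 0)"
        by (rule DERIV_transform_nhds)
      then have "(\<Sum>i\<in>I. e j i * L u i) = u j"
        using line_has_derivative[of w j u] by (rule DERIV_unique)
      then show ?thesis using True by (simp add: M_def)
    next
      case False
      then show ?thesis using u by (simp add: M_def affine_space_def)
    qed
  qed
  have LT: "L u \<in> tangent_space I Y p" if u: "u \<in> affine_space J" for u
    unfolding tangent_space_def mem_Collect_eq
  proof (intro conjI LA ballI impI)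
    fix f assume f: "f \<in> poly_funs I" "\<forall>q\<in>Y. f q = 0"
    obtain df where df: "has_gradient I f p df" using poly_has_gradient[OF I f(1)] by blast
    have "((\<lambda>t. f (\<Phi> (\<lambda>j. w j + t * u j))) has_field_derivative (\<Sum>i\<in>I. df i * L u i)) (at 0)"
      by (rule has_gradientD[OF df]) (use \<Phi>[OF w(1)] w(2) derL in simp_all)
    moreover have "\<forall>\<^sub>F t in nhds 0. f (\<Phi> (\<lambda>j. w j + t * u j)) = 0"
      using eventually_line_open[OF W w(1) u]
      by (rule eventually_mono) (use \<Phi> f(2) \<phi>(1) in auto)
    ultimately have "((\<lambda>t. 0) has_field_derivative (\<Sum>i\<in>I. df i * L u i)) (at 0)"
      by (rule DERIV_transform_nhds)
    then have "(\<Sum>i\<in>I. df i * L u i) = 0"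
      using DERIV_const by (rule DERIV_unique)
    moreover have "((\<lambda>t. f (\<lambda>i. p i + t * L u i)) has_field_derivative (\<Sum>i\<in>I. df i * L u i)) (at 0)"
      by (rule has_gradientD[OF df]) (simp_all add: line_has_derivative)
    ultimately show "((\<lambda>t. f (\<lambda>i. p i + t * L u i)) has_field_derivative 0) (at 0)" by simp
  qed
  have LMid: "L (M v) = v" if v: "v \<in> tangent_space I Y p" for v
  proof
    fix i
    have vA: "v \<in> affine_space I" using v by (simp add: tangent_space_def)
    show "L (M v) i = v i"
    proof (cases "i \<in> I")
      case True
      \<comment> \<open>\<open>X1\<close> is the set where the denominators of \<open>\<Psi>\<close>
        are nonzero; on \<open>X2\<close> the denominator of coordinate \<open>i\<close> of
        \<open>\<Phi>\<close> at \<open>\<Psi> q\<close> is nonzero as well. Both contain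
        \<open>Y\<close> and, for small \<open>t\<close>, the points \<open>p + t v\<close>.\<close>
      define X1 where "X1 = {q. \<forall>j\<in>J. b j q \<noteq> 0}"
      have \<Psi>X1: "(\<lambda>q. \<Psi> q j) \<in> frac_funs I X1" if "j \<in> J" for j
        using that ab by (intro frac_funsI[of "a j" I "b j"]) (auto simp: X1_def \<Psi>_def)
      have hi: "h i \<in> poly_funs J" and gi: "g i \<in> poly_funs J" using gh True by auto
      obtain r s where rs: "r \<in> poly_funs I" "s \<in> poly_funs I" "\<forall>q\<in>X1. s q \<noteq> 0"
        "\<forall>q\<in>X1. h i (\<Psi> q) = r q / s q"
        using poly_funs_comp_frac[OF hi \<Psi>X1] by (rule frac_funsE)
      define X2 where "X2 = {q \<in> X1. r q \<noteq> 0}"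
      have hX2: "h i (\<Psi> q) \<noteq> 0" if "q \<in> X2" for q
        using that rs(3,4) by (auto simp: X2_def)
      have \<Psi>X2: "(\<lambda>q. \<Psi> q j) \<in> frac_funs I X2" if "j \<in> J" for j
        by (rule frac_funs_mono[OF \<Psi>X1[OF that]]) (auto simp: X2_def)
      have "(\<lambda>q. g i (\<Psi> q) / h i (\<Psi> q)) \<in> frac_funs I X2"
        by (rule frac_funs_divide[OF poly_funs_comp_frac[OF gi \<Psi>X2] poly_funs_comp_frac[OF hi \<Psi>X2] hX2])
      then have "(\<lambda>q. q i - g i (\<Psi> q) / h i (\<Psi> q)) \<in> frac_funs I X2"
        using True by (intro frac_funs_diff frac_funs_coord)
      then obtain G H where GH: "G \<in> poly_funs I" "H \<in> poly_funs I" "\<forall>q\<in>X2. H q \<noteq> 0"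
        "\<forall>q\<in>X2. q i - g i (\<Psi> q) / h i (\<Psi> q) = G q / H q"
        by (rule frac_funsE)
      have YX1: "Y \<subseteq> X1" using ab by (auto simp: X1_def)
      have YX2: "q \<in> X2" if "q \<in> Y" for q
      proof -
        have "\<Psi> q \<in> W" using \<Psi> \<psi>(1) that by auto
        then have "h i (\<Psi> q) \<noteq> 0" using gh True by blast
        then show ?thesis using YX1 that rs(4) by (auto simp: X2_def)
      qed
      have GY: "G q = 0" if "q \<in> Y" for q
      proof -
        have "\<Psi> q = \<psi> q" "\<psi> q \<in> W" using \<Psi> \<psi>(1) that by auto
        then have "g i (\<Psi> q) / h i (\<Psi> q) = \<phi> (\<psi> q) i" using gh True by simp
        then have "g i (\<Psi> q) / h i (\<Psi> q) = q i" using inv(2) that by simp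
        then have "G q / H q = 0" using GH(4) YX2[OF that] by fastforce
        then show ?thesis using GH(3) YX2[OF that] by auto
      qed
      define \<delta> where "\<delta> t = (\<lambda>i. p i + t * v i)" for t
      have \<delta>0: "\<delta> 0 = p" by (simp add: \<delta>_def)
      \<comment> \<open>Tangency of \<open>v\<close> enters here, since \<open>G\<close> vanishes on
        \<open>Y\<close>. Division by \<open>H\<close> preserves the zero derivative because
        \<open>G\<close> is zero at \<open>p\<close> itself.\<close>
      have "((\<lambda>t. G (\<delta> t)) has_field_derivative 0) (at 0)"
        using v GH(1) GY unfolding tangent_space_def \<delta>_def by blast
      moreover obtain H' where "has_gradient I H p H'" using poly_has_gradient[OF I GH(2)] by blast
      then have "((\<lambda>t. H (\<delta> t)) has_field_derivative (\<Sum>i\<in>I. H' i * v i)) (at 0)"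
        unfolding \<delta>_def by (rule has_gradientD) (simp_all add: line_has_derivative)
      moreover have "H (\<delta> 0) \<noteq> 0" using GH(3) YX2[OF p] \<delta>0 by simp
      ultimately have "((\<lambda>t. G (\<delta> t) / H (\<delta> t)) has_field_derivative
          (0 * H (\<delta> 0) - G (\<delta> 0) * (\<Sum>i\<in>I. H' i * v i)) / (H (\<delta> 0) * H (\<delta> 0))) (at 0)"
        by (rule DERIV_divide)
      then have "((\<lambda>t. G (\<delta> t) / H (\<delta> t)) has_field_derivative 0) (at 0)"
        using GY[OF p] \<delta>0 by simp
      moreover have "\<forall>\<^sub>F t in nhds 0. G (\<delta> t) / H (\<delta> t) = \<delta> t i - \<Phi> (\<Psi> (\<delta> t)) i"
      proof -
        have "\<forall>\<^sub>F t in nhds 0. \<forall>j\<in>J. b j (\<delta> t) \<noteq> 0"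
          unfolding eventually_ball_finite_distrib[OF J] \<delta>_def
        proof
          fix j assume "j \<in> J"
          then have "b j \<in> poly_funs I" "b j p \<noteq> 0" using ab p by auto
          then show "\<forall>\<^sub>F t in nhds 0. b j (\<lambda>i. p i + t * v i) \<noteq> 0"
            by (rule eventually_line_nonzero[of "b j" I p v])
        qed
        moreover have "\<forall>\<^sub>F t in nhds 0. r (\<delta> t) \<noteq> 0"
          unfolding \<delta>_def
          by (rule eventually_line_nonzero[of r I p v, OF rs(1)])
            (use YX2[OF p] in \<open>simp add: X2_def\<close>)
        ultimately show ?thesis
        proof eventually_elim
          case (elim t)
          then have "\<delta> t \<in> X2" by (simp add: X2_def X1_def)
          then show ?case using GH(4) True by (simp add: \<Phi>_def)
        qed
      qed
      ultimately have "((\<lambda>t. \<delta> t i - \<Phi> (\<Psi> (\<delta> t)) i) has_field_derivative 0) (at 0)"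
        by (rule DERIV_transform_nhds)
      moreover have "((\<lambda>t. \<delta> t i - \<Phi> (\<Psi> (\<delta> t)) i) has_field_derivative v i - L (M v) i) (at 0)"
        unfolding LI[OF True]
      proof (intro DERIV_diff has_gradientD[OF d[OF True]])
        show "((\<lambda>t. \<delta> t i) has_field_derivative v i) (at 0)"
          unfolding \<delta>_def by (rule line_has_derivative)
        fix j assume "j \<in> J"
        then show "((\<lambda>t. \<Psi> (\<delta> t) j) has_field_derivative M v j) (at 0)"
          unfolding \<delta>_def by (rule derM)
        show "\<Psi> (\<delta> 0) j = w j" using \<delta>0 \<Psi>[OF p] w_def by simp
      qed
      ultimately have "v i - L (M v) i = 0" by (rule DERIV_unique[symmetric])
      then show ?thesis by simp
    next
      case False
      then show ?thesis using vA LA[of "M v"] by (simp add: affine_space_def)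
    qed
  qed
  show ?thesis
  proof (rule dim_parametrized[OF J])
    show "tangent_space I Y p = {(\<lambda>i. \<Sum>j\<in>J. u j * l j i) | u. True}"
    proof (intro Set.set_eqI iffI)
      fix v assume "v \<in> tangent_space I Y p"
      then show "v \<in> {(\<lambda>i. \<Sum>j\<in>J. u j * l j i) | u. True}"
        using LMid[of v] unfolding L_def mem_Collect_eq
        by (intro exI[of _ "M v"] conjI TrueI) simp
    next
      fix v assume "v \<in> {(\<lambda>i. \<Sum>j\<in>J. u j * l j i) | u. True}"
      then obtain u where u: "v = (\<lambda>i. \<Sum>j\<in>J. u j * l j i)" by blast
      \<comment> \<open>Coefficients outside \<open>J\<close> do not influence the combination;
        cutting them off gives a point of \<open>affine_space J\<close>, to which \<open>LT\<close>
        applies.\<close>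
      define u' where "u' = (\<lambda>j. if j \<in> J then u j else 0)"
      have "v = L u'" unfolding u L_def u'_def by (intro ext sum.cong) auto
      moreover have "u' \<in> affine_space J" by (simp add: u'_def affine_space_def)
      ultimately show "v \<in> tangent_space I Y p" using LT by simp
    qed
  next
    fix u assume u: "\<And>i. (\<Sum>j\<in>J. u j * l j i) = 0"
    define u' where "u' = (\<lambda>j. if j \<in> J then u j else 0)"
    have "L u' = (\<lambda>i. \<Sum>j\<in>J. u j * l j i)" unfolding L_def u'_def by (intro ext sum.cong) auto
    then have "L u' = (\<lambda>i. 0)" using u by auto
    moreover have "u' \<in> affine_space J" by (simp add: u'_def affine_space_def)
    ultimately have "u' = M (\<lambda>i. 0)" using MLid[of u'] by simp
    then have u0: "u' j = 0" for j by (simp add: M_def)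
    show "\<forall>j\<in>J. u j = 0"
    proof
      fix j assume "j \<in> J"
      then show "u j = 0" using u0[of j] by (simp add: u'_def)
    qed
  qed
qed

text \<open>Applied twice in the end: to the incidence set with its parameters, and to the open
  ambient set with both maps the identity.\<close>

lemma parametrized_variety:
  assumes I: "finite I" and J: "finite J" and W: "openin (zariski J) W" "W \<noteq> {}"
    and Y: "Y \<subseteq> affine_space I"
    and \<phi>: "\<phi> ` W \<subseteq> Y" "\<And>i. i \<in> I \<Longrightarrow> (\<lambda>w. \<phi> w i) \<in> frac_funs J W"
    and \<psi>: "\<psi> ` Y \<subseteq> W" "\<And>j. j \<in> J \<Longrightarrow> (\<lambda>p. \<psi> p j) \<in> frac_funs I Y"
    and inv: "\<And>w. w \<in> W \<Longrightarrow> \<psi> (\<phi> w) = w" "\<And>p. p \<in> Y \<Longrightarrow> \<phi> (\<psi> p) = p"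
  shows "irreducible_space (subtopology (zariski I) Y)"
    and "krull_dim (subtopology (zariski I) Y) = enat (card J)"
    and "nonsingular I Y"
proof -
  have WA: "W \<subseteq> affine_space J" using openin_subset[OF W(1)] by (simp add: topspace_zariski)
  let ?TW = "subtopology (zariski J) W" and ?TY = "subtopology (zariski I) Y"
  have c\<phi>: "continuous_map ?TW ?TY \<phi>" by (rule continuous_frac[OF WA Y \<phi>])
  have c\<psi>: "continuous_map ?TY ?TW \<psi>" by (rule continuous_frac[OF Y WA \<psi>])
  have hom: "homeomorphic_maps ?TW ?TY \<phi> \<psi>"
    unfolding homeomorphic_maps_def
    using c\<phi> c\<psi> inv by (auto simp: topspace_subtopology_zariski[OF WA] topspace_subtopology_zariski[OF Y])
  have "\<phi> ` W = Y" 
  proof (intro antisym[OF \<phi>(1)] subsetI)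
    fix p assume "p \<in> Y"
    then have "p = \<phi> (\<psi> p)" "\<psi> p \<in> W" using inv(2) \<psi>(1) by auto
    then show "p \<in> \<phi> ` W" by (rule image_eqI)
  qed
  moreover have "subtopology ?TW W = ?TW" "subtopology ?TY Y = ?TY"
    by (simp_all add: subtopology_subtopology)
  ultimately show "irreducible_space ?TY"
    using irreducible_image[OF c\<phi>, of W] irreducible_zariski_open[OF W] WA by (simp add: topspace_zariski)
  have "krull_dim ?TW = enat (card J)"
    using krull_dim_le[OF J WA] krull_dim_open_ge[OF J W] by (rule antisym)
  moreover have "krull_dim ?TY = krull_dim ?TW"
    using krull_dim_homeomorphic_le[of ?TW ?TY \<phi>] krull_dim_homeomorphic_le[of ?TY ?TW \<psi>] hom
    by (metis antisym homeomorphic_maps_map)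
  ultimately show dim: "krull_dim ?TY = enat (card J)" by simp
  show "nonsingular I Y"
    unfolding nonsingular_def dim
    using tangent_space_parametrized[OF I J W(1) Y \<phi> \<psi> inv] by simp
qed

section \<open>Affineness\<close>

lemma poly_funs_reindex:
  assumes "f \<in> poly_funs I" "\<And>i. i \<in> I \<Longrightarrow> e i \<in> J"
  shows "(\<lambda>q. f (\<lambda>i. if i \<in> I then q (e i) else 0)) \<in> poly_funs J"
  by (rule poly_funs_comp[OF assms(1), where \<phi> = "\<lambda>q i. if i \<in> I then q (e i) else 0"])
    (simp add: poly_funs.coord assms(2))

text \<open>The extra coordinate, with index \<open>card I\<close>, is the inverse of \<open>f\<close>.\<close>

lemma affine_varietyI:
  assumes I: "finite I" and f: "f \<in> poly_funs I" and F: "F \<subseteq> poly_funs I"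
    and X: "X = {p \<in> affine_space I. f p \<noteq> 0 \<and> (\<forall>g\<in>F. g p = 0)}"
    and irr: "irreducible_space (subtopology (zariski I) X)"
  shows "affine_variety I X"
proof -
  let ?k = "card I"
  \<comment> \<open>\<open>affine_variety\<close> asks for a closed set with coordinates
    \<open>{..<N}\<close>, so \<open>I\<close> is enumerated and the number \<open>card I\<close> is
    free for the extra coordinate.\<close>
  obtain e where e: "bij_betw e {0..<?k} I" using ex_bij_betw_nat_finite[OF I] by blast
  define e' where "e' = the_inv_into {0..<?k} e"
  have e'b: "bij_betw e' I {0..<?k}" unfolding e'_def by (rule bij_betw_the_inv_into[OF e])
  have ee': "e (e' i) = i" "e' i < ?k" if "i \<in> I" for i
    using that f_the_inv_into_f_bij_betw[OF e, of i] bij_betwE[OF e'b]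
    unfolding e'_def by auto
  have e'e: "e' (e m) = m" "e m \<in> I" if "m < ?k" for m
    using that e the_inv_into_f_f[of e "{0..<?k}" m] unfolding e'_def bij_betw_def by auto
  define \<phi> where "\<phi> p = (\<lambda>m. if m < ?k then p (e m) else if m = ?k then 1 / f p else 0)"
    for p :: "'a \<Rightarrow> complex"
  define \<psi> where "\<psi> q = (\<lambda>i. if i \<in> I then q (e' i) else 0)" for q :: "nat \<Rightarrow> complex"
  let ?J = "{..<Suc ?k}"
  have \<psi>poly: "(\<lambda>q. g (\<psi> q)) \<in> poly_funs ?J" if "g \<in> poly_funs I" for g
    unfolding \<psi>_def using ee'(2) by (intro poly_funs_reindex[OF that]) (simp add: less_SucI)
  define G where "G = insert (\<lambda>q. q ?k * f (\<psi> q) - 1) ((\<lambda>g q. g (\<psi> q)) ` F)"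
  define Z where "Z = zero_locus ?J G"
  have G: "G \<subseteq> poly_funs ?J"
    unfolding G_def using F f
    by (auto intro!: poly_funs_diff poly_funs.mult poly_funs.const poly_funs.coord \<psi>poly)
  have Z: "Z = {q \<in> affine_space ?J. q ?k * f (\<psi> q) = 1 \<and> (\<forall>g\<in>F. g (\<psi> q) = 0)}"
    by (auto simp: Z_def G_def zero_locus_def)
  have XA: "X \<subseteq> affine_space I" and ZA: "Z \<subseteq> affine_space ?J" by (auto simp: X Z)
  have \<psi>\<phi>: "\<psi> (\<phi> p) = p" if "p \<in> affine_space I" for p
    using that ee' by (auto simp: \<psi>_def \<phi>_def affine_space_def)
  have \<phi>\<psi>: "\<phi> (\<psi> q) = q" if "q \<in> Z" for q
  proof
    fix m
    consider "m < ?k" | "m = ?k" | "m > ?k" by linarith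
    then show "\<phi> (\<psi> q) m = q m"
    proof cases
      case 1
      then show ?thesis using e'e by (simp add: \<phi>_def \<psi>_def)
    next
      case 2
      have "q ?k * f (\<psi> q) = 1" using that Z by simp
      then show ?thesis using 2 by (simp add: \<phi>_def) (metis mult_eq_0_iff nonzero_eq_divide_eq zero_neq_one)
    next
      case 3
      then show ?thesis using that Z by (simp add: \<phi>_def affine_space_def)
    qed
  qed
  have "morphism I X ?J Z \<phi>"
    unfolding morphism_def
  proof (intro conjI ballI frac_funs_regular XA)
    show "\<phi> ` X \<subseteq> Z"
    proof (rule image_subsetI)
      fix p assume p: "p \<in> X"
      have "\<phi> p \<in> affine_space ?J" by (simp add: \<phi>_def affine_space_def)
      moreover have "\<phi> p ?k = 1 / f p" by (simp add: \<phi>_def)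
      ultimately show "\<phi> p \<in> Z" using p \<psi>\<phi>[of p] by (simp add: X Z)
    qed
    fix m assume "m \<in> ?J"
    then consider "m < ?k" | "m = ?k" by force
    then show "(\<lambda>p. \<phi> p m) \<in> frac_funs I X"
    proof cases
      case 1
      then show ?thesis using e'e(2) by (simp add: \<phi>_def frac_funs_coord)
    next
      case 2
      have "(\<lambda>p. 1 / f p) \<in> frac_funs I X"
        by (rule frac_funs_divide[OF frac_funs_const poly_funs_frac[OF f]]) (simp add: X)
      then show ?thesis using 2 by (simp add: \<phi>_def)
    qed
  qed
  moreover have "morphism ?J Z I X \<psi>"
    unfolding morphism_def
  proof (intro conjI ballI frac_funs_regular ZA)
    show "\<psi> ` Z \<subseteq> X" by (auto simp: Z X \<psi>_def affine_space_def)
    fix i assume "i \<in> I"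
    then show "(\<lambda>q. \<psi> q i) \<in> frac_funs ?J Z"
      using ee'(2)[of i] by (simp add: \<psi>_def frac_funs_coord less_SucI)
  qed
  ultimately have "isomorphic_varieties I X ?J Z"
    unfolding isomorphic_varieties_def using \<psi>\<phi> \<phi>\<psi> XA by blast
  moreover have "closedin (zariski ?J) Z"
    unfolding closedin_zariski Z_def using G by blast
  moreover have "quasi_affine_variety I X"
    unfolding quasi_affine_variety_def
  proof (intro conjI I irr exI)
    show "openin (zariski I) (affine_space I - zero_locus I {f})"
      unfolding openin_zariski zariski_open_def using f by blast
    show "closedin (zariski I) (zero_locus I F)"
      unfolding closedin_zariski using F by blast
    show "X = (affine_space I - zero_locus I {f}) \<inter> zero_locus I F"
      by (auto simp: X zero_locus_def)
  qed
  ultimately show ?thesis unfolding affine_variety_def by blast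
qed

section \<open>Eigenvector matrices of bordered matrices\<close>

text \<open>Entries are kept as a function of two indices, so that passing to a leading block
  changes only \<open>m\<close> and one function describes all blocks at once.\<close>

definition fmat :: "nat \<Rightarrow> (nat \<Rightarrow> nat \<Rightarrow> complex) \<Rightarrow> complex mat" where
  "fmat m g = mat m m (\<lambda>(i, j). g i j)"

lemma fmat_carrier [simp]: "fmat m g \<in> carrier_mat m m"
  by (simp add: fmat_def)

lemma fmat_dim [simp]: "dim_row (fmat m g) = m" "dim_col (fmat m g) = m"
  by (simp_all add: fmat_def)

lemma fmat_index [simp]: "i < m \<Longrightarrow> j < m \<Longrightarrow> fmat m g $$ (i, j) = g i j"
  by (simp add: fmat_def)

lemma fmat_cong: "(\<And>i j. i < m \<Longrightarrow> j < m \<Longrightarrow> g i j = h i j) \<Longrightarrow> fmat m g = fmat m h"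
  by (rule eq_matI) auto

lemma fmat_mult: "fmat m g * fmat m h = fmat m (\<lambda>i j. \<Sum>k<m. g i k * h k j)"
  by (rule eq_matI) (auto simp: scalar_prod_def atLeast0LessThan intro!: sum.cong)

lemma fmat_one: "fmat m (\<lambda>i j. if i = j then 1 else 0) = 1\<^sub>m m"
  by (rule eq_matI) auto

text \<open>Adjugate over determinant: in this form the entries of an inverse are visibly fractions
  in the entries of the matrix, which \<open>minv_frac_funs\<close> exploits.\<close>

definition minv :: "nat \<Rightarrow> (nat \<Rightarrow> nat \<Rightarrow> complex) \<Rightarrow> nat \<Rightarrow> nat \<Rightarrow> complex" where
  "minv m g i j = adj_mat (fmat m g) $$ (i, j) / det (fmat m g)"

lemma minv:
  assumes "det (fmat m g) \<noteq> 0" "i < m" "j < m"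
  shows "(\<Sum>k<m. g i k * minv m g k j) = (if i = j then 1 else 0)"
    and "(\<Sum>k<m. minv m g i k * g k j) = (if i = j then 1 else 0)"
proof -
  have c: "adj_mat (fmat m g) \<in> carrier_mat m m" by (rule adj_mat(1)[OF fmat_carrier])
  have "(fmat m g * adj_mat (fmat m g)) $$ (i, j) = (\<Sum>k<m. g i k * adj_mat (fmat m g) $$ (k, j))"
    using c assms by (auto simp: scalar_prod_def atLeast0LessThan intro!: sum.cong)
  then show "(\<Sum>k<m. g i k * minv m g k j) = (if i = j then 1 else 0)"
    using assms unfolding adj_mat(2)[OF fmat_carrier]
    by (simp add: minv_def sum_divide_distrib[symmetric] split: if_splits)
  have "(adj_mat (fmat m g) * fmat m g) $$ (i, j) = (\<Sum>k<m. adj_mat (fmat m g) $$ (i, k) * g k j)"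
    using c assms by (auto simp: scalar_prod_def atLeast0LessThan intro!: sum.cong)
  then show "(\<Sum>k<m. minv m g i k * g k j) = (if i = j then 1 else 0)"
    using assms unfolding adj_mat(3)[OF fmat_carrier]
    by (simp add: minv_def sum_divide_distrib[symmetric] split: if_splits)
qed

lemma sum_delta_lessThan:
  fixes m :: nat and y :: "nat \<Rightarrow> complex"
  shows
  "i < m \<Longrightarrow> (\<Sum>k<m. y k * (if k = i then 1 else 0)) = y i"
    and "i < m \<Longrightarrow> (\<Sum>k<m. (if i = k then 1 else 0) * y k) = y i"
proof -
  assume i: "i < m"
  have "(\<Sum>k<m. y k * (if k = i then 1 else 0)) = (\<Sum>k\<in>{i}. y k * (if k = i then 1 else 0))"
    using i by (intro sum.mono_neutral_right) auto
  then show "(\<Sum>k<m. y k * (if k = i then 1 else 0)) = y i" by simp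
  have "(\<Sum>k<m. (if i = k then 1 else 0) * y k) = (\<Sum>k\<in>{i}. (if i = k then 1 else 0) * y k)"
    using i by (intro sum.mono_neutral_right) auto
  then show "(\<Sum>k<m. (if i = k then 1 else 0) * y k) = y i" by simp
qed

lemma minv_row:
  assumes "det (fmat m g) \<noteq> 0" "j < m"
  shows "(\<Sum>k<m. (\<Sum>i<m. y i * g i k) * minv m g k j) = y j"
proof -
  have "(\<Sum>k<m. (\<Sum>i<m. y i * g i k) * minv m g k j) = (\<Sum>i<m. y i * (\<Sum>k<m. g i k * minv m g k j))"
    unfolding sum_distrib_left sum_distrib_right by (subst sum.swap) (simp add: mult.assoc)
  also have "\<dots> = (\<Sum>i<m. y i * (if i = j then 1 else 0))"
    using minv(1)[OF assms(1) _ assms(2)] by (intro sum.cong) auto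
  finally show ?thesis using sum_delta_lessThan(1)[OF assms(2)] by simp
qed

lemma minv_col:
  assumes "det (fmat m g) \<noteq> 0" "i < m"
  shows "(\<Sum>k<m. g i k * (\<Sum>l<m. minv m g k l * y l)) = y i"
    and "(\<Sum>k<m. minv m g i k * (\<Sum>l<m. g k l * y l)) = y i"
proof -
  have "(\<Sum>k<m. g i k * (\<Sum>l<m. minv m g k l * y l)) = (\<Sum>l<m. (\<Sum>k<m. g i k * minv m g k l) * y l)"
    unfolding sum_distrib_left sum_distrib_right by (subst sum.swap) (simp add: mult.assoc)
  also have "\<dots> = (\<Sum>l<m. (if i = l then 1 else 0) * y l)"
    using minv(1)[OF assms] by (intro sum.cong) auto
  finally show "(\<Sum>k<m. g i k * (\<Sum>l<m. minv m g k l * y l)) = y i"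
    using sum_delta_lessThan(2)[OF assms(2)] by simp
  have "(\<Sum>k<m. minv m g i k * (\<Sum>l<m. g k l * y l)) = (\<Sum>l<m. (\<Sum>k<m. minv m g i k * g k l) * y l)"
    unfolding sum_distrib_left sum_distrib_right by (subst sum.swap) (simp add: mult.assoc)
  also have "\<dots> = (\<Sum>l<m. (if i = l then 1 else 0) * y l)"
    using minv(2)[OF assms] by (intro sum.cong) auto
  finally show "(\<Sum>k<m. minv m g i k * (\<Sum>l<m. g k l * y l)) = y i"
    using sum_delta_lessThan(2)[OF assms(2)] by simp
qed

lemma row_cancel:
  assumes "det (fmat m g) \<noteq> 0" "\<And>k. k < m \<Longrightarrow> (\<Sum>i<m. y i * g i k) = (\<Sum>i<m. z i * g i k)" "j < m"
  shows "y j = z j"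
proof -
  have "(\<Sum>k<m. (\<Sum>i<m. y i * g i k) * minv m g k j) = (\<Sum>k<m. (\<Sum>i<m. z i * g i k) * minv m g k j)"
    using assms(2) by (intro sum.cong) auto
  then show ?thesis
    using minv_row[OF assms(1,3), of y] minv_row[OF assms(1,3), of z] by simp
qed

lemma col_cancel:
  assumes "det (fmat m g) \<noteq> 0" "\<And>k. k < m \<Longrightarrow> (\<Sum>i<m. g k i * y i) = (\<Sum>i<m. g k i * z i)" "j < m"
  shows "y j = z j"
proof -
  have "(\<Sum>k<m. minv m g j k * (\<Sum>i<m. g k i * y i)) = (\<Sum>k<m. minv m g j k * (\<Sum>i<m. g k i * z i))"
    using assms(2) by (intro sum.cong) auto
  then show ?thesis
    using minv_col(2)[OF assms(1,3), of y] minv_col(2)[OF assms(1,3), of z] by simp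
qed

lemma det_nonzero_colI:
  assumes "\<And>y j. (\<And>i. i < m \<Longrightarrow> (\<Sum>k<m. g i k * y k) = 0) \<Longrightarrow> j < m \<Longrightarrow> y j = 0"
  shows "det (fmat m g) \<noteq> 0"
proof
  assume "det (fmat m g) = 0"
  then obtain v where v: "v \<in> carrier_vec m" "v \<noteq> 0\<^sub>v m" "fmat m g *\<^sub>v v = 0\<^sub>v m"
    unfolding det_0_iff_vec_prod_zero_field[OF fmat_carrier] by (elim exE conjE)
  have "(\<Sum>k<m. g i k * v $ k) = 0" if "i < m" for i
  proof -
    have "(fmat m g *\<^sub>v v) $ i = (\<Sum>k<m. g i k * v $ k)"
      using v(1) that by (auto simp: scalar_prod_def atLeast0LessThan intro!: sum.cong)
    then show ?thesis using v(3) that by simp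
  qed
  then have "v $ j = 0" if "j < m" for j
    using that by (rule assms[where y = "\<lambda>k. v $ k"])
  then have "v = 0\<^sub>v m" using v(1) by (intro eq_vecI) auto
  then show False using v(2) by simp
qed

lemma det_nonzero_rowI:
  assumes "\<And>y j. (\<And>k. k < m \<Longrightarrow> (\<Sum>i<m. y i * g i k) = 0) \<Longrightarrow> j < m \<Longrightarrow> y j = 0"
  shows "det (fmat m g) \<noteq> 0"
proof -
  have "det (fmat m (\<lambda>i j. g j i)) \<noteq> 0"
  proof (rule det_nonzero_colI)
    fix y j assume *: "\<And>i. i < m \<Longrightarrow> (\<Sum>k<m. g k i * y k) = 0" "j < m"
    show "y j = 0"
      by (rule assms[where y = y and j = j, OF _ *(2)]) (use *(1) in \<open>simp add: mult.commute\<close>)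
  qed
  moreover have "fmat m (\<lambda>i j. g j i) = transpose_mat (fmat m g)"
    by (rule eq_matI) auto
  ultimately show ?thesis by (simp add: det_transpose[OF fmat_carrier])
qed

text \<open>After clearing denominators, the left-hand sides become values of a polynomial of degree at
  most \<open>m\<close> at \<open>m + 1\<close> points.\<close>

lemma cauchy_kernel:
  fixes \<nu> \<mu> c :: "nat \<Rightarrow> complex"
  assumes \<nu>: "inj_on \<nu> {..<m}" and \<mu>: "inj_on \<mu> {..<Suc m}"
    and ne: "\<And>i j. i < m \<Longrightarrow> j < Suc m \<Longrightarrow> \<nu> i \<noteq> \<mu> j"
    and eq: "\<And>j. j < Suc m \<Longrightarrow> (\<Sum>k<m. c k / (\<mu> j - \<nu> k)) + d = 0"
  shows "(\<forall>k<m. c k = 0) \<and> d = 0"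
proof -
  define q where "q A = (\<Prod>l\<in>A. [:- \<nu> l, 1:])" for A
  have qpoly: "poly (q A) x = (\<Prod>l\<in>A. x - \<nu> l)" for A x
    by (simp add: q_def poly_prod)
  have qdeg: "degree (q A) \<le> m" if "A \<subseteq> {..<m}" for A
  proof -
    have "degree (q A) \<le> (\<Sum>l\<in>A. degree [:- \<nu> l, 1:])"
      unfolding q_def using that finite_subset by (intro degree_prod_sum_le[unfolded o_def]) auto
    also have "\<dots> = card A" by simp
    also have "\<dots> \<le> card {..<m}" using that by (intro card_mono) auto
    finally show ?thesis by simp
  qed
  define p where "p = Polynomial.smult d (q {..<m}) + (\<Sum>k<m. Polynomial.smult (c k) (q ({..<m} - {k})))"
  have "poly p x = 0" if x: "x \<in> \<mu> ` {..<Suc m}" for x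
  proof -
    obtain j where j: "j < Suc m" "x = \<mu> j" using x by auto
    have nz: "x - \<nu> k \<noteq> 0" if "k < m" for k using ne[OF that j(1)] j(2) by simp
    have "poly (q ({..<m} - {k})) x = poly (q {..<m}) x / (x - \<nu> k)" if "k < m" for k
      using nz[OF that] that by (simp add: qpoly prod.remove[of "{..<m}" k])
    then have "poly p x = poly (q {..<m}) x * ((\<Sum>k<m. c k / (x - \<nu> k)) + d)"
      by (simp add: p_def poly_sum distrib_left sum_distrib_left mult.commute)
    then show ?thesis using eq[OF j(1)] j(2) by simp
  qed
  moreover have "degree p \<le> m"
    unfolding p_def
    by (intro degree_add_le degree_sum_le order.trans[OF degree_smult_le] qdeg) auto
  moreover have "card (\<mu> ` {..<Suc m}) = Suc m" using card_image[OF \<mu>] by simp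
  ultimately have p0: "p = 0" by (intro poly_eqI_degree[of "\<mu> ` {..<Suc m}"]) auto
  have c: "c k = 0" if k: "k < m" for k
  proof -
    have "poly (q A) (\<nu> k) = 0" if "k \<in> A" "finite A" for A
      unfolding qpoly using that by (intro prod_zero) auto
    \<comment> \<open>At \<open>\<nu> k\<close> all summands of \<open>p\<close> but one contain the
      factor \<open>x - \<nu> k\<close>.\<close>
    then have "poly p (\<nu> k) = c k * poly (q ({..<m} - {k})) (\<nu> k)"
      using k by (simp add: p_def poly_sum sum.remove[of "{..<m}" k])
    moreover have "poly (q ({..<m} - {k})) (\<nu> k) \<noteq> 0"
      unfolding qpoly using \<nu> k by (auto simp: inj_on_def)
    ultimately show ?thesis using p0 by simp
  qed
  moreover have "d = 0" using eq[of 0] c by simp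
  ultimately show ?thesis by simp
qed

section \<open>From the eigenvectors of one leading block to those of the next\<close>

definition eig_step ::
    "nat \<Rightarrow> (nat \<Rightarrow> complex) \<Rightarrow> (nat \<Rightarrow> complex) \<Rightarrow> (nat \<Rightarrow> complex) \<Rightarrow>
      (nat \<Rightarrow> nat \<Rightarrow> complex) \<Rightarrow> nat \<Rightarrow> nat \<Rightarrow> complex" where
  "eig_step m \<nu> \<mu> b g i j = (if i < m then \<Sum>k<m. g i k * (b k / (\<mu> j - \<nu> k)) else 1)"

text \<open>Exhibits a combination of rows as a rational function of \<open>\<mu> j\<close> with
  simple poles at the \<open>\<nu> k\<close> and constant term \<open>y m\<close>, the shape handled
  by \<open>cauchy_kernel\<close>.\<close>

lemma sum_eig_step:
  "(\<Sum>i<Suc m. y i * eig_step m \<nu> \<mu> b g i j) =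
    (\<Sum>k<m. (\<Sum>i<m. y i * g i k) * (b k / (\<mu> j - \<nu> k))) + y m"
proof -
  have "(\<Sum>i<m. y i * eig_step m \<nu> \<mu> b g i j) = (\<Sum>i<m. \<Sum>k<m. y i * g i k * (b k / (\<mu> j - \<nu> k)))"
    by (intro sum.cong) (auto simp: eig_step_def sum_distrib_left mult.assoc)
  also have "\<dots> = (\<Sum>k<m. (\<Sum>i<m. y i * g i k) * (b k / (\<mu> j - \<nu> k)))"
    unfolding sum_distrib_right by (rule sum.swap)
  finally show ?thesis by (simp add: eig_step_def)
qed

text \<open>If the row vector \<open>y\<close> annihilates all columns, the products of
  \<open>(y g)_k\<close> with \<open>b k\<close> satisfy the relations of
  \<open>cauchy_kernel\<close>. They vanish together with \<open>y m\<close>; dividing by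
  \<open>b k\<close> and cancelling \<open>g\<close> leaves \<open>y = 0\<close>.\<close>

lemma det_eig_step:
  assumes "inj_on \<nu> {..<m}" "inj_on \<mu> {..<Suc m}" "\<And>i j. i < m \<Longrightarrow> j < Suc m \<Longrightarrow> \<nu> i \<noteq> \<mu> j"
    and b: "\<And>k. k < m \<Longrightarrow> b k \<noteq> 0" and g: "det (fmat m g) \<noteq> 0"
  shows "det (fmat (Suc m) (eig_step m \<nu> \<mu> b g)) \<noteq> 0"
proof (rule det_nonzero_rowI)
  fix y j
  assume y: "\<And>j. j < Suc m \<Longrightarrow> (\<Sum>i<Suc m. y i * eig_step m \<nu> \<mu> b g i j) = 0" and j: "j < Suc m"
  have "(\<forall>k<m. (\<Sum>i<m. y i * g i k) * b k = 0) \<and> y m = 0"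
  proof (rule cauchy_kernel[OF assms(1-3)])
    fix j assume "j < Suc m"
    from y[OF this] show "(\<Sum>k<m. (\<Sum>i<m. y i * g i k) * b k / (\<mu> j - \<nu> k)) + y m = 0"
      unfolding sum_eig_step by simp
  qed
  then have yb: "(\<Sum>i<m. y i * g i k) * b k = 0" if "k < m" for k
    using that by blast
  have "(\<Sum>i<m. y i * g i k) = (\<Sum>i<m. 0 * g i k)" if "k < m" for k
    using yb[OF that] b[OF that] by simp
  then have "y i = 0" if "i < m" for i
    using that by (rule row_cancel[OF g, where z = "\<lambda>_. 0"])
  then show "y j = 0"
    using j \<open>_ \<and> y m = 0\<close> by (cases "j = m") auto
qed

text \<open>\<open>g\<close> is a matrix of eigenvectors of the upper left \<open>m \<times> m\<close> block of \<open>x\<close>.\<close>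

definition eigmat ::
    "nat \<Rightarrow> (nat \<Rightarrow> nat \<Rightarrow> complex) \<Rightarrow> (nat \<Rightarrow> complex) \<Rightarrow> (nat \<Rightarrow> nat \<Rightarrow> complex) \<Rightarrow> bool" where
  "eigmat m x \<nu> g \<longleftrightarrow> (\<forall>i<m. \<forall>j<m. (\<Sum>l<m. x i l * g l j) = g i j * \<nu> j)"

lemma eigmatD: "eigmat m x \<nu> g \<Longrightarrow> i < m \<Longrightarrow> j < m \<Longrightarrow> (\<Sum>l<m. x i l * g l j) = g i j * \<nu> j"
  by (simp add: eigmat_def)

text \<open>In the first \<open>m\<close> rows the eigenvector equation reduces to \<open>\<nu> k /
  (\<mu> j - \<nu> k) + 1 = \<mu> j / (\<mu> j - \<nu> k)\<close>, so it holds whatever the last row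
  of \<open>x\<close> is.\<close>

lemma eig_step_upper_rows:
  assumes x: "eigmat m x \<nu> g" and xm: "x i m = (\<Sum>k<m. g i k * b k)" and i: "i < m" and j: "j < Suc m"
    and ne: "\<And>i j. i < m \<Longrightarrow> j < Suc m \<Longrightarrow> \<nu> i \<noteq> \<mu> j"
  shows "(\<Sum>l<Suc m. x i l * eig_step m \<nu> \<mu> b g l j) = eig_step m \<nu> \<mu> b g i j * \<mu> j"
proof -
  have "(\<Sum>l<Suc m. x i l * eig_step m \<nu> \<mu> b g l j) =
      (\<Sum>k<m. (g i k * \<nu> k) * (b k / (\<mu> j - \<nu> k))) + (\<Sum>k<m. g i k * b k)"
    unfolding sum_eig_step xm using eigmatD[OF x i] by simp
  also have "\<dots> = (\<Sum>k<m. g i k * (b k / (\<mu> j - \<nu> k)) * \<mu> j)"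
    unfolding sum.distrib[symmetric]
  proof (intro sum.cong refl)
    fix k assume "k \<in> {..<m}"
    then have "\<mu> j - \<nu> k \<noteq> 0" using ne[of k j] j by simp
    then show "g i k * \<nu> k * (b k / (\<mu> j - \<nu> k)) + g i k * b k = g i k * (b k / (\<mu> j - \<nu> k)) * \<mu> j"
      by (simp add: field_simps)
  qed
  finally show ?thesis using i by (simp add: eig_step_def sum_distrib_right)
qed

text \<open>Eigenvalues and an invertible eigenvector matrix fix every row of a matrix. The rows
  above the last are compared with those of \<open>x1\<close>, the smaller matrix \<open>x0\<close>
  bordered by the column \<open>g b\<close>, which satisfies the same equations by
  \<open>eig_step_upper_rows\<close>.\<close>

lemma eigmat_eig_step_unique:
  assumes x: "eigmat (Suc m) x \<mu> (eig_step m \<nu> \<mu> b g)"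
    and g': "det (fmat (Suc m) (eig_step m \<nu> \<mu> b g)) \<noteq> 0"
    and x0: "eigmat m x0 \<nu> g" and ne: "\<And>i j. i < m \<Longrightarrow> j < Suc m \<Longrightarrow> \<nu> i \<noteq> \<mu> j"
    and i: "i < m"
  shows "\<And>l. l < m \<Longrightarrow> x i l = x0 i l" "x i m = (\<Sum>k<m. g i k * b k)"
proof -
  define x1 where "x1 i l = (if l = m then \<Sum>k<m. g i k * b k else x0 i l)" for i l
  have x1g: "eigmat m x1 \<nu> g" using x0 by (simp add: eigmat_def x1_def)
  have x1: "(\<Sum>l<Suc m. x1 i l * eig_step m \<nu> \<mu> b g l j) = eig_step m \<nu> \<mu> b g i j * \<mu> j"
    if "j < Suc m" for j
    by (rule eig_step_upper_rows[OF x1g _ i that ne]) (simp_all add: x1_def)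
  have "x i l = x1 i l" if "l < Suc m" for l
    using g' _ that
  proof (rule row_cancel)
    fix j assume "j < Suc m"
    then show "(\<Sum>l<Suc m. x i l * eig_step m \<nu> \<mu> b g l j) = (\<Sum>l<Suc m. x1 i l * eig_step m \<nu> \<mu> b g l j)"
      using x1 eigmatD[OF x, of i j] i by simp
  qed
  then show "\<And>l. l < m \<Longrightarrow> x i l = x0 i l" "x i m = (\<Sum>k<m. g i k * b k)"
    by (auto simp: x1_def)
qed

text \<open>Any eigenvector matrix \<open>P\<close> of the larger block agrees with
  \<open>eig_step\<close> up to scaling of columns: the upper rows give
  \<open>(\<mu> j - \<nu> k) * R k j = b k * P m j\<close>, where \<open>R\<close> holds the
  coordinates with respect to \<open>g\<close>. A zero last entry \<open>P m j\<close> would kill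
  the whole column \<open>j\<close>, and \<open>b k = 0\<close> would kill row \<open>k\<close> of
  \<open>R\<close>; both contradict the invertibility of \<open>P\<close>.\<close>

lemma eigmat_extend:
  assumes x: "eigmat m x \<nu> g" and g: "det (fmat m g) \<noteq> 0"
    and b: "\<And>i. i < m \<Longrightarrow> x i m = (\<Sum>k<m. g i k * b k)"
    and ne: "\<And>i j. i < m \<Longrightarrow> j < Suc m \<Longrightarrow> \<nu> i \<noteq> \<mu> j"
    and P: "eigmat (Suc m) x \<mu> P" "det (fmat (Suc m) P) \<noteq> 0"
  shows "eigmat (Suc m) x \<mu> (eig_step m \<nu> \<mu> b g)"
    and "det (fmat (Suc m) (eig_step m \<nu> \<mu> b g)) \<noteq> 0"
    and "k < m \<Longrightarrow> b k \<noteq> 0"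
proof -
  define R where "R k j = (\<Sum>i<m. minv m g k i * P i j)" for k j
  have PR: "P i j = (\<Sum>k<m. g i k * R k j)" if "i < m" for i j
    unfolding R_def by (rule minv_col(1)[OF g that, symmetric])
  have R: "R k j = b k / (\<mu> j - \<nu> k) * P m j" if k: "k < m" and j: "j < Suc m" for k j
  proof -
    have "\<nu> k * R k j + b k * P m j = \<mu> j * R k j"
      using g _ k
    proof (rule col_cancel)
      fix i assume i: "i < m"
      have "P i j * \<mu> j = (\<Sum>l<m. x i l * P l j) + x i m * P m j"
        using eigmatD[OF P(1), of i j] i j by simp
      also have "(\<Sum>l<m. x i l * P l j) = (\<Sum>l<m. \<Sum>k<m. x i l * g l k * R k j)"
        using PR by (intro sum.cong) (simp_all add: sum_distrib_left mult.assoc)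
      also have "\<dots> = (\<Sum>k<m. (\<Sum>l<m. x i l * g l k) * R k j)"
        unfolding sum_distrib_right by (rule sum.swap)
      also have "\<dots> = (\<Sum>k<m. g i k * (\<nu> k * R k j))"
        using eigmatD[OF x i] by (intro sum.cong) (auto simp: mult.assoc)
      also have "x i m * P m j = (\<Sum>k<m. g i k * (b k * P m j))"
        unfolding b[OF i] by (simp add: sum_distrib_right mult.assoc)
      finally have "(\<Sum>k<m. g i k * (\<nu> k * R k j + b k * P m j)) = P i j * \<mu> j"
        by (simp add: distrib_left sum.distrib)
      also have "\<dots> = (\<Sum>k<m. g i k * (\<mu> j * R k j))"
        unfolding PR[OF i] sum_distrib_right by (simp add: mult_ac)
      finally show "(\<Sum>k<m. g i k * (\<nu> k * R k j + b k * P m j)) = (\<Sum>k<m. g i k * (\<mu> j * R k j))" .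
    qed
    moreover have "\<mu> j - \<nu> k \<noteq> 0" using ne[OF k j] by simp
    ultimately show ?thesis by (simp add: field_simps)
  qed
  have PG: "eig_step m \<nu> \<mu> b g i j * P m j = P i j" if "i < Suc m" "j < Suc m" for i j
  proof (cases "i < m")
    case True
    have "P i j = (\<Sum>k<m. g i k * (b k / (\<mu> j - \<nu> k) * P m j))"
      unfolding PR[OF True] using R that by (intro sum.cong) auto
    then show ?thesis using True by (simp add: eig_step_def sum_distrib_right mult.assoc)
  next
    case False
    then have "i = m" using that by simp
    then show ?thesis by (simp add: eig_step_def)
  qed
  have Pm: "P m j \<noteq> 0" if j: "j < Suc m" for j
  proof
    assume "P m j = 0"
    then have "P k j = 0" if "k < Suc m" for k using PG[OF that j] by simp
    then have "(\<Sum>k<Suc m. minv (Suc m) P j k * P k j) = 0"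
      by (intro sum.neutral) simp
    then show False using minv(2)[OF P(2) j j] by simp
  qed
  show ext: "eigmat (Suc m) x \<mu> (eig_step m \<nu> \<mu> b g)"
    unfolding eigmat_def
  proof (intro allI impI)
    fix i j assume ij: "i < Suc m" "j < Suc m"
    have "(\<Sum>l<Suc m. x i l * eig_step m \<nu> \<mu> b g l j) * P m j = (\<Sum>l<Suc m. x i l * P l j)"
      unfolding sum_distrib_right using PG[OF _ ij(2)] by (intro sum.cong) (auto simp: mult.assoc)
    also have "\<dots> = eig_step m \<nu> \<mu> b g i j * \<mu> j * P m j"
      unfolding eigmatD[OF P(1) ij] by (simp add: PG[OF ij, symmetric])
    finally show "(\<Sum>l<Suc m. x i l * eig_step m \<nu> \<mu> b g l j) = eig_step m \<nu> \<mu> b g i j * \<mu> j"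
      using Pm[OF ij(2)] by simp
  qed
  show "det (fmat (Suc m) (eig_step m \<nu> \<mu> b g)) \<noteq> 0"
  proof (rule det_nonzero_colI)
    fix y j assume y: "\<And>i. i < Suc m \<Longrightarrow> (\<Sum>k<Suc m. eig_step m \<nu> \<mu> b g i k * y k) = 0"
      and j: "j < Suc m"
    have "y j / P m j = 0"
    proof (rule col_cancel[OF P(2) _ j, where y = "\<lambda>k. y k / P m k" and z = "\<lambda>_. 0"])
      fix i assume i: "i < Suc m"
      have "(\<Sum>k<Suc m. P i k * (y k / P m k)) = (\<Sum>k<Suc m. eig_step m \<nu> \<mu> b g i k * y k)"
      proof (intro sum.cong refl)
        fix k assume "k \<in> {..<Suc m}"
        then have k: "k < Suc m" by simp
        show "P i k * (y k / P m k) = eig_step m \<nu> \<mu> b g i k * y k"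
          using Pm[OF k] by (simp add: PG[OF i k, symmetric])
      qed
      then show "(\<Sum>k<Suc m. P i k * (y k / P m k)) = (\<Sum>k<Suc m. P i k * 0)" using y[OF i] by simp
    qed
    then show "y j = 0" using Pm[OF j] by simp
  qed
  assume k: "k < m"
  show "b k \<noteq> 0"
  proof
    assume "b k = 0"
    \<comment> \<open>Row \<open>k\<close> of the inverse of \<open>g\<close>, padded by 0:
      multiplied with \<open>P\<close> it gives row \<open>k\<close> of \<open>R\<close>.\<close>
    define y where "y i = (if i < m then minv m g k i else 0)" for i
    have y0: "y i = 0" if "i < Suc m" for i
      using P(2) _ that
    proof (rule row_cancel[where z = "\<lambda>_. 0"])
      fix j assume j: "j < Suc m"
      have "(\<Sum>i<Suc m. y i * P i j) = R k j" by (simp add: y_def R_def)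
      also have "\<dots> = 0" using R[OF k j] \<open>b k = 0\<close> by simp
      finally show "(\<Sum>i<Suc m. y i * P i j) = (\<Sum>i<Suc m. 0 * P i j)" by simp
    qed
    have "minv m g k i = 0" if "i < m" for i
      using y0[of i] that by (simp add: y_def)
    then have "(\<Sum>i<m. minv m g k i * g i k) = 0"
      by (intro sum.neutral) simp
    then show False using minv(2)[OF g k k] by simp
  qed
qed

section \<open>Conjugacy to a diagonal matrix\<close>

lemma similar_diag_iff:
  "similar_mat (mat_diag m \<nu>) (fmat m x) \<longleftrightarrow> (\<exists>P. det (fmat m P) \<noteq> 0 \<and> eigmat m x \<nu> P)"
proof
  assume "similar_mat (mat_diag m \<nu>) (fmat m x)"
  then obtain n P Q where PQ: "{mat_diag m \<nu>, fmat m x, P, Q} \<subseteq> carrier_mat n n"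
    "P * Q = 1\<^sub>m n" "Q * P = 1\<^sub>m n" "mat_diag m \<nu> = P * fmat m x * Q"
    using similar_matD by blast
  have n: "n = m" using PQ(1) by auto
  then have c: "P \<in> carrier_mat m m" "Q \<in> carrier_mat m m" using PQ(1) by auto
  have Q: "fmat m (\<lambda>i j. Q $$ (i, j)) = Q" using c by (intro eq_matI) auto
  have "det Q * det P = 1" using det_mult[OF c(2,1)] PQ(3) n by simp
  then have "det (fmat m (\<lambda>i j. Q $$ (i, j))) \<noteq> 0" unfolding Q by auto
  moreover have "fmat m x * Q = Q * mat_diag m \<nu>"
  proof -
    have "Q * mat_diag m \<nu> = Q * P * fmat m x * Q"
      unfolding PQ(4) using c by (simp add: assoc_mult_mat[of _ m m _ m _ m])
    then show ?thesis using PQ(3) n c by simp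
  qed
  then have "eigmat m x \<nu> (\<lambda>i j. Q $$ (i, j))"
    unfolding eigmat_def
  proof (intro allI impI)
    fix i j assume eq: "fmat m x * Q = Q * mat_diag m \<nu>" and ij: "i < m" "j < m"
    have "(fmat m x * Q) $$ (i, j) = (\<Sum>l<m. x i l * Q $$ (l, j))"
      using ij c by (auto simp: scalar_prod_def atLeast0LessThan intro!: sum.cong)
    then show "(\<Sum>l<m. x i l * Q $$ (l, j)) = Q $$ (i, j) * \<nu> j"
      unfolding eq mat_diag_mult_right[OF c(2)] using ij by simp
  qed
  ultimately show "\<exists>P. det (fmat m P) \<noteq> 0 \<and> eigmat m x \<nu> P" by blast
next
  assume "\<exists>P. det (fmat m P) \<noteq> 0 \<and> eigmat m x \<nu> P"
  then obtain P where P: "det (fmat m P) \<noteq> 0" "eigmat m x \<nu> P" by blast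
  let ?P = "fmat m P" and ?Q = "fmat m (minv m P)"
  have PQ: "?P * ?Q = 1\<^sub>m m" "?Q * ?P = 1\<^sub>m m"
    unfolding fmat_mult fmat_one[symmetric] using minv[OF P(1)] by (auto intro!: fmat_cong)
  have "fmat m x * ?P = ?P * mat_diag m \<nu>"
    unfolding fmat_mult mat_diag_mult_right[OF fmat_carrier]
    using eigmatD[OF P(2)] by (intro eq_matI) auto
  then have "?Q * fmat m x * ?P = ?Q * (?P * mat_diag m \<nu>)"
    by (simp add: assoc_mult_mat[OF fmat_carrier fmat_carrier fmat_carrier])
  also have "\<dots> = ?Q * ?P * mat_diag m \<nu>"
    by (rule assoc_mult_mat[symmetric, OF fmat_carrier fmat_carrier mat_diag_dim])
  also have "\<dots> = mat_diag m \<nu>" unfolding PQ(2) by (rule left_mult_one_mat[OF mat_diag_dim])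
  finally show "similar_mat (mat_diag m \<nu>) (fmat m x)"
    by (intro similar_matI[OF _ PQ(2,1)]) auto
qed

text \<open>Each root supplies an eigenvector, and eigenvectors for distinct eigenvalues are
  independent. This turns conjugacy into polynomial equations in
  \<open>incidence_eq\<close>.\<close>

lemma eigmat_of_roots:
  assumes \<nu>: "inj_on \<nu> {..<m}"
    and det: "\<And>j. j < m \<Longrightarrow> det (fmat m (\<lambda>a b. x a b - (if a = b then \<nu> j else 0))) = 0"
  shows "\<exists>P. det (fmat m P) \<noteq> 0 \<and> eigmat m x \<nu> P"
proof -
  have "\<exists>v. (\<exists>k<m. v k \<noteq> 0) \<and> (\<forall>i<m. (\<Sum>l<m. x i l * v l) = v i * \<nu> j)" if j: "j < m" for j
  proof (rule ccontr)
    assume *: "\<nexists>v. (\<exists>k<m. v k \<noteq> 0) \<and> (\<forall>i<m. (\<Sum>l<m. x i l * v l) = v i * \<nu> j)"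
    have "det (fmat m (\<lambda>a b. x a b - (if a = b then \<nu> j else 0))) \<noteq> 0"
    proof (rule det_nonzero_colI)
      fix y k assume y: "\<And>i. i < m \<Longrightarrow> (\<Sum>k<m. (x i k - (if i = k then \<nu> j else 0)) * y k) = 0"
        and k: "k < m"
      have "(\<Sum>l<m. x i l * y l) = y i * \<nu> j" if i: "i < m" for i
      proof -
        have "(\<Sum>l<m. (if i = l then \<nu> j else 0) * y l) = y i * \<nu> j"
          using i by (simp add: if_distrib[of "\<lambda>x. x * _"] cong: if_cong)
        then show ?thesis using y[OF i] by (simp add: left_diff_distrib sum_subtractf)
      qed
      then show "y k = 0" using * k by blast
    qed
    then show False using det[OF j] by simp
  qed
  then obtain v where v: "\<And>j. j < m \<Longrightarrow> \<exists>k<m. v j k \<noteq> 0"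
    "\<And>i j. j < m \<Longrightarrow> i < m \<Longrightarrow> (\<Sum>l<m. x i l * v j l) = v j i * \<nu> j"
    by metis
  have ind: "\<forall>j\<in>S. y j = 0"
    if "finite S" "S \<subseteq> {..<m}" "\<And>i. i < m \<Longrightarrow> (\<Sum>j\<in>S. v j i * y j) = 0" for S y
    using that
  proof (induction S arbitrary: y rule: finite_induct)
    case empty
    then show ?case by simp
  next
    case (insert s S)
    \<comment> \<open>Applying \<open>x - \<nu> s\<close> to the relation removes \<open>v s\<close>
      and multiplies every other coefficient by \<open>\<nu> j - \<nu> s\<close>, which is
      nonzero.\<close>
    have "(\<Sum>j\<in>S. v j i * ((\<nu> j - \<nu> s) * y j)) = 0" if i: "i < m" for i
    proof -
      have "(\<Sum>l<m. x i l * (\<Sum>j\<in>insert s S. v j l * y j)) = 0"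
        using insert.prems(2) by (intro sum.neutral) auto
      moreover have "(\<Sum>l<m. x i l * (\<Sum>j\<in>insert s S. v j l * y j)) =
          (\<Sum>j\<in>insert s S. (\<Sum>l<m. x i l * v j l) * y j)"
        unfolding sum_distrib_left sum_distrib_right by (subst sum.swap) (simp add: mult.assoc)
      moreover have "\<dots> = (\<Sum>j\<in>insert s S. v j i * \<nu> j * y j)"
        using v(2) i insert.prems(1) by (intro sum.cong) auto
      ultimately have "(\<Sum>j\<in>insert s S. v j i * \<nu> j * y j) - \<nu> s * (\<Sum>j\<in>insert s S. v j i * y j) = 0"
        using insert.prems(2)[OF i] by simp
      then show ?thesis
        using insert.hyps by (simp add: sum_distrib_left sum_subtractf algebra_simps)
    qed
    then have "\<forall>j\<in>S. (\<nu> j - \<nu> s) * y j = 0"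
      using insert.IH[of "\<lambda>j. (\<nu> j - \<nu> s) * y j"] insert.prems(1) by simp
    moreover have "\<nu> j \<noteq> \<nu> s" if "j \<in> S" for j
      using inj_onD[OF \<nu>, of j s] that insert.hyps(2) insert.prems(1) by auto
    ultimately have S: "\<forall>j\<in>S. y j = 0" by auto
    obtain i where i: "i < m" "v s i \<noteq> 0" using v(1)[of s] insert.prems(1) by auto
    have "(\<Sum>j\<in>insert s S. v j i * y j) = v s i * y s"
      using insert.hyps S by simp
    then have "y s = 0" using insert.prems(2)[OF i(1)] i(2) by simp
    then show ?case using S by simp
  qed
  show ?thesis
  proof (intro exI conjI)
    show "det (fmat m (\<lambda>i j. v j i)) \<noteq> 0"
    proof (rule det_nonzero_colI)
      fix y j assume y: "\<And>i. i < m \<Longrightarrow> (\<Sum>k<m. v k i * y k) = 0" and j: "j < m"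
      have "\<forall>j\<in>{..<m}. y j = 0" by (rule ind[OF finite_lessThan order_refl y])
      from bspec[OF this, of j] show "y j = 0" using j by simp
    qed
    show "eigmat m x \<nu> (\<lambda>i j. v j i)" using v(2) by (simp add: eigmat_def)
  qed
qed

lemma det_eigenvalue_zero:
  assumes P: "eigmat m x \<nu> P" "det (fmat m P) \<noteq> 0" and j: "j < m"
  shows "det (fmat m (\<lambda>a b. x a b - (if a = b then \<nu> j else 0))) = 0"
proof (rule ccontr)
  assume nz: "\<not> ?thesis"
  have "P k j = 0" if "k < m" for k
  proof (rule col_cancel[OF nz _ that, where y = "\<lambda>k. P k j" and z = "\<lambda>_. 0"])
    fix i assume i: "i < m"
    have "(\<Sum>l<m. (if i = l then \<nu> j else 0) * P l j) = P i j * \<nu> j"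
      using i by (simp add: if_distrib[of "\<lambda>x. x * _"] cong: if_cong)
    then show "(\<Sum>k<m. (x i k - (if i = k then \<nu> j else 0)) * P k j) =
        (\<Sum>k<m. (x i k - (if i = k then \<nu> j else 0)) * 0)"
      using eigmatD[OF P(1) i j] by (simp add: left_diff_distrib sum_subtractf)
  qed
  then have "(\<Sum>k<m. minv m P j k * P k j) = 0" by (intro sum.neutral) auto
  then show False using minv(2)[OF P(2) j j] by simp
qed

section \<open>Determinants, inverses and resultants as polynomial functions\<close>

lemma det_poly_funs:
  assumes "\<And>p. A p \<in> carrier_mat m m"
    and "\<And>i j. i < m \<Longrightarrow> j < m \<Longrightarrow> (\<lambda>p. A p $$ (i, j)) \<in> poly_funs I"
  shows "(\<lambda>p. det (A p)) \<in> poly_funs I"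
  unfolding det_def'[OF assms(1)]
proof (intro poly_funs_sum poly_funs.mult poly_funs_prod poly_funs.const)
  fix \<pi> i assume "\<pi> \<in> {\<pi>. \<pi> permutes {0..<m}}" "i \<in> {0..<m}"
  then have "i < m" "\<pi> i < m" using permutes_in_image[of \<pi> "{0..<m}" i] by auto
  then show "(\<lambda>p. A p $$ (i, \<pi> i)) \<in> poly_funs I" by (rule assms(2))
qed

lemma det_fmat_poly_funs:
  assumes "\<And>i j. i < m \<Longrightarrow> j < m \<Longrightarrow> (\<lambda>p. g p i j) \<in> poly_funs I"
  shows "(\<lambda>p. det (fmat m (g p))) \<in> poly_funs I"
  using assms by (intro det_poly_funs[of _ m]) simp_all

text \<open>The determinant is treated first for a generic matrix whose entries are the coordinates;
  fractions are then substituted for them. \<open>minv_frac_funs\<close> repeats this for the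
  adjugate.\<close>

lemma det_fmat_frac_funs:
  assumes "\<And>i j. i < m \<Longrightarrow> j < m \<Longrightarrow> (\<lambda>p. g p i j) \<in> frac_funs I X"
  shows "(\<lambda>p. det (fmat m (g p))) \<in> frac_funs I X"
proof -
  have "(\<lambda>q. det (fmat m (\<lambda>i j. q (i, j)))) \<in> poly_funs ({..<m} \<times> {..<m})"
    by (rule det_fmat_poly_funs) (auto intro: poly_funs.coord)
  from poly_funs_comp_frac[OF this, of "\<lambda>p (i, j). g p i j" I X]
  show ?thesis using assms by auto
qed

lemma minv_frac_funs:
  assumes g: "\<And>i j. i < m \<Longrightarrow> j < m \<Longrightarrow> (\<lambda>p. g p i j) \<in> frac_funs I X"
    and det: "\<And>p. p \<in> X \<Longrightarrow> det (fmat m (g p)) \<noteq> 0" and ij: "i < m" "j < m"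
  shows "(\<lambda>p. minv m (g p) i j) \<in> frac_funs I X"
proof -
  have "(\<lambda>q. det (mat_delete (fmat m (\<lambda>a b. q (a, b))) j i)) \<in> poly_funs ({..<m} \<times> {..<m})"
  proof (rule det_poly_funs)
    show "mat_delete (fmat m (\<lambda>a b. p (a, b))) j i \<in> carrier_mat (m - 1) (m - 1)" for p
      by (simp add: mat_delete_def)
  qed (auto simp: mat_delete_def intro!: poly_funs.coord)
  then have "(\<lambda>q. adj_mat (fmat m (\<lambda>a b. q (a, b))) $$ (i, j)) \<in> poly_funs ({..<m} \<times> {..<m})"
    using ij by (simp add: adj_mat_def cofactor_def poly_funs.mult poly_funs.const)
  from poly_funs_comp_frac[OF this, of "\<lambda>p (a, b). g p a b" I X]
  have "(\<lambda>p. adj_mat (fmat m (g p)) $$ (i, j)) \<in> frac_funs I X" using g by auto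
  then show ?thesis
    unfolding minv_def by (rule frac_funs_divide[OF _ det_fmat_frac_funs[OF g] det])
qed

section \<open>Polynomial dependence of characteristic polynomials and resultants\<close>

definition coeff_poly_funs :: "'i set \<Rightarrow> (('i \<Rightarrow> complex) \<Rightarrow> complex poly) set" where
  "coeff_poly_funs I = {Q. \<forall>k. (\<lambda>p. poly.coeff (Q p) k) \<in> poly_funs I}"

lemma coeff_poly_funsD: "Q \<in> coeff_poly_funs I \<Longrightarrow> (\<lambda>p. poly.coeff (Q p) k) \<in> poly_funs I"
  by (simp add: coeff_poly_funs_def)

lemma coeff_poly_funs_const: "(\<lambda>p. c) \<in> coeff_poly_funs I"
  by (simp add: coeff_poly_funs_def poly_funs.const)

lemma coeff_poly_funs_sum:
  "(\<And>a. a \<in> A \<Longrightarrow> Q a \<in> coeff_poly_funs I) \<Longrightarrow> (\<lambda>p. \<Sum>a\<in>A. Q a p) \<in> coeff_poly_funs I"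
  by (simp add: coeff_poly_funs_def coeff_sum poly_funs_sum)

lemma coeff_poly_funs_mult:
  assumes "Q \<in> coeff_poly_funs I" "R \<in> coeff_poly_funs I"
  shows "(\<lambda>p. Q p * R p) \<in> coeff_poly_funs I"
  unfolding coeff_poly_funs_def mem_Collect_eq coeff_mult
  by (intro allI poly_funs_sum poly_funs.mult coeff_poly_funsD assms)

lemma coeff_poly_funs_prod:
  "(\<And>a. a \<in> A \<Longrightarrow> Q a \<in> coeff_poly_funs I) \<Longrightarrow> (\<lambda>p. \<Prod>a\<in>A. Q a p) \<in> coeff_poly_funs I"
  by (induction A rule: infinite_finite_induct)
    (simp_all add: coeff_poly_funs_const coeff_poly_funs_mult)

lemma char_poly_coeff_poly_funs:
  assumes g: "\<And>i j. i < m \<Longrightarrow> j < m \<Longrightarrow> (\<lambda>p. g p i j) \<in> poly_funs I"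
  shows "(\<lambda>p. char_poly (fmat m (g p))) \<in> coeff_poly_funs I"
  unfolding char_poly_def det_def'[OF char_poly_matrix_closed[OF fmat_carrier]]
proof (intro coeff_poly_funs_sum coeff_poly_funs_mult coeff_poly_funs_prod coeff_poly_funs_const)
  fix \<pi> i assume "\<pi> \<in> {\<pi>. \<pi> permutes {0..<m}}" "i \<in> {0..<m}"
  then have i: "i < m" "\<pi> i < m" using permutes_in_image[of \<pi> "{0..<m}" i] by auto
  have eq: "char_poly_matrix (fmat m (g p)) $$ (i, \<pi> i) = [: - g p i (\<pi> i), if i = \<pi> i then 1 else 0 :]" for p
    using i by (simp add: char_poly_matrix_def)
  show "(\<lambda>p. char_poly_matrix (fmat m (g p)) $$ (i, \<pi> i)) \<in> coeff_poly_funs I"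
    unfolding coeff_poly_funs_def mem_Collect_eq eq
  proof
    fix k
    show "(\<lambda>p. poly.coeff [: - g p i (\<pi> i), if i = \<pi> i then 1 else 0 :] k) \<in> poly_funs I"
      using poly_funs_uminus[OF g[OF i]]
      by (cases k) (simp_all add: poly_funs.const)
  qed
qed

lemma poly_funs_if:
  "(c \<Longrightarrow> f \<in> poly_funs I) \<Longrightarrow> (\<not> c \<Longrightarrow> g \<in> poly_funs I) \<Longrightarrow>
    (\<lambda>p. if c then f p else g p) \<in> poly_funs I"
  by (cases c) simp_all

text \<open>The size of the Sylvester matrix depends on the degrees, so these are required to be
  constant. Characteristic polynomials qualify because they are monic.\<close>

lemma resultant_poly_funs:
  assumes "Q \<in> coeff_poly_funs I" "R \<in> coeff_poly_funs I"
    and "\<And>p. degree (Q p) = a" "\<And>p. degree (R p) = b"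
  shows "(\<lambda>p. resultant (Q p) (R p)) \<in> poly_funs I"
  unfolding resultant_def sylvester_mat_def assms(3,4)
proof (rule det_poly_funs[where m = "a + b"])
  fix i j assume ij: "i < a + b" "j < a + b"
  show "(\<lambda>p. sylvester_mat_sub a b (Q p) (R p) $$ (i, j)) \<in> poly_funs I"
    unfolding sylvester_mat_sub_index[OF ij]
    by (intro poly_funs_if poly_funs.const coeff_poly_funsD assms(1,2))
qed (simp add: carrier_matI)

text \<open>Both sides say that the gcd is not constant, since a nonconstant complex polynomial has
  a root.\<close>

lemma resultant_zero_iff_common_root:
  fixes p q :: "complex poly"
  assumes "p \<noteq> 0"
  shows "resultant p q = 0 \<longleftrightarrow> (\<exists>x. poly p x = 0 \<and> poly q x = 0)"
proof
  assume "resultant p q = 0"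
  then have "degree (gcd p q) \<noteq> 0" by (simp add: resultant_0_gcd)
  then have "\<not> constant (poly (gcd p q))" by (simp add: constant_degree)
  then obtain x where x: "poly (gcd p q) x = 0" using fundamental_theorem_of_algebra by blast
  then have "[:-x, 1:] dvd gcd p q" by (simp only: poly_eq_0_iff_dvd)
  then have "[:-x, 1:] dvd p" "[:-x, 1:] dvd q" by simp_all
  then show "\<exists>x. poly p x = 0 \<and> poly q x = 0"
    by (intro exI[of _ x]) (simp only: poly_eq_0_iff_dvd)
next
  assume "\<exists>x. poly p x = 0 \<and> poly q x = 0"
  then obtain x where "[:-x, 1:] dvd p" "[:-x, 1:] dvd q" by (auto simp: poly_eq_0_iff_dvd)
  then have "[:-x, 1:] dvd gcd p q" by simp
  moreover have "gcd p q \<noteq> 0" using assms by simp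
  ultimately have "degree [:-x, 1:] \<le> degree (gcd p q)" by (rule dvd_imp_degree_le)
  then show "resultant p q = 0" by (simp add: resultant_0_gcd)
qed

text \<open>Counted with multiplicity there are \<open>degree p\<close> roots, so equality means
  that all multiplicities are 1, that is, that \<open>p\<close> and its derivative have no common
  root.\<close>

lemma card_roots_eq_degree_iff:
  fixes p :: "complex poly"
  assumes "p \<noteq> 0"
  shows "card {x. poly p x = 0} = degree p \<longleftrightarrow> resultant p (pderiv p) \<noteq> 0"
proof -
  have set: "set_mset (proots p) = {x. poly p x = 0}" using assms by simp
  have "card {x. poly p x = 0} = degree p \<longleftrightarrow> card (set_mset (proots p)) = size (proots p)"
    unfolding set size_proots_complex ..
  also have "\<dots> \<longleftrightarrow> (\<forall>x\<in>#proots p. count (proots p) x = 1)"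
  proof
    assume "\<forall>x\<in>#proots p. count (proots p) x = 1"
    then show "card (set_mset (proots p)) = size (proots p)"
      by (simp add: size_multiset_overloaded_eq)
  next
    assume *: "card (set_mset (proots p)) = size (proots p)"
    show "\<forall>x\<in>#proots p. count (proots p) x = 1"
    proof (rule ccontr)
      assume "\<not> (\<forall>x\<in>#proots p. count (proots p) x = 1)"
      then obtain x where x: "x \<in># proots p" "count (proots p) x \<noteq> 1" by blast
      then have "1 < count (proots p) x"
        by (metis count_greater_eq_one_iff le_neq_implies_less)
      then have "(\<Sum>y\<in>set_mset (proots p). 1) < (\<Sum>y\<in>set_mset (proots p). count (proots p) y)"
        using x(1) by (intro sum_strict_mono_ex1) (auto simp: count_greater_eq_one_iff)
      then show False using * by (simp add: size_multiset_overloaded_eq)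
    qed
  qed
  also have "\<dots> \<longleftrightarrow> rsquarefree p"
  proof -
    have "(0 < order a p \<longrightarrow> order a p = 1) \<longleftrightarrow> (order a p = 0 \<or> order a p = 1)" for a
      by linarith
    then show ?thesis
      unfolding rsquarefree_def using assms by (simp add: order_root Ball_def)
  qed
  also have "\<dots> \<longleftrightarrow> resultant p (pderiv p) \<noteq> 0"
    unfolding resultant_zero_iff_common_root[OF assms] rsquarefree_roots by blast
  finally show ?thesis .
qed

section \<open>Spectra in terms of resultants\<close>

lemma char_poly_fmat:
  "char_poly (fmat m x) \<noteq> 0" "degree (char_poly (fmat m x)) = m"
  "degree (pderiv (char_poly (fmat m x))) = m - 1"
  using degree_monic_char_poly[OF fmat_carrier, of m x] by (auto simp: degree_pderiv)

lemma spectrum_fmat: "spectrum (fmat m x) = {k. poly (char_poly (fmat m x)) k = 0}"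
  by (rule spectrum_root_char_poly[OF fmat_carrier])

lemma card_spectrum_fmat_iff:
  "card (spectrum (fmat m x)) = m \<longleftrightarrow>
    resultant (char_poly (fmat m x)) (pderiv (char_poly (fmat m x))) \<noteq> 0"
  using card_roots_eq_degree_iff[OF char_poly_fmat(1), of m x]
  unfolding char_poly_fmat(2) spectrum_fmat .

lemma disjoint_spectrum_fmat_iff:
  "spectrum (fmat m x) \<inter> spectrum (fmat k y) = {} \<longleftrightarrow>
    resultant (char_poly (fmat m x)) (char_poly (fmat k y)) \<noteq> 0"
  unfolding resultant_zero_iff_common_root[OF char_poly_fmat(1)] spectrum_fmat by blast

lemma spectrum_similar_diag:
  assumes "similar_mat (mat_diag m \<nu>) (fmat m x)"
  shows "spectrum (fmat m x) = \<nu> ` {..<m}"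
proof -
  have "char_poly (fmat m x) = (\<Prod>a\<leftarrow>diag_mat (mat_diag m \<nu>). [:- a, 1:])"
    using char_poly_similar[OF assms] char_poly_upper_triangular[of "mat_diag m \<nu>" m]
    by (simp add: upper_triangular_def mat_diag_def)
  moreover have "diag_mat (mat_diag m \<nu>) = map \<nu> [0..<m]"
    by (simp add: diag_mat_def mat_diag_def)
  ultimately have "poly (char_poly (fmat m x)) k = 0 \<longleftrightarrow> k \<in> \<nu> ` {..<m}" for k
    by (auto simp: poly_prod_list prod_list_zero_iff image_iff)
  then show ?thesis unfolding spectrum_fmat by auto
qed

section \<open>Reconstruction of a matrix from eigenvalues and borders\<close>

text \<open>
  The border coefficients \<open>b\<close> express the border columns in the eigenbasis of the preceding block;
  \<open>eigrec_of_mat\<close> computes them from the matrix \<open>x\<close> instead of taking them as given.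
\<close>

primrec eigrec ::
    "(nat \<times> nat \<Rightarrow> complex) \<Rightarrow> (nat \<times> nat \<Rightarrow> complex) \<Rightarrow> nat \<Rightarrow> nat \<Rightarrow> nat \<Rightarrow> complex" where
  "eigrec \<nu> b 0 = (\<lambda>i j. 0)"
| "eigrec \<nu> b (Suc m) =
     eig_step m (\<lambda>k. \<nu> (k, m)) (\<lambda>j. \<nu> (j, Suc m)) (\<lambda>k. b (k, m)) (eigrec \<nu> b m)"

primrec eigrec_of_mat ::
    "(nat \<times> nat \<Rightarrow> complex) \<Rightarrow> (nat \<times> nat \<Rightarrow> complex) \<Rightarrow> nat \<Rightarrow> nat \<Rightarrow> nat \<Rightarrow> complex" where
  "eigrec_of_mat \<nu> x 0 = (\<lambda>i j. 0)"
| "eigrec_of_mat \<nu> x (Suc m) =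
     eig_step m (\<lambda>k. \<nu> (k, m)) (\<lambda>j. \<nu> (j, Suc m))
       (\<lambda>k. \<Sum>l<m. minv m (eigrec_of_mat \<nu> x m) k l * x (l, m)) (eigrec_of_mat \<nu> x m)"

text \<open>With indices from 0, column \<open>m\<close> is the one added to the block of size
  \<open>m\<close>. So \<open>(k, m)\<close> with \<open>k < m\<close> belongs to the step from
  \<open>m\<close> to \<open>Suc m\<close>.\<close>

definition border :: "(nat \<times> nat \<Rightarrow> complex) \<Rightarrow> (nat \<times> nat \<Rightarrow> complex) \<Rightarrow> nat \<times> nat \<Rightarrow> complex" where
  "border \<nu> x = (\<lambda>(k, m). \<Sum>l<m. minv m (eigrec_of_mat \<nu> x m) k l * x (l, m))"

lemma eigrec_border: "eigrec \<nu> (border \<nu> x) m = eigrec_of_mat \<nu> x m"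
  by (induction m) (simp_all add: border_def)

lemma eig_step_cong:
  assumes "\<And>k. k < m \<Longrightarrow> b k = b' k"
  shows "eig_step m \<nu> \<mu> b g = eig_step m \<nu> \<mu> b' g"
  using assms by (intro ext) (simp add: eig_step_def)

lemma eigrec_cong:
  "(\<And>k l. k < l \<Longrightarrow> l < m \<Longrightarrow> b (k, l) = b' (k, l)) \<Longrightarrow> eigrec \<nu> b m = eigrec \<nu> b' m"
proof (induction m)
  case (Suc m)
  then have "eigrec \<nu> b m = eigrec \<nu> b' m" by simp
  then show ?case using Suc.prems by (simp add: eig_step_cong[of m "\<lambda>k. b (k, m)" "\<lambda>k. b' (k, m)"])
qed simp

lemma e_OmegaD:
  assumes "\<nu> \<in> e_Omega n" "m < n"
  shows "inj_on (\<lambda>k. \<nu> (k, m)) {..<m}" "inj_on (\<lambda>k. \<nu> (k, Suc m)) {..<Suc m}"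
    "\<And>i j. i < m \<Longrightarrow> j < Suc m \<Longrightarrow> \<nu> (i, m) \<noteq> \<nu> (j, Suc m)"
proof -
  show "inj_on (\<lambda>k. \<nu> (k, m)) {..<m}"
    using assms by (cases "m = 0") (auto simp: e_Omega_def)
  show "inj_on (\<lambda>k. \<nu> (k, Suc m)) {..<Suc m}"
    using assms by (auto simp: e_Omega_def)
  show "\<nu> (i, m) \<noteq> \<nu> (j, Suc m)" if "i < m" "j < Suc m" for i j
    using assms that by (auto simp: e_Omega_def)
qed

lemma det_eigrec:
  assumes \<nu>: "\<nu> \<in> e_Omega n" and b: "\<And>k l. k < l \<Longrightarrow> l < n \<Longrightarrow> b (k, l) \<noteq> 0"
  shows "m \<le> n \<Longrightarrow> det (fmat m (eigrec \<nu> b m)) \<noteq> 0"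
proof (induction m)
  case 0
  show ?case by (rule det_nonzero_colI) simp
next
  case (Suc m)
  then have m: "m < n" by simp
  show ?case
    unfolding eigrec.simps
    by (rule det_eig_step[OF e_OmegaD[OF \<nu> m]]) (use Suc b m in simp_all)
qed

text \<open>The entries of \<open>G D G^{-1}\<close> with \<open>G = eigrec \<nu> b n\<close> and
  \<open>D\<close> the eigenvalues of level \<open>n\<close>. The lower levels enter only through
  \<open>G\<close>.\<close>

definition recon ::
    "(nat \<times> nat \<Rightarrow> complex) \<Rightarrow> (nat \<times> nat \<Rightarrow> complex) \<Rightarrow> nat \<Rightarrow> nat \<Rightarrow> nat \<Rightarrow> complex" where
  "recon \<nu> b n i j = (\<Sum>k<n. eigrec \<nu> b n i k * \<nu> (k, n) * minv n (eigrec \<nu> b n) k j)"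

lemma eigmat_recon:
  assumes "det (fmat n (eigrec \<nu> b n)) \<noteq> 0"
  shows "eigmat n (recon \<nu> b n) (\<lambda>k. \<nu> (k, n)) (eigrec \<nu> b n)"
  unfolding eigmat_def
proof (intro allI impI)
  fix i j assume ij: "i < n" "j < n"
  let ?g = "eigrec \<nu> b n"
  have "(\<Sum>l<n. recon \<nu> b n i l * ?g l j) =
      (\<Sum>k<n. ?g i k * \<nu> (k, n) * (\<Sum>l<n. minv n ?g k l * ?g l j))"
    unfolding recon_def sum_distrib_left sum_distrib_right
    by (subst sum.swap) (simp add: mult.assoc)
  also have "\<dots> = (\<Sum>k<n. ?g i k * \<nu> (k, n) * (if k = j then 1 else 0))"
    using minv(2)[OF assms _ ij(2)] by (intro sum.cong) auto
  also have "\<dots> = ?g i j * \<nu> (j, n)" by (rule sum_delta_lessThan(1)[OF ij(2)])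
  finally show "(\<Sum>l<n. recon \<nu> b n i l * ?g l j) = ?g i j * \<nu> (j, n)" .
qed

text \<open>Downward induction from \<open>m = n\<close>, where \<open>eigmat_recon\<close> applies.
  At each step \<open>eigmat_eig_step_unique\<close> compares the block with
  \<open>recon \<nu> b m\<close>, which has the desired eigenvectors by construction; it yields both
  the agreement of the blocks and the border column.\<close>

lemma recon_blocks:
  assumes \<nu>: "\<nu> \<in> e_Omega n" and b: "\<And>k l. k < l \<Longrightarrow> l < n \<Longrightarrow> b (k, l) \<noteq> 0" and m: "m \<le> n"
  shows "eigmat m (recon \<nu> b n) (\<lambda>k. \<nu> (k, m)) (eigrec \<nu> b m)"
    and "\<And>i. m < n \<Longrightarrow> i < m \<Longrightarrow> recon \<nu> b n i m = (\<Sum>k<m. eigrec \<nu> b m i k * b (k, m))"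
proof -
  have det: "det (fmat m (eigrec \<nu> b m)) \<noteq> 0" if "m \<le> n" for m
    using det_eigrec[where b = b, OF \<nu> b that] .
  have blocks: "(\<forall>i<m. (\<forall>l<m. recon \<nu> b n i l = recon \<nu> b m i l) \<and>
      recon \<nu> b n i m = (\<Sum>k<m. eigrec \<nu> b m i k * b (k, m)))"
    if m: "m < n" and eig: "eigmat (Suc m) (recon \<nu> b n) (\<lambda>k. \<nu> (k, Suc m)) (eigrec \<nu> b (Suc m))" for m
  proof -
    have 0: "eigmat m (recon \<nu> b m) (\<lambda>k. \<nu> (k, m)) (eigrec \<nu> b m)"
      using det[of m] m by (intro eigmat_recon) simp
    have d: "det (fmat (Suc m) (eigrec \<nu> b (Suc m))) \<noteq> 0" using det[of "Suc m"] m by simp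
    show ?thesis
      using eigmat_eig_step_unique[OF eig[unfolded eigrec.simps] d[unfolded eigrec.simps] 0
          e_OmegaD(3)[OF \<nu> m]] by blast
  qed
  have eig: "eigmat m (recon \<nu> b n) (\<lambda>k. \<nu> (k, m)) (eigrec \<nu> b m)" if "m \<le> n" for m
    using that
  proof (induction m rule: inc_induct)
    case base
    show ?case by (rule eigmat_recon[OF det]) simp
  next
    case (step m)
    have "eigmat m (recon \<nu> b m) (\<lambda>k. \<nu> (k, m)) (eigrec \<nu> b m)"
      using det[of m] step.hyps by (intro eigmat_recon) simp
    then show ?case
      using blocks[OF step.hyps(2) step.IH] by (simp add: eigmat_def)
  qed
  show "eigmat m (recon \<nu> b n) (\<lambda>k. \<nu> (k, m)) (eigrec \<nu> b m)" using eig[OF m] .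
  show "recon \<nu> b n i m = (\<Sum>k<m. eigrec \<nu> b m i k * b (k, m))" if "m < n" "i < m" for i
    using blocks[OF that(1) eig] that by simp
qed

text \<open>Upward induction by \<open>eigmat_extend\<close>. Any eigenvector matrix of the larger
  block may serve as \<open>P\<close>, since the normalized one does not depend on it.\<close>

lemma eigrec_of_mat_correct:
  assumes \<nu>: "\<nu> \<in> e_Omega n"
    and P: "\<And>m. 1 \<le> m \<Longrightarrow> m \<le> n \<Longrightarrow>
      \<exists>P. det (fmat m P) \<noteq> 0 \<and> eigmat m (\<lambda>i j. x (i, j)) (\<lambda>k. \<nu> (k, m)) P"
  shows "m \<le> n \<Longrightarrow> det (fmat m (eigrec_of_mat \<nu> x m)) \<noteq> 0 \<and>
      eigmat m (\<lambda>i j. x (i, j)) (\<lambda>k. \<nu> (k, m)) (eigrec_of_mat \<nu> x m)"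
    and "\<And>k. k < m \<Longrightarrow> m < n \<Longrightarrow> border \<nu> x (k, m) \<noteq> 0"
proof -
  have step: "det (fmat (Suc m) (eigrec_of_mat \<nu> x (Suc m))) \<noteq> 0 \<and>
      eigmat (Suc m) (\<lambda>i j. x (i, j)) (\<lambda>k. \<nu> (k, Suc m)) (eigrec_of_mat \<nu> x (Suc m)) \<and>
      (\<forall>k<m. border \<nu> x (k, m) \<noteq> 0)"
    if m: "m < n" and d: "det (fmat m (eigrec_of_mat \<nu> x m)) \<noteq> 0"
      and e: "eigmat m (\<lambda>i j. x (i, j)) (\<lambda>k. \<nu> (k, m)) (eigrec_of_mat \<nu> x m)" for m
  proof -
    obtain P where P: "det (fmat (Suc m) P) \<noteq> 0"
      "eigmat (Suc m) (\<lambda>i j. x (i, j)) (\<lambda>k. \<nu> (k, Suc m)) P"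
      using P[of "Suc m"] m by auto
    have xb: "x (i, m) = (\<Sum>k<m. eigrec_of_mat \<nu> x m i k *
        (\<Sum>l<m. minv m (eigrec_of_mat \<nu> x m) k l * x (l, m)))" if "i < m" for i
      by (rule minv_col(1)[OF d that, symmetric])
    note ext = eigmat_extend[OF e d xb e_OmegaD(3)[OF \<nu> m] P(2,1)]
    show ?thesis using ext by (simp add: border_def)
  qed
  have main: "det (fmat m (eigrec_of_mat \<nu> x m)) \<noteq> 0 \<and>
      eigmat m (\<lambda>i j. x (i, j)) (\<lambda>k. \<nu> (k, m)) (eigrec_of_mat \<nu> x m)" if "m \<le> n" for m
    using that
  proof (induction m)
    case 0
    have "det (fmat 0 (eigrec_of_mat \<nu> x 0)) \<noteq> 0" by (rule det_nonzero_colI) simp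
    then show ?case by (simp add: eigmat_def)
  next
    case (Suc m)
    then show ?case using step[of m] by simp
  qed
  show "m \<le> n \<Longrightarrow> det (fmat m (eigrec_of_mat \<nu> x m)) \<noteq> 0 \<and>
      eigmat m (\<lambda>i j. x (i, j)) (\<lambda>k. \<nu> (k, m)) (eigrec_of_mat \<nu> x m)" by (rule main)
  show "border \<nu> x (k, m) \<noteq> 0" if "k < m" "m < n" for k
    using step[of m] main[of m] that by simp
qed

text \<open>The two recursions differ only in their border coefficients, and inverting the formula
  for the border columns in \<open>recon_blocks(2)\<close> gives back \<open>b\<close>.\<close>

lemma eigrec_of_mat_recon:
  assumes \<nu>: "\<nu> \<in> e_Omega n" and b: "\<And>k l. k < l \<Longrightarrow> l < n \<Longrightarrow> b (k, l) \<noteq> 0"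
    and x: "\<And>i j. i < n \<Longrightarrow> j < n \<Longrightarrow> x (i, j) = recon \<nu> b n i j"
  shows "m \<le> n \<Longrightarrow> eigrec_of_mat \<nu> x m = eigrec \<nu> b m"
    and "k < m \<Longrightarrow> m < n \<Longrightarrow> border \<nu> x (k, m) = b (k, m)"
proof -
  have brd: "(\<Sum>l<m. minv m (eigrec \<nu> b m) k l * x (l, m)) = b (k, m)" if "k < m" "m < n" for k m
  proof -
    have "(\<Sum>l<m. minv m (eigrec \<nu> b m) k l * x (l, m)) =
        (\<Sum>l<m. minv m (eigrec \<nu> b m) k l * (\<Sum>k<m. eigrec \<nu> b m l k * b (k, m)))"
      using that x recon_blocks(2)[where b = b, OF \<nu> b] by (intro sum.cong) simp_all
    also have "\<dots> = b (k, m)"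
      using det_eigrec[where b = b, OF \<nu> b, of m] that by (intro minv_col(2)) simp_all
    finally show ?thesis .
  qed
  have main: "eigrec_of_mat \<nu> x m = eigrec \<nu> b m" if "m \<le> n" for m
    using that
  proof (induction m)
    case (Suc m)
    then have eq: "eigrec_of_mat \<nu> x m = eigrec \<nu> b m" and m: "m < n" by simp_all
    show ?case
      unfolding eigrec.simps eigrec_of_mat.simps eq using brd[OF _ m] by (rule eig_step_cong)
  qed simp
  show "m \<le> n \<Longrightarrow> eigrec_of_mat \<nu> x m = eigrec \<nu> b m" by (rule main)
  show "k < m \<Longrightarrow> m < n \<Longrightarrow> border \<nu> x (k, m) = b (k, m)"
    using main[of m] brd[of k m] by (simp add: border_def)
qed

section \<open>The varieties as sets of coordinate vectors\<close>

lemma pair_coords_inverse: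
  assumes "x \<in> carrier_mat n n"
  shows "pair_coords (\<nu>, x) \<circ> Inl = \<nu>" "mat n n (pair_coords (\<nu>, x) \<circ> Inr) = x"
  using assms by (auto simp: pair_coords_def mat_coords_def fun_eq_iff intro!: eq_matI)

lemma pair_coords_of_parts:
  "p \<in> affine_space (pair_index n) \<Longrightarrow> pair_coords (p \<circ> Inl, mat n n (p \<circ> Inr)) = p"
  by (auto simp: pair_coords_def mat_coords_def fun_eq_iff affine_space_def pair_index_def
      split: sum.splits)

lemma affine_space_Inl:
  "p \<in> affine_space (A <+> B) \<Longrightarrow> p \<circ> Inl \<in> affine_space A"
  by (auto simp: affine_space_def)

lemma mem_pair_coords_image:
  assumes S: "S \<subseteq> affine_space (triangle_index n) \<times> carrier_mat n n"
  shows "p \<in> pair_coords ` S \<longleftrightarrow>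
    p \<in> affine_space (pair_index n) \<and> (p \<circ> Inl, mat n n (p \<circ> Inr)) \<in> S"
proof
  assume "p \<in> pair_coords ` S"
  then obtain \<nu> x where p: "p = pair_coords (\<nu>, x)" "(\<nu>, x) \<in> S" by auto
  then have "(\<nu>, x) \<in> affine_space (triangle_index n) \<times> carrier_mat n n" using S by blast
  then have "p \<in> affine_space (pair_index n)" "x \<in> carrier_mat n n"
    using bij_betwE[OF bij_betw_pair_coords[of n]] p(1) by auto
  then show "p \<in> affine_space (pair_index n) \<and> (p \<circ> Inl, mat n n (p \<circ> Inr)) \<in> S"
    using pair_coords_inverse[of x n \<nu>] p by simp
next
  assume "p \<in> affine_space (pair_index n) \<and> (p \<circ> Inl, mat n n (p \<circ> Inr)) \<in> S"
  then show "p \<in> pair_coords ` S" using pair_coords_of_parts[of p n] by (metis image_eqI)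
qed

definition ambient :: "nat \<Rightarrow> ((nat \<times> nat) + (nat \<times> nat) \<Rightarrow> complex) set" where
  "ambient n = pair_coords ` (e_Omega n \<times> M_Omega n)"

definition incidence :: "nat \<Rightarrow> ((nat \<times> nat) + (nat \<times> nat) \<Rightarrow> complex) set" where
  "incidence n = pair_coords ` M_Omega_e n"

definition entries :: "((nat \<times> nat) + (nat \<times> nat) \<Rightarrow> complex) \<Rightarrow> nat \<Rightarrow> nat \<Rightarrow> complex" where
  "entries p i j = p (Inr (i, j))"

lemma lead_block_entries: "m \<le> n \<Longrightarrow> lead_block (mat n n (p \<circ> Inr)) m = fmat m (entries p)"
  by (rule eq_matI) (auto simp: lead_block_def entries_def)

lemma e_Omega_subset: "e_Omega n \<subseteq> affine_space (triangle_index n)"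
  by (auto simp: e_Omega_def)

lemma M_Omega_subset: "M_Omega n \<subseteq> carrier_mat n n"
  by (auto simp: M_Omega_def)

lemma M_Omega_iff:
  "mat n n (p \<circ> Inr) \<in> M_Omega n \<longleftrightarrow>
    (\<forall>m\<in>{1..n}. card (spectrum (fmat m (entries p))) = m) \<and>
    (\<forall>m\<in>{1..<n}. spectrum (fmat m (entries p)) \<inter> spectrum (fmat (Suc m) (entries p)) = {})"
proof -
  have "(\<forall>m\<in>{1..n}. card (spectrum (lead_block (mat n n (p \<circ> Inr)) m)) = m) \<longleftrightarrow>
      (\<forall>m\<in>{1..n}. card (spectrum (fmat m (entries p))) = m)"
    by (intro ball_cong refl) (simp add: lead_block_entries)
  moreover have "(\<forall>m\<in>{1..<n}. spectrum (lead_block (mat n n (p \<circ> Inr)) m) \<inter>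
        spectrum (lead_block (mat n n (p \<circ> Inr)) (Suc m)) = {}) \<longleftrightarrow>
      (\<forall>m\<in>{1..<n}. spectrum (fmat m (entries p)) \<inter> spectrum (fmat (Suc m) (entries p)) = {})"
    by (intro ball_cong refl) (simp add: lead_block_entries)
  ultimately show ?thesis unfolding M_Omega_def by simp
qed

lemma mem_ambient:
  "p \<in> ambient n \<longleftrightarrow> p \<in> affine_space (pair_index n) \<and> p \<circ> Inl \<in> e_Omega n \<and>
    mat n n (p \<circ> Inr) \<in> M_Omega n"
  unfolding ambient_def
  by (subst mem_pair_coords_image) (use e_Omega_subset M_Omega_subset in auto)

lemma diag_part_eq: "diag_part (p \<circ> Inl) m = mat_diag m (\<lambda>i. p (Inl (i, m)))"
  by (simp add: diag_part_def)

lemma mem_incidence_ambient: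
  "p \<in> incidence n \<longleftrightarrow> p \<in> ambient n \<and>
    (\<forall>m\<in>{1..n}. \<exists>P. det (fmat m P) \<noteq> 0 \<and> eigmat m (entries p) (\<lambda>j. p (Inl (j, m))) P)"
proof -
  have "M_Omega_e n \<subseteq> affine_space (triangle_index n) \<times> carrier_mat n n"
    unfolding M_Omega_e_def using e_Omega_subset M_Omega_subset by blast
  then have "p \<in> incidence n \<longleftrightarrow> p \<in> affine_space (pair_index n) \<and>
      (p \<circ> Inl, mat n n (p \<circ> Inr)) \<in> M_Omega_e n"
    unfolding incidence_def by (rule mem_pair_coords_image)
  also have "\<dots> \<longleftrightarrow> p \<in> ambient n \<and>
      (\<forall>m\<in>{1..n}. similar_mat (diag_part (p \<circ> Inl) m) (fmat m (entries p)))"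
    by (auto simp: mem_ambient M_Omega_e_def lead_block_entries)
  finally show ?thesis
    unfolding diag_part_eq similar_diag_iff .
qed

text \<open>Conjugacy identifies the spectra of the blocks with the sets of eigenvalues, so the
  conditions of \<open>M_Omega\<close> follow from those of \<open>e_Omega\<close>. Points produced
  by the parametrization then only need eigenvector matrices.\<close>

lemma mem_incidence:
  "p \<in> incidence n \<longleftrightarrow> p \<in> affine_space (pair_index n) \<and> p \<circ> Inl \<in> e_Omega n \<and>
    (\<forall>m\<in>{1..n}. \<exists>P. det (fmat m P) \<noteq> 0 \<and> eigmat m (entries p) (\<lambda>j. p (Inl (j, m))) P)"
  (is "_ \<longleftrightarrow> ?A \<and> ?E \<and> ?S")
proof -
  have "mat n n (p \<circ> Inr) \<in> M_Omega n" if E: ?E and S: ?S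
  proof -
    have spec: "spectrum (fmat m (entries p)) = (\<lambda>j. p (Inl (j, m))) ` {..<m}" if "m \<in> {1..n}" for m
      using S that by (intro spectrum_similar_diag) (simp add: similar_diag_iff)
    have "card (spectrum (fmat m (entries p))) = m" if "m \<in> {1..n}" for m
      unfolding spec[OF that] using E that by (subst card_image) (auto simp: e_Omega_def)
    moreover have "spectrum (fmat m (entries p)) \<inter> spectrum (fmat (Suc m) (entries p)) = {}"
      if m: "m \<in> {1..<n}" for m
    proof -
      have "m \<in> {1..n}" "Suc m \<in> {1..n}" using m by auto
      then show ?thesis
        unfolding spec[OF \<open>m \<in> {1..n}\<close>] spec[OF \<open>Suc m \<in> {1..n}\<close>]
        using e_OmegaD(3)[OF E, of m] m by auto
    qed
    ultimately show ?thesis unfolding M_Omega_iff by blast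
  qed
  then show ?thesis unfolding mem_incidence_ambient mem_ambient by blast
qed

text \<open>Only coordinates of the left summand are read, so the same function serves for pairs and
  for parameters.\<close>

definition nu_discr :: "nat \<Rightarrow> ((nat \<times> nat) + 'a \<Rightarrow> complex) \<Rightarrow> complex" where
  "nu_discr n p =
    (\<Prod>m\<in>{1..n}. \<Prod>i<m. \<Prod>j\<in>{..<m} - {i}. p (Inl (i, m)) - p (Inl (j, m))) *
    (\<Prod>m\<in>{1..<n}. \<Prod>i<m. \<Prod>j<Suc m. p (Inl (i, m)) - p (Inl (j, Suc m)))"

text \<open>The first factors are, up to sign, the discriminants of the characteristic polynomials.
  The product is nonzero exactly on \<open>M_Omega\<close>, which is therefore a principal open
  set.\<close>

definition mat_discr :: "nat \<Rightarrow> ((nat \<times> nat) + (nat \<times> nat) \<Rightarrow> complex) \<Rightarrow> complex" where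
  "mat_discr n p =
    (\<Prod>m\<in>{1..n}. resultant (char_poly (fmat m (entries p))) (pderiv (char_poly (fmat m (entries p))))) *
    (\<Prod>m\<in>{1..<n}. resultant (char_poly (fmat m (entries p))) (char_poly (fmat (Suc m) (entries p))))"

lemma e_Omega_iff_discr:
  assumes "p \<circ> Inl \<in> affine_space (triangle_index n)"
  shows "p \<circ> Inl \<in> e_Omega n \<longleftrightarrow> nu_discr n p \<noteq> 0"
proof -
  have inj: "inj_on (\<lambda>i. p (Inl (i, m))) {..<m} \<longleftrightarrow>
      (\<forall>i\<in>{..<m}. \<forall>j\<in>{..<m} - {i}. p (Inl (i, m)) - p (Inl (j, m)) \<noteq> 0)" for m
    by (auto simp: inj_on_def)
  have nz: "prod f A \<noteq> 0 \<longleftrightarrow> (\<forall>a\<in>A. f a \<noteq> 0)" if "finite A" for f :: "nat \<Rightarrow> complex" and A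
    using that by simp
  have "nu_discr n p \<noteq> 0 \<longleftrightarrow>
      (\<forall>m\<in>{1..n}. inj_on (\<lambda>i. p (Inl (i, m))) {..<m}) \<and>
      (\<forall>m\<in>{1..<n}. \<forall>i\<in>{..<m}. \<forall>j\<in>{..<Suc m}. p (Inl (i, m)) - p (Inl (j, Suc m)) \<noteq> 0)"
    unfolding nu_discr_def mult_eq_0_iff de_Morgan_disj inj
    by (simp only: nz finite_atLeastAtMost finite_atLeastLessThan finite_lessThan finite_Diff)
  moreover have "p \<circ> Inl \<in> e_Omega n \<longleftrightarrow>
      (\<forall>m\<in>{1..n}. inj_on (\<lambda>i. p (Inl (i, m))) {..<m}) \<and>
      (\<forall>m\<in>{1..<n}. \<forall>i\<in>{..<m}. \<forall>j\<in>{..<Suc m}. p (Inl (i, m)) - p (Inl (j, Suc m)) \<noteq> 0)"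
    using assms by (simp add: e_Omega_def Ball_def)
  ultimately show ?thesis by (simp only:)
qed

lemma nu_discr_poly_funs:
  assumes "Inl ` triangle_index n \<subseteq> I"
  shows "nu_discr n \<in> poly_funs I"
proof -
  have "Inl (i, m) \<in> I" if "i < m" "m \<le> n" for i m
    using assms that by (auto simp: triangle_index_def)
  then show ?thesis
    unfolding nu_discr_def
    by (intro poly_funs.mult poly_funs_prod poly_funs_diff poly_funs.coord) auto
qed

lemma M_Omega_iff_discr: "mat n n (p \<circ> Inr) \<in> M_Omega n \<longleftrightarrow> mat_discr n p \<noteq> 0"
  unfolding M_Omega_iff mat_discr_def card_spectrum_fmat_iff disjoint_spectrum_fmat_iff by simp

lemma mem_pair_index [simp]:
  "Inl (i, m) \<in> pair_index n \<longleftrightarrow> i < m \<and> m \<le> n"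
  "Inr (i, j) \<in> pair_index n \<longleftrightarrow> i < n \<and> j < n"
  by (auto simp: pair_index_def triangle_index_def)

lemma mat_discr_poly_funs: "mat_discr n \<in> poly_funs (pair_index n)"
proof -
  have c: "(\<lambda>p. char_poly (fmat m (entries p))) \<in> coeff_poly_funs (pair_index n)" if "m \<le> n" for m
    by (rule char_poly_coeff_poly_funs) (use that in \<open>simp add: entries_def poly_funs.coord\<close>)
  have d: "(\<lambda>p. pderiv (char_poly (fmat m (entries p)))) \<in> coeff_poly_funs (pair_index n)"
    if "m \<le> n" for m
    unfolding coeff_poly_funs_def mem_Collect_eq coeff_pderiv
    by (intro allI poly_funs.mult poly_funs.const coeff_poly_funsD[OF c[OF that]])
  show ?thesis
    unfolding mat_discr_def
    by (intro poly_funs.mult poly_funs_prod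
        resultant_poly_funs[OF c d char_poly_fmat(2) char_poly_fmat(3)]
        resultant_poly_funs[OF c c char_poly_fmat(2) char_poly_fmat(2)]) auto
qed

lemma ambient_eq:
  "ambient n = {p \<in> affine_space (pair_index n). nu_discr n p * mat_discr n p \<noteq> 0}"
proof -
  have "p \<circ> Inl \<in> e_Omega n \<longleftrightarrow> nu_discr n p \<noteq> 0" if "p \<in> affine_space (pair_index n)" for p
    by (rule e_Omega_iff_discr[OF affine_space_Inl[OF that[unfolded pair_index_def]]])
  then show ?thesis by (auto simp: mem_ambient M_Omega_iff_discr)
qed

lemma discr_poly_funs: "(\<lambda>p. nu_discr n p * mat_discr n p) \<in> poly_funs (pair_index n)"
  by (intro poly_funs.mult nu_discr_poly_funs mat_discr_poly_funs) (auto simp: pair_index_def)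

lemma openin_nonzero_locus:
  assumes "f \<in> poly_funs I"
  shows "openin (zariski I) {p \<in> affine_space I. f p \<noteq> 0}"
  unfolding openin_zariski zariski_open_def
  by (intro exI[of _ "{f}"] conjI) (use assms in \<open>auto simp: zero_locus_def\<close>)

definition eig_eq ::
    "nat \<times> nat \<Rightarrow> ((nat \<times> nat) + (nat \<times> nat) \<Rightarrow> complex) \<Rightarrow> complex" where
  "eig_eq = (\<lambda>(j, m) p. det (fmat m (\<lambda>a b. entries p a b - (if a = b then p (Inl (j, m)) else 0))))"

lemma eig_eq_poly_funs:
  assumes "jm \<in> triangle_index n"
  shows "eig_eq jm \<in> poly_funs (pair_index n)"
proof -
  obtain j m where jm: "jm = (j, m)" "j < m" "m \<le> n" using assms by (auto simp: triangle_index_def)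
  have "(\<lambda>p. det (fmat m (\<lambda>a b. entries p a b - (if a = b then p (Inl (j, m)) else 0))))
      \<in> poly_funs (pair_index n)"
  proof (rule det_fmat_poly_funs)
    fix a b assume "a < m" "b < m"
    then show "(\<lambda>p. entries p a b - (if a = b then p (Inl (j, m)) else 0)) \<in> poly_funs (pair_index n)"
      unfolding entries_def using jm
      by (intro poly_funs_diff poly_funs_if poly_funs.const poly_funs.coord) simp_all
  qed
  then show ?thesis unfolding jm(1) eig_eq_def by simp
qed

text \<open>On the ambient set the \<open>\<nu>\<close> of each level are distinct. Hence being
  conjugate to the diagonal matrix means that each of them is a root of the characteristic
  polynomial of the block, and closedness is visible.\<close>

lemma incidence_eq: "incidence n = {p \<in> ambient n. \<forall>f\<in>eig_eq ` triangle_index n. f p = 0}"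
proof (intro Set.set_eqI iffI)
  fix p assume p: "p \<in> incidence n"
  then have amb: "p \<in> ambient n" and S: "\<And>m. m \<in> {1..n} \<Longrightarrow>
      \<exists>P. det (fmat m P) \<noteq> 0 \<and> eigmat m (entries p) (\<lambda>j. p (Inl (j, m))) P"
    unfolding mem_incidence_ambient by blast+
  have "eig_eq (j, m) p = 0" if jm: "j < m" "m \<le> n" for j m
  proof -
    obtain P where "det (fmat m P) \<noteq> 0" "eigmat m (entries p) (\<lambda>j. p (Inl (j, m))) P"
      using S[of m] jm by auto
    from det_eigenvalue_zero[OF this(2,1) jm(1)] show ?thesis by (simp add: eig_eq_def)
  qed
  then show "p \<in> {p \<in> ambient n. \<forall>f\<in>eig_eq ` triangle_index n. f p = 0}"
    using amb by (auto simp: triangle_index_def)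
next
  fix p assume p: "p \<in> {p \<in> ambient n. \<forall>f\<in>eig_eq ` triangle_index n. f p = 0}"
  have "\<exists>P. det (fmat m P) \<noteq> 0 \<and> eigmat m (entries p) (\<lambda>j. p (Inl (j, m))) P" if m: "m \<in> {1..n}" for m
  proof (rule eigmat_of_roots)
    show "inj_on (\<lambda>j. p (Inl (j, m))) {..<m}"
      using p m by (simp add: mem_ambient e_Omega_def)
    fix j assume "j < m"
    then have "(j, m) \<in> triangle_index n" using m by (simp add: triangle_index_def)
    then have "eig_eq (j, m) p = 0" using p by blast
    then show "det (fmat m (\<lambda>a b. entries p a b - (if a = b then p (Inl (j, m)) else 0))) = 0"
      by (simp add: eig_eq_def)
  qed
  then show "p \<in> incidence n" using p unfolding mem_incidence_ambient by blast
qed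

lemma finite_triangle_index: "finite (triangle_index n)"
  by (rule finite_subset[of _ "{..n} \<times> {..n}"]) (auto simp: triangle_index_def)

lemma finite_pair_index: "finite (pair_index n)"
  unfolding pair_index_def by (intro finite_Plus finite_triangle_index) simp

section \<open>The parametrization\<close>

text \<open>The right summand carries the border coefficients with \<open>k < m < n\<close>, which
  explains \<open>n - 1\<close>. The total number is d(n) + d(n-1) = n^2.\<close>

definition param_index :: "nat \<Rightarrow> ((nat \<times> nat) + (nat \<times> nat)) set" where
  "param_index n = triangle_index n <+> triangle_index (n - 1)"

lemma mem_param_index:
  "Inl (i, m) \<in> param_index n \<longleftrightarrow> i < m \<and> m \<le> n"
  "n > 0 \<Longrightarrow> Inr (k, m) \<in> param_index n \<longleftrightarrow> k < m \<and> m < n"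
  by (auto simp: param_index_def triangle_index_def)

lemma card_triangle_index: "card (triangle_index (Suc n)) = card (triangle_index n) + Suc n"
proof -
  have "triangle_index (Suc n) = triangle_index n \<union> (\<lambda>i. (i, Suc n)) ` {..<Suc n}"
    by (auto simp: triangle_index_def le_Suc_eq)
  moreover have "triangle_index n \<inter> (\<lambda>i. (i, Suc n)) ` {..<Suc n} = {}"
    by (auto simp: triangle_index_def)
  moreover have "card ((\<lambda>i. (i, Suc n)) ` {..<Suc n}) = Suc n"
    by (subst card_image) (auto simp: inj_on_def)
  ultimately show ?thesis by (simp add: card_Un_disjoint finite_triangle_index)
qed

lemma card_param_index: "n > 0 \<Longrightarrow> card (param_index n) = n\<^sup>2"
proof -
  have "card (triangle_index (Suc k)) + card (triangle_index k) = (Suc k)\<^sup>2" for k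
  proof (induction k)
    case 0
    have "triangle_index 0 = {}" by (auto simp: triangle_index_def)
    then show ?case using card_triangle_index[of 0] by simp
  next
    case (Suc k)
    then show ?case
      using card_triangle_index[of "Suc k"] card_triangle_index[of k] by (simp add: power2_eq_square)
  qed
  from this[of "n - 1"] show "n > 0 \<Longrightarrow> ?thesis"
    by (simp add: param_index_def card_Plus finite_triangle_index)
qed

definition params :: "nat \<Rightarrow> ((nat \<times> nat) + (nat \<times> nat) \<Rightarrow> complex) set" where
  "params n = {w \<in> affine_space (param_index n). w \<circ> Inl \<in> e_Omega n \<and>
     (\<forall>k m. k < m \<and> m < n \<longrightarrow> w (Inr (k, m)) \<noteq> 0)}"

lemma openin_params:
  assumes n: "n > 0"
  shows "openin (zariski (param_index n)) (params n)"
proof -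
  define f where "f w = nu_discr n w * (\<Prod>m<n. \<Prod>k<m. w (Inr (k, m)))"
    for w :: "(nat \<times> nat) + (nat \<times> nat) \<Rightarrow> complex"
  have "f \<in> poly_funs (param_index n)"
    unfolding f_def using n
    by (intro poly_funs.mult nu_discr_poly_funs poly_funs_prod poly_funs.coord)
      (auto simp: mem_param_index triangle_index_def)
  moreover have "params n = {w \<in> affine_space (param_index n). f w \<noteq> 0}"
    using e_Omega_iff_discr[OF affine_space_Inl[of _ "triangle_index n"]]
    by (auto simp: params_def f_def param_index_def)
  ultimately show ?thesis using openin_nonzero_locus[of f] by simp
qed

lemma params_nonempty: "params n \<noteq> {}"
proof -
  \<comment> \<open>The injective pairing function makes all eigenvalue coordinates distinct at
    once; the border coefficients are all 1.\<close>
  define w :: "(nat \<times> nat) + (nat \<times> nat) \<Rightarrow> complex" where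
    "w s = (if s \<in> param_index n then
       (case s of Inl (i, m) \<Rightarrow> of_nat (prod_encode (i, m)) | Inr _ \<Rightarrow> 1) else 0)" for s
  have wl: "w (Inl (i, m)) = of_nat (prod_encode (i, m))" if "i < m" "m \<le> n" for i m
    using that by (simp add: w_def mem_param_index)
  have "w \<in> affine_space (param_index n)" by (simp add: w_def affine_space_def)
  moreover from this have "w \<circ> Inl \<in> affine_space (triangle_index n)"
    unfolding param_index_def by (rule affine_space_Inl)
  then have "w \<circ> Inl \<in> e_Omega n"
    by (auto simp: e_Omega_def wl inj_on_def)
  moreover have "w (Inr (k, m)) \<noteq> 0" if "k < m" "m < n" for k m
    using that by (simp add: w_def mem_param_index(2))
  ultimately show ?thesis unfolding params_def by blast
qed

text \<open>The reconstructed entries are cut off outside the index range, because points of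
  \<open>affine_space\<close> vanish there.\<close>

definition to_pair ::
    "nat \<Rightarrow> ((nat \<times> nat) + (nat \<times> nat) \<Rightarrow> complex) \<Rightarrow> (nat \<times> nat) + (nat \<times> nat) \<Rightarrow> complex" where
  "to_pair n w = case_sum (w \<circ> Inl)
     (\<lambda>(i, j). if i < n \<and> j < n then recon (w \<circ> Inl) (w \<circ> Inr) n i j else 0)"

definition to_param ::
    "nat \<Rightarrow> ((nat \<times> nat) + (nat \<times> nat) \<Rightarrow> complex) \<Rightarrow> (nat \<times> nat) + (nat \<times> nat) \<Rightarrow> complex" where
  "to_param n p = case_sum (p \<circ> Inl)
     (\<lambda>(k, m). if k < m \<and> m < n then border (p \<circ> Inl) (p \<circ> Inr) (k, m) else 0)"

lemma to_pair_simps: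
  "to_pair n w \<circ> Inl = w \<circ> Inl" "to_pair n w (Inl s) = w (Inl s)"
  "i < n \<Longrightarrow> j < n \<Longrightarrow> to_pair n w (Inr (i, j)) = recon (w \<circ> Inl) (w \<circ> Inr) n i j"
  "\<not> (i < n \<and> j < n) \<Longrightarrow> to_pair n w (Inr (i, j)) = 0"
  by (auto simp: to_pair_def fun_eq_iff)

lemma to_param_simps:
  "to_param n p \<circ> Inl = p \<circ> Inl" "to_param n p (Inl s) = p (Inl s)"
  "k < m \<Longrightarrow> m < n \<Longrightarrow> to_param n p (Inr (k, m)) = border (p \<circ> Inl) (p \<circ> Inr) (k, m)"
  "\<not> (k < m \<and> m < n) \<Longrightarrow> to_param n p (Inr (k, m)) = 0"
  by (auto simp: to_param_def fun_eq_iff)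

lemma paramsD:
  assumes "w \<in> params n"
  shows "w \<circ> Inl \<in> e_Omega n" "\<And>k l. k < l \<Longrightarrow> l < n \<Longrightarrow> (w \<circ> Inr) (k, l) \<noteq> 0"
    "w \<in> affine_space (param_index n)"
  using assms by (auto simp: params_def)

lemma incidence_eigmat:
  assumes "p \<in> incidence n"
  shows "p \<circ> Inl \<in> e_Omega n"
    and "\<And>m. 1 \<le> m \<Longrightarrow> m \<le> n \<Longrightarrow>
      \<exists>P. det (fmat m P) \<noteq> 0 \<and> eigmat m (\<lambda>i j. (p \<circ> Inr) (i, j)) (\<lambda>k. (p \<circ> Inl) (k, m)) P"
  using assms by (auto simp: mem_incidence entries_def[abs_def])

lemma eigmat_cong:
  "(\<And>i j. i < m \<Longrightarrow> j < m \<Longrightarrow> x i j = x' i j) \<Longrightarrow> eigmat m x \<nu> g \<longleftrightarrow> eigmat m x' \<nu> g"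
  by (simp add: eigmat_def)

lemma to_pair_incidence:
  assumes w: "w \<in> params n"
  shows "to_pair n w \<in> incidence n"
  unfolding mem_incidence to_pair_simps(1)
proof (intro conjI ballI paramsD(1)[OF w])
  show "to_pair n w \<in> affine_space (pair_index n)"
    unfolding affine_space_def mem_Collect_eq
  proof (intro allI impI)
    fix s assume s: "s \<notin> pair_index n"
    show "to_pair n w s = 0"
    proof (cases s)
      case (Inl a)
      moreover obtain i m where "a = (i, m)" by (cases a)
      ultimately show ?thesis
        using s paramsD(3)[OF w] by (simp add: to_pair_simps affine_space_def mem_param_index)
    next
      case (Inr a)
      moreover obtain i m where "a = (i, m)" by (cases a)
      ultimately show ?thesis using s by (simp add: to_pair_simps)
    qed
  qed
next
  fix m assume m: "m \<in> {1..n}"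
  have mn: "m \<le> n" using m by simp
  show "\<exists>P. det (fmat m P) \<noteq> 0 \<and> eigmat m (entries (to_pair n w)) (\<lambda>j. to_pair n w (Inl (j, m))) P"
  proof (intro exI conjI)
    show "det (fmat m (eigrec (w \<circ> Inl) (w \<circ> Inr) m)) \<noteq> 0"
      by (rule det_eigrec[where b = "w \<circ> Inr", OF paramsD(1,2)[OF w] mn])
    have "eigmat m (entries (to_pair n w)) (\<lambda>j. (w \<circ> Inl) (j, m)) (eigrec (w \<circ> Inl) (w \<circ> Inr) m) \<longleftrightarrow>
        eigmat m (recon (w \<circ> Inl) (w \<circ> Inr) n) (\<lambda>j. (w \<circ> Inl) (j, m)) (eigrec (w \<circ> Inl) (w \<circ> Inr) m)"
      using mn by (intro eigmat_cong) (simp add: entries_def to_pair_simps)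
    then show "eigmat m (entries (to_pair n w)) (\<lambda>j. to_pair n w (Inl (j, m)))
        (eigrec (w \<circ> Inl) (w \<circ> Inr) m)"
      using recon_blocks(1)[where b = "w \<circ> Inr", OF paramsD(1,2)[OF w] mn] by (simp add: to_pair_simps)
  qed
qed

lemma to_param_params:
  assumes n: "n > 0" and p: "p \<in> incidence n"
  shows "to_param n p \<in> params n"
proof -
  have pA: "p \<in> affine_space (pair_index n)" using p by (simp add: mem_incidence)
  have "to_param n p s = 0" if s: "s \<notin> param_index n" for s
  proof (cases s)
    case (Inl a)
    moreover obtain i m where "a = (i, m)" by (cases a)
    ultimately show ?thesis
      using s pA by (simp add: to_param_simps affine_space_def mem_param_index)
  next
    case (Inr a)
    moreover obtain i m where "a = (i, m)" by (cases a)
    ultimately show ?thesis using s n by (simp add: to_param_simps mem_param_index)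
  qed
  moreover have "to_param n p (Inr (k, m)) \<noteq> 0" if "k < m" "m < n" for k m
    using eigrec_of_mat_correct(2)[where \<nu> = "p \<circ> Inl" and x = "p \<circ> Inr", OF incidence_eigmat[OF p] that] that
    by (simp add: to_param_simps)
  ultimately show ?thesis
    using incidence_eigmat(1)[OF p] by (simp add: params_def affine_space_def to_param_simps)
qed

lemma to_param_to_pair:
  assumes n: "n > 0" and w: "w \<in> params n"
  shows "to_param n (to_pair n w) = w"
proof
  fix s
  show "to_param n (to_pair n w) s = w s"
  proof (cases s)
    case (Inl a)
    then show ?thesis by (simp add: to_param_simps to_pair_simps)
  next
    case (Inr a)
    moreover obtain k m where a: "a = (k, m)" by (cases a)
    moreover have "to_param n (to_pair n w) (Inr (k, m)) = w (Inr (k, m))"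
    proof (cases "k < m \<and> m < n")
      case True
      have "border (w \<circ> Inl) (to_pair n w \<circ> Inr) (k, m) = (w \<circ> Inr) (k, m)"
        by (rule eigrec_of_mat_recon(2)[where b = "w \<circ> Inr", OF paramsD(1,2)[OF w]])
          (use True in \<open>simp_all add: to_pair_simps\<close>)
      then show ?thesis using True by (simp add: to_param_simps to_pair_simps)
    next
      case False
      then have "Inr (k, m) \<notin> param_index n" using n by (simp add: mem_param_index)
      then show ?thesis using False paramsD(3)[OF w] by (simp add: to_param_simps affine_space_def)
    qed
    ultimately show ?thesis by simp
  qed
qed

text \<open>The given matrix and its reconstruction share the invertible eigenvector matrix and the
  eigenvalues of level \<open>n\<close>, so they agree row by row.\<close>

lemma to_pair_to_param:
  assumes p: "p \<in> incidence n"
  shows "to_pair n (to_param n p) = p"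
proof
  let ?\<nu> = "p \<circ> Inl" and ?x = "p \<circ> Inr" and ?b = "to_param n p \<circ> Inr"
  let ?g = "eigrec_of_mat ?\<nu> ?x n"
  note c = eigrec_of_mat_correct(1)[where \<nu> = "p \<circ> Inl" and x = "p \<circ> Inr", OF incidence_eigmat[OF p] order_refl]
  \<comment> \<open>\<open>?b\<close> is \<open>border\<close> cut off to the indices with
    \<open>k < m < n\<close>, the only ones that the recursion up to level \<open>n\<close>
    reads.\<close>
  have g: "eigrec ?\<nu> ?b n = ?g"
    unfolding eigrec_border[symmetric] by (rule eigrec_cong) (simp add: to_param_simps)
  have r: "eigmat n (recon ?\<nu> ?b n) (\<lambda>k. ?\<nu> (k, n)) ?g"
    using eigmat_recon[of n ?\<nu> ?b] c unfolding g by blast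
  have eq: "recon ?\<nu> ?b n i j = p (Inr (i, j))" if ij: "i < n" "j < n" for i j
  proof (rule row_cancel[where g = ?g and m = n and y = "recon ?\<nu> ?b n i" and z = "\<lambda>j. p (Inr (i, j))"])
    show "det (fmat n ?g) \<noteq> 0" using c by blast
    fix k assume k: "k < n"
    show "(\<Sum>l<n. recon ?\<nu> ?b n i l * ?g l k) = (\<Sum>l<n. p (Inr (i, l)) * ?g l k)"
      using eigmatD[OF r ij(1) k] eigmatD[OF conjunct2[OF c] ij(1) k] by simp
  qed (rule ij(2))
  fix s
  show "to_pair n (to_param n p) s = p s"
  proof (cases s)
    case (Inl a)
    then show ?thesis by (simp add: to_param_simps to_pair_simps)
  next
    case (Inr a)
    moreover obtain i j where a: "a = (i, j)" by (cases a)
    moreover have "to_pair n (to_param n p) (Inr (i, j)) = p (Inr (i, j))"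
    proof (cases "i < n \<and> j < n")
      case True
      then show ?thesis using eq by (simp add: to_pair_simps to_param_simps)
    next
      case False
      then have "Inr (i, j) \<notin> pair_index n" by simp
      moreover have "p \<in> affine_space (pair_index n)" using p by (simp add: mem_incidence)
      ultimately show ?thesis using False by (simp add: to_pair_simps affine_space_def)
    qed
    ultimately show ?thesis by simp
  qed
qed

section \<open>Both maps of the parametrization are given by fractions\<close>

lemma eig_step_frac_funs:
  assumes "\<And>i k. i < m \<Longrightarrow> k < m \<Longrightarrow> (\<lambda>p. g p i k) \<in> frac_funs I X"
    and "\<And>k. k < m \<Longrightarrow> (\<lambda>p. b p k) \<in> frac_funs I X"
    and "\<And>k. k < m \<Longrightarrow> (\<lambda>p. \<nu> p k) \<in> frac_funs I X"
    and "(\<lambda>p. \<mu> p j) \<in> frac_funs I X"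
    and "\<And>p k. p \<in> X \<Longrightarrow> k < m \<Longrightarrow> \<nu> p k \<noteq> \<mu> p j"
  shows "(\<lambda>p. eig_step m (\<nu> p) (\<mu> p) (b p) (g p) i j) \<in> frac_funs I X"
proof (cases "i < m")
  case True
  have "(\<lambda>p. \<Sum>k<m. g p i k * (b p k / (\<mu> p j - \<nu> p k))) \<in> frac_funs I X"
  proof (rule frac_funs_sum)
    fix k assume "k \<in> {..<m}"
    then have k: "k < m" by simp
    have nz: "\<mu> p j - \<nu> p k \<noteq> 0" if "p \<in> X" for p using assms(5)[OF that k] by simp
    show "(\<lambda>p. g p i k * (b p k / (\<mu> p j - \<nu> p k))) \<in> frac_funs I X"
      by (rule frac_funs_mult[OF assms(1)[OF True k]
            frac_funs_divide[OF assms(2)[OF k] frac_funs_diff[OF assms(4) assms(3)[OF k]] nz]])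
  qed
  then show ?thesis using True by (simp add: eig_step_def)
next
  case False
  then show ?thesis by (simp add: eig_step_def frac_funs_const)
qed

lemma eigrec_frac_funs:
  assumes n: "n > 0"
  shows "m \<le> n \<Longrightarrow> i < m \<Longrightarrow> j < m \<Longrightarrow>
    (\<lambda>w. eigrec (w \<circ> Inl) (w \<circ> Inr) m i j) \<in> frac_funs (param_index n) (params n)"
proof (induction m arbitrary: i j)
  case (Suc m)
  then have m: "m < n" by simp
  show ?case
    unfolding eigrec.simps
  proof (rule eig_step_frac_funs)
    show "(\<lambda>w. eigrec (w \<circ> Inl) (w \<circ> Inr) m i k) \<in> frac_funs (param_index n) (params n)"
      if "i < m" "k < m" for i k by (rule Suc.IH) (use that m in linarith)+
  next
    fix k assume "k < m"
    then show "(\<lambda>w. (w \<circ> Inr) (k, m)) \<in> frac_funs (param_index n) (params n)"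
      "(\<lambda>w. (w \<circ> Inl) (k, m)) \<in> frac_funs (param_index n) (params n)"
      using m n by (simp_all add: frac_funs_coord mem_param_index)
  next
    show "(\<lambda>w. (w \<circ> Inl) (j, Suc m)) \<in> frac_funs (param_index n) (params n)"
      using Suc.prems m by (simp add: frac_funs_coord mem_param_index)
  next
    fix w k assume "w \<in> params n" "k < m"
    then show "(w \<circ> Inl) (k, m) \<noteq> (w \<circ> Inl) (j, Suc m)"
      using e_OmegaD(3)[OF paramsD(1) m] Suc.prems(3) by blast
  qed
qed simp

lemma to_pair_frac_funs:
  assumes n: "n > 0" and s: "s \<in> pair_index n"
  shows "(\<lambda>w. to_pair n w s) \<in> frac_funs (param_index n) (params n)"
proof (cases s)
  case (Inl a)
  moreover obtain i m where "a = (i, m)" by (cases a)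
  ultimately show ?thesis using s by (simp add: to_pair_simps frac_funs_coord mem_param_index)
next
  case (Inr a)
  moreover obtain i j where a: "a = (i, j)" by (cases a)
  ultimately have ij: "i < n" "j < n" using s by simp_all
  let ?F = "frac_funs (param_index n) (params n)"
  have g: "(\<lambda>w. eigrec (w \<circ> Inl) (w \<circ> Inr) n i j) \<in> ?F" if "i < n" "j < n" for i j
    using eigrec_frac_funs[OF n order_refl that] .
  have "(\<lambda>w. recon (w \<circ> Inl) (w \<circ> Inr) n i j) \<in> ?F"
    unfolding recon_def
  proof (rule frac_funs_sum)
    fix k assume "k \<in> {..<n}"
    then have k: "k < n" by simp
    have v: "(\<lambda>w. (w \<circ> Inl) (k, n)) \<in> ?F"
      using k by (simp add: frac_funs_coord mem_param_index)
    have d: "det (fmat n (eigrec (w \<circ> Inl) (w \<circ> Inr) n)) \<noteq> 0" if "w \<in> params n" for w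
      by (rule det_eigrec[where b = "w \<circ> Inr", OF paramsD(1,2)[OF that] order_refl])
    have mi: "(\<lambda>w. minv n (eigrec (w \<circ> Inl) (w \<circ> Inr) n) k j) \<in> ?F"
      by (rule minv_frac_funs[OF g d k ij(2)])
    show "(\<lambda>w. eigrec (w \<circ> Inl) (w \<circ> Inr) n i k * (w \<circ> Inl) (k, n) *
        minv n (eigrec (w \<circ> Inl) (w \<circ> Inr) n) k j) \<in> ?F"
      by (rule frac_funs_mult[OF frac_funs_mult[OF g[OF ij(1) k] v] mi])
  qed
  then show ?thesis using Inr a ij by (simp add: to_pair_simps)
qed

text \<open>The fraction property of level \<open>m\<close> is a hypothesis, so that the lemma can
  be used inside the induction for \<open>eigrec_of_mat\<close> and once more afterwards for
  \<open>to_param\<close>.\<close>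

lemma border_coeff_frac_funs:
  assumes g: "\<And>i j. i < m \<Longrightarrow> j < m \<Longrightarrow>
      (\<lambda>p. eigrec_of_mat (p \<circ> Inl) (p \<circ> Inr) m i j) \<in> frac_funs (pair_index n) (incidence n)"
    and k: "k < m" and m: "m < n"
  shows "(\<lambda>p. \<Sum>l<m. minv m (eigrec_of_mat (p \<circ> Inl) (p \<circ> Inr) m) k l * (p \<circ> Inr) (l, m))
    \<in> frac_funs (pair_index n) (incidence n)"
proof (rule frac_funs_sum)
  fix l assume "l \<in> {..<m}"
  then have l: "l < m" by simp
  have d: "det (fmat m (eigrec_of_mat (p \<circ> Inl) (p \<circ> Inr) m)) \<noteq> 0" if "p \<in> incidence n" for p
    using eigrec_of_mat_correct(1)[where \<nu> = "p \<circ> Inl" and x = "p \<circ> Inr", OF incidence_eigmat[OF that], of m] m by simp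
  have x: "(\<lambda>p. (p \<circ> Inr) (l, m)) \<in> frac_funs (pair_index n) (incidence n)"
    using l m by (simp add: frac_funs_coord)
  show "(\<lambda>p. minv m (eigrec_of_mat (p \<circ> Inl) (p \<circ> Inr) m) k l * (p \<circ> Inr) (l, m))
      \<in> frac_funs (pair_index n) (incidence n)"
    by (rule frac_funs_mult[OF minv_frac_funs[OF g d k l] x])
qed

lemma eigrec_of_mat_frac_funs:
  "m \<le> n \<Longrightarrow> i < m \<Longrightarrow> j < m \<Longrightarrow>
    (\<lambda>p. eigrec_of_mat (p \<circ> Inl) (p \<circ> Inr) m i j) \<in> frac_funs (pair_index n) (incidence n)"
proof (induction m arbitrary: i j)
  case (Suc m)
  then have m: "m < n" by simp
  have IH: "(\<lambda>p. eigrec_of_mat (p \<circ> Inl) (p \<circ> Inr) m i k) \<in> frac_funs (pair_index n) (incidence n)"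
    if "i < m" "k < m" for i k by (rule Suc.IH) (use that m in linarith)+
  show ?case
    unfolding eigrec_of_mat.simps
  proof (rule eig_step_frac_funs[OF IH border_coeff_frac_funs[OF IH _ m]])
    fix k assume "k < m"
    then show "(\<lambda>p. (p \<circ> Inl) (k, m)) \<in> frac_funs (pair_index n) (incidence n)"
      using m by (simp add: frac_funs_coord)
  next
    show "(\<lambda>p. (p \<circ> Inl) (j, Suc m)) \<in> frac_funs (pair_index n) (incidence n)"
      using Suc.prems m by (simp add: frac_funs_coord)
  next
    fix p k assume "p \<in> incidence n" "k < m"
    then show "(p \<circ> Inl) (k, m) \<noteq> (p \<circ> Inl) (j, Suc m)"
      using e_OmegaD(3)[OF incidence_eigmat(1) m] Suc.prems(3) by blast
  qed
qed simp

lemma to_param_frac_funs: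
  assumes n: "n > 0" and s: "s \<in> param_index n"
  shows "(\<lambda>p. to_param n p s) \<in> frac_funs (pair_index n) (incidence n)"
proof (cases s)
  case (Inl a)
  moreover obtain i m where "a = (i, m)" by (cases a)
  ultimately show ?thesis using s by (simp add: to_param_simps frac_funs_coord mem_param_index)
next
  case (Inr a)
  moreover obtain k m where a: "a = (k, m)" by (cases a)
  ultimately have km: "k < m" "m < n" using s n by (simp_all add: mem_param_index)
  have "(\<lambda>p. border (p \<circ> Inl) (p \<circ> Inr) (k, m)) \<in> frac_funs (pair_index n) (incidence n)"
    unfolding border_def prod.case
    by (rule border_coeff_frac_funs[OF eigrec_of_mat_frac_funs km]) (use km in simp_all)
  then show ?thesis using Inr a km by (simp add: to_param_simps)
qed

theorem theorem4p9:
  fixes n :: nat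
  assumes "n > 0"
  shows "affine_variety (pair_index n) (pair_coords ` (e_Omega n \<times> M_Omega n)) \<and>
         nonsingular (pair_index n) (pair_coords ` (e_Omega n \<times> M_Omega n)) \<and>
         closedin (subtopology (zariski (pair_index n)) (pair_coords ` (e_Omega n \<times> M_Omega n)))
           (pair_coords ` M_Omega_e n) \<and>
         affine_variety (pair_index n) (pair_coords ` M_Omega_e n) \<and>
         nonsingular (pair_index n) (pair_coords ` M_Omega_e n) \<and>
         krull_dim (subtopology (zariski (pair_index n)) (pair_coords ` M_Omega_e n)) = enat (n\<^sup>2)"
proof -
  let ?I = "pair_index n" and ?J = "param_index n"
  let ?D = "\<lambda>p. nu_discr n p * mat_discr n p"
  have J: "finite ?J"
    unfolding param_index_def by (intro finite_Plus finite_triangle_index)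
  have XA: "ambient n \<subseteq> affine_space ?I" and YA: "incidence n \<subseteq> affine_space ?I"
    by (auto simp: mem_ambient mem_incidence)
  have X: "openin (zariski ?I) (ambient n)"
    unfolding ambient_eq by (rule openin_nonzero_locus[OF discr_poly_funs])
  have to_pair: "to_pair n ` params n \<subseteq> incidence n" using to_pair_incidence by blast
  have to_param: "to_param n ` incidence n \<subseteq> params n" using to_param_params[OF assms] by blast
  note Y = parametrized_variety[OF finite_pair_index J openin_params[OF assms] params_nonempty YA
      to_pair to_pair_frac_funs[OF assms] to_param to_param_frac_funs[OF assms]
      to_param_to_pair[OF assms] to_pair_to_param]
  \<comment> \<open>The parameters also supply a point of the ambient set, since their images lie in
    the incidence set.\<close>
  have "ambient n \<noteq> {}"
    using params_nonempty[of n] to_pair incidence_eq[of n] by auto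
  \<comment> \<open>Being Zariski open, the ambient set is parametrized by itself through the
    identity.\<close>
  have X': "irreducible_space (subtopology (zariski ?I) (ambient n))" "nonsingular ?I (ambient n)"
    using parametrized_variety(1,3)[OF finite_pair_index finite_pair_index X \<open>ambient n \<noteq> {}\<close> XA,
        of "\<lambda>p. p" "\<lambda>p. p"]
    by (simp_all add: frac_funs_coord)
  have F: "eig_eq ` triangle_index n \<subseteq> poly_funs ?I" using eig_eq_poly_funs by blast
  have "affine_variety ?I (ambient n)"
    by (rule affine_varietyI[where F = "{}" and f = ?D, OF finite_pair_index discr_poly_funs _ _ X'(1)])
      (simp_all add: ambient_eq)
  moreover have "affine_variety ?I (incidence n)"
    by (rule affine_varietyI[where F = "eig_eq ` triangle_index n" and f = ?D,
          OF finite_pair_index discr_poly_funs F _ Y(1)])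
      (auto simp: incidence_eq ambient_eq)
  moreover have "closedin (subtopology (zariski ?I) (ambient n)) (incidence n)"
    unfolding closedin_subtopology_zariski[OF XA] using F incidence_eq
    by (intro exI[of _ "eig_eq ` triangle_index n"] conjI)
  ultimately show ?thesis
    using X'(2) Y(2,3) card_param_index[OF assms] unfolding ambient_def incidence_def by simp
qed

end
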